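(* Let $\tau$ be a set. There is a fully faithful functor from the category of $\mathcal{W}_\tau$-algebras (operad functors $H:\mathcal{W}_\tau\to\mathbf{Set}$, with natural transformations as morphisms) to the category of strict symmetric monoidal categories whose objects are the $\tau$-typed finite sets, with identity-on-objects symmetric monoidal functors as morphisms. On objects it sends $H$ to the symmetric monoidal category $\mathcal{C}$ with $\mathcal{C}(\mathbf{t}_-,\mathbf{t}_+)=H(\mathbf{t}_-,\mathbf{t}_+)$, identity on $A$ the image of $H(\mathsf{unit}_A):1\to H(A,A)$, composition $H(\mathsf{seq}_{(A,B,C)}):H(A,B)\times H(B,C)\to H(A,C)$, and monoidal product of morphisms $H(\mathsf{para}):H(A,B)\times H(A',B')\to H(A\oplus A',B\oplus B')$.
   Context: Fix a set $\tau$ of types. A $\tau$-typed finite set is a finite set $X$ with a map $X\to\tau$; $\mathbf{Bij}_\tau$ is the category of $\tau$-typed finite sets and type-preserving bijections, and $\oplus$ denotes disjoint union of typed sets. $\mathbf{Set}$ is regarded as an operad via its cartesian monoidal structure. The operad $\mathcal{W}_\tau$ of acyclic wiring diagrams is defined as follows. Objects ("boxes"): pairs $\mathbf{t}=(\mathbf{t}_-,\mathbf{t}_+)$ of $\tau$-typed finite sets (inputs and outputs). Morphisms ("wiring diagrams") $\Phi:\mathbf{t}^1,\dots,\mathbf{t}^n\to\mathbf{v}$: isomorphism classes of spans in $\mathbf{Bij}_\tau$ $$\mathbf{v}_-\oplus\mathbf{t}_+\xleftarrow{\Phi_{\mathrm{src}}}\omega\xrightarrow{\Phi_{\mathrm{tgt}}}\mathbf{t}_-\oplus\mathbf{v}_+,$$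 where $\mathbf{t}_\pm=\bigoplus_{i=1}^n\mathbf{t}^i_\pm$; elements of $\omega$ are wires. They satisfy the progress condition: setting $\mathbf{t}^i\prec\mathbf{t}^j$ whenever some wire $A$ has $\Phi_{\mathrm{src}}(A)\in\mathbf{t}^i_+$ and $\Phi_{\mathrm{tgt}}(A)\in\mathbf{t}^j_-$, the result must be a partial order on the inner boxes (no directed cycles). Identity on $\mathbf{t}$: the identity span on $\mathbf{t}_-\oplus\mathbf{t}_+$. Partial composition: given $\Psi:\mathbf{s}^1,\dots,\mathbf{s}^m\to\mathbf{t}^i$ and $\Phi:\mathbf{t}^1,\dots,\mathbf{t}^n\to\mathbf{v}$, the composite $\Psi\,;_i\,\Phi:\mathbf{t}^1,\dots,\mathbf{t}^{i-1},\mathbf{s}^1,\dots,\mathbf{s}^m,\mathbf{t}^{i+1},\dots,\mathbf{t}^n\to\mathbf{v}$ has, with $\mathbf{u}_-=\mathbf{v}_-\oplus\bigoplus_{j\ne i}\mathbf{t}^j_+$, $\mathbf{u}_+=\bigoplus_{j\neq i}\mathbf{t}^j_-\oplus\mathbf{v}_+$, $\mathbf{s}_\pm=\bigoplus_k\mathbf{s}^k_\pm$, the following wires (obtained by fusing wires through the ports of $\mathbf{t}^i$): (i) from $\mathbf{u}_-$ to $\mathbf{s}_-$: a $\Phi$-wire from $\mathbf{u}_-$ to $p\in\mathbf{t}^i_-$ followed by the $\Psi$-wire from $p$ to $\mathbf{s}_-$; (ii) from $\mathbf{u}_-$ to $\mathbf{u}_+$: the $\Phi$-wires between them, and chains $\Phi$-wire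 $\mathbf{u}_-\to p\in\mathbf{t}^i_-$, $\Psi$-wire $p\to q\in\mathbf{t}^i_+$, $\Phi$-wire $q\to\mathbf{u}_+$; (iii) from $\mathbf{s}_+$ to $\mathbf{s}_-$: the $\Psi$-wires between them; (iv) from $\mathbf{s}_+$ to $\mathbf{u}_+$: a $\Psi$-wire $\mathbf{s}_+\to q\in\mathbf{t}^i_+$ followed by the $\Phi$-wire $q\to\mathbf{u}_+$. Special diagrams: $\mathsf{unit}_A:()\to(A,A)$ is the $0$-ary diagram connecting each input of the outer box identically to the corresponding output; $\mathsf{seq}_{(A,B,C)}:(A,B),(B,C)\to(A,C)$ connects outer inputs $A$ to the first box's inputs, the first box's outputs $B$ to the second box's inputs $B$, and the second box's outputs to the outer outputs $C$, all identically; $\mathsf{para}:(A,B),(A',B')\to(A\oplus A',B\oplus B')$ connects outer inputs $A,A'$ identically to the inputs of the first and second box, and their outputs $B,B'$ identically to the outer outputs.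
   Formalization: Typed finite sets are taken to be finite ordinals with a map to τ (words in τ), with ⊕ as concatenation: for arbitrary finite sets ⊕ is not strictly associative, and with a non-skeletal strict choice fullness fails, since bijections between distinct singletons need not be preserved. *)

theory Defs
  imports Main "HOL-Library.FuncSet" "HOL-Combinatorics.Permutations"
begin

section \<open>Categories\<close>

text \<open>
  As in HOL-Algebra, structures are records whose values outside the carriers are irrelevant;
  structure-preserving maps are extensional, so that they can be compared by equality.
  Composition is written in diagrammatic order: \<open>Comp C a b c f g\<close> is \<open>f\<close> followed by \<open>g\<close>.
\<close>

record ('o, 'm) category =
  Obj :: "'o set"
  Hom :: "'o \<Rightarrow> 'o \<Rightarrow> 'm set"
  Idt :: "'o \<Rightarrow> 'm"
  Comp :: "'o \<Rightarrow> 'o \<Rightarrow> 'o \<Rightarrow> 'm \<Rightarrow> 'm \<Rightarrow> 'm"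

locale category =
  fixes C :: "('o, 'm, 'x) category_scheme"
  assumes Idt_in_Hom: "a \<in> Obj C \<Longrightarrow> Idt C a \<in> Hom C a a"
    and Comp_in_Hom:
      "\<lbrakk>a \<in> Obj C; b \<in> Obj C; c \<in> Obj C; f \<in> Hom C a b; g \<in> Hom C b c\<rbrakk>
        \<Longrightarrow> Comp C a b c f g \<in> Hom C a c"
    and Comp_Idt_left:
      "\<lbrakk>a \<in> Obj C; b \<in> Obj C; f \<in> Hom C a b\<rbrakk> \<Longrightarrow> Comp C a a b (Idt C a) f = f"
    and Comp_Idt_right:
      "\<lbrakk>a \<in> Obj C; b \<in> Obj C; f \<in> Hom C a b\<rbrakk> \<Longrightarrow> Comp C a b b f (Idt C b) = f"
    and Comp_assoc:
      "\<lbrakk>a \<in> Obj C; b \<in> Obj C; c \<in> Obj C; d \<in> Obj C;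
        f \<in> Hom C a b; g \<in> Hom C b c; h \<in> Hom C c d\<rbrakk>
        \<Longrightarrow> Comp C a c d (Comp C a b c f g) h = Comp C a b d f (Comp C b c d g h)"

locale cat_functor = A: category A + B: category B
  for A :: "('o, 'm, 'x) category_scheme" and B :: "('p, 'n, 'y) category_scheme" +
  fixes F :: "'o \<Rightarrow> 'p" and F' :: "'o \<Rightarrow> 'o \<Rightarrow> 'm \<Rightarrow> 'n"
  assumes functor_Obj: "a \<in> Obj A \<Longrightarrow> F a \<in> Obj B"
    and functor_Hom:
      "\<lbrakk>a \<in> Obj A; b \<in> Obj A; f \<in> Hom A a b\<rbrakk> \<Longrightarrow> F' a b f \<in> Hom B (F a) (F b)"
    and functor_Idt: "a \<in> Obj A \<Longrightarrow> F' a a (Idt A a) = Idt B (F a)"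
    and functor_Comp:
      "\<lbrakk>a \<in> Obj A; b \<in> Obj A; c \<in> Obj A; f \<in> Hom A a b; g \<in> Hom A b c\<rbrakk>
        \<Longrightarrow> F' a c (Comp A a b c f g) = Comp B (F a) (F b) (F c) (F' a b f) (F' b c g)"

definition fully_faithful ::
  "('o, 'm, 'x) category_scheme \<Rightarrow> ('p, 'n, 'y) category_scheme
    \<Rightarrow> ('o \<Rightarrow> 'p) \<Rightarrow> ('o \<Rightarrow> 'o \<Rightarrow> 'm \<Rightarrow> 'n) \<Rightarrow> bool" where
  "fully_faithful A B F F' \<longleftrightarrow>
    (\<forall>a\<in>Obj A. \<forall>b\<in>Obj A. bij_betw (F' a b) (Hom A a b) (Hom B (F a) (F b)))"


section \<open>Strict symmetric monoidal categories\<close>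

text \<open>\<open>Tensor C a b a' b' f g\<close> is the product of \<open>f : a \<rightarrow> b\<close> and \<open>g : a' \<rightarrow> b'\<close>.\<close>

record ('o, 'm) smc = "('o, 'm) category" +
  UnitOb :: "'o"
  TensorOb :: "'o \<Rightarrow> 'o \<Rightarrow> 'o"
  Tensor :: "'o \<Rightarrow> 'o \<Rightarrow> 'o \<Rightarrow> 'o \<Rightarrow> 'm \<Rightarrow> 'm \<Rightarrow> 'm"
  Braid :: "'o \<Rightarrow> 'o \<Rightarrow> 'm"

locale strict_symmetric_monoidal_category = category C
  for C :: "('o, 'm, 'x) smc_scheme" +
  assumes UnitOb_in_Obj: "UnitOb C \<in> Obj C"
    and TensorOb_in_Obj: "\<lbrakk>a \<in> Obj C; b \<in> Obj C\<rbrakk> \<Longrightarrow> TensorOb C a b \<in> Obj C"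
    and TensorOb_unit_left: "a \<in> Obj C \<Longrightarrow> TensorOb C (UnitOb C) a = a"
    and TensorOb_unit_right: "a \<in> Obj C \<Longrightarrow> TensorOb C a (UnitOb C) = a"
    and TensorOb_assoc:
      "\<lbrakk>a \<in> Obj C; b \<in> Obj C; c \<in> Obj C\<rbrakk>
        \<Longrightarrow> TensorOb C (TensorOb C a b) c = TensorOb C a (TensorOb C b c)"
    and Tensor_in_Hom:
      "\<lbrakk>a \<in> Obj C; b \<in> Obj C; a' \<in> Obj C; b' \<in> Obj C; f \<in> Hom C a b; g \<in> Hom C a' b'\<rbrakk>
        \<Longrightarrow> Tensor C a b a' b' f g \<in> Hom C (TensorOb C a a') (TensorOb C b b')"
    and Tensor_Idt:
      "\<lbrakk>a \<in> Obj C; b \<in> Obj C\<rbrakk>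
        \<Longrightarrow> Tensor C a a b b (Idt C a) (Idt C b) = Idt C (TensorOb C a b)"
    and Tensor_Comp:
      "\<lbrakk>a \<in> Obj C; b \<in> Obj C; c \<in> Obj C; a' \<in> Obj C; b' \<in> Obj C; c' \<in> Obj C;
        f \<in> Hom C a b; g \<in> Hom C b c; f' \<in> Hom C a' b'; g' \<in> Hom C b' c'\<rbrakk>
        \<Longrightarrow> Tensor C a c a' c' (Comp C a b c f g) (Comp C a' b' c' f' g') =
            Comp C (TensorOb C a a') (TensorOb C b b') (TensorOb C c c')
              (Tensor C a b a' b' f f') (Tensor C b c b' c' g g')"
    and Tensor_unit_left:
      "\<lbrakk>a \<in> Obj C; b \<in> Obj C; f \<in> Hom C a b\<rbrakk>
        \<Longrightarrow> Tensor C (UnitOb C) (UnitOb C) a b (Idt C (UnitOb C)) f = f"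
    and Tensor_unit_right:
      "\<lbrakk>a \<in> Obj C; b \<in> Obj C; f \<in> Hom C a b\<rbrakk>
        \<Longrightarrow> Tensor C a b (UnitOb C) (UnitOb C) f (Idt C (UnitOb C)) = f"
    and Tensor_assoc:
      "\<lbrakk>a \<in> Obj C; b \<in> Obj C; a' \<in> Obj C; b' \<in> Obj C; a'' \<in> Obj C; b'' \<in> Obj C;
        f \<in> Hom C a b; g \<in> Hom C a' b'; h \<in> Hom C a'' b''\<rbrakk>
        \<Longrightarrow> Tensor C (TensorOb C a a') (TensorOb C b b') a'' b'' (Tensor C a b a' b' f g) h =
            Tensor C a b (TensorOb C a' a'') (TensorOb C b' b'') f (Tensor C a' b' a'' b'' g h)"
    and Braid_in_Hom:
      "\<lbrakk>a \<in> Obj C; b \<in> Obj C\<rbrakk> \<Longrightarrow> Braid C a b \<in> Hom C (TensorOb C a b) (TensorOb C b a)"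
    and Braid_natural:
      "\<lbrakk>a \<in> Obj C; b \<in> Obj C; a' \<in> Obj C; b' \<in> Obj C; f \<in> Hom C a b; g \<in> Hom C a' b'\<rbrakk>
        \<Longrightarrow> Comp C (TensorOb C a a') (TensorOb C b b') (TensorOb C b' b)
              (Tensor C a b a' b' f g) (Braid C b b') =
            Comp C (TensorOb C a a') (TensorOb C a' a) (TensorOb C b' b)
              (Braid C a a') (Tensor C a' b' a b g f)"
    and Braid_symmetry:
      "\<lbrakk>a \<in> Obj C; b \<in> Obj C\<rbrakk>
        \<Longrightarrow> Comp C (TensorOb C a b) (TensorOb C b a) (TensorOb C a b) (Braid C a b) (Braid C b a)
          = Idt C (TensorOb C a b)"
    and Braid_hexagon:
      "\<lbrakk>a \<in> Obj C; b \<in> Obj C; c \<in> Obj C\<rbrakk>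
        \<Longrightarrow> Braid C a (TensorOb C b c) =
            Comp C (TensorOb C (TensorOb C a b) c) (TensorOb C (TensorOb C b a) c)
                (TensorOb C b (TensorOb C c a))
              (Tensor C (TensorOb C a b) (TensorOb C b a) c c (Braid C a b) (Idt C c))
              (Tensor C b b (TensorOb C a c) (TensorOb C c a) (Idt C b) (Braid C a c))"


section \<open>Operads\<close>

text \<open>
  The structure of a symmetric coloured operad.  \<open>Ops O cs d\<close> are the operations
  \<open>c\<^sub>0, \<dots>, c\<^sub>n\<^sub>-\<^sub>1 \<rightarrow> d\<close>, with arguments indexed from \<open>0\<close>;
  for \<open>g\<close> in \<open>Ops O bs (cs ! i)\<close> and \<open>f\<close> in \<open>Ops O cs d\<close>, \<open>PComp O bs cs d i g f\<close> is the partial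
  composite \<open>g ;\<^sub>i f\<close>; and for \<open>\<pi>\<close> permuting \<open>{..<n}\<close>, \<open>Perm O \<pi> cs d f\<close> is \<open>f\<close> with its arguments
  reordered to \<open>c\<^bsub>\<pi> 0\<^esub>, \<dots>, c\<^bsub>\<pi> (n-1)\<^esub>\<close>.
\<close>

record ('c, 'm) operad =
  Col :: "'c set"
  Ops :: "'c list \<Rightarrow> 'c \<Rightarrow> 'm set"
  OpId :: "'c \<Rightarrow> 'm"
  PComp :: "'c list \<Rightarrow> 'c list \<Rightarrow> 'c \<Rightarrow> nat \<Rightarrow> 'm \<Rightarrow> 'm \<Rightarrow> 'm"
  Perm :: "(nat \<Rightarrow> nat) \<Rightarrow> 'c list \<Rightarrow> 'c \<Rightarrow> 'm \<Rightarrow> 'm"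

definition graft :: "nat \<Rightarrow> 'c list \<Rightarrow> 'c list \<Rightarrow> 'c list" where
  "graft i bs cs = take i cs @ bs @ drop (Suc i) cs"

record ('c, 'm, 'd, 'n) opmap =
  onCol :: "'c \<Rightarrow> 'd"
  onOps :: "'c list \<Rightarrow> 'c \<Rightarrow> 'm \<Rightarrow> 'n"

locale operad_functor =
  fixes P :: "('c, 'm, 'x) operad_scheme" and Q :: "('d, 'n, 'y) operad_scheme"
    and H :: "('c, 'm, 'd, 'n) opmap"
  assumes onCol_in_Col: "c \<in> Col P \<Longrightarrow> onCol H c \<in> Col Q"
    and onOps_in_Ops:
      "\<lbrakk>set cs \<subseteq> Col P; d \<in> Col P; f \<in> Ops P cs d\<rbrakk>
        \<Longrightarrow> onOps H cs d f \<in> Ops Q (map (onCol H) cs) (onCol H d)"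
    and onOps_OpId: "c \<in> Col P \<Longrightarrow> onOps H [c] c (OpId P c) = OpId Q (onCol H c)"
    and onOps_PComp:
      "\<lbrakk>set bs \<subseteq> Col P; set cs \<subseteq> Col P; d \<in> Col P; i < length cs;
        g \<in> Ops P bs (cs ! i); f \<in> Ops P cs d\<rbrakk>
        \<Longrightarrow> onOps H (graft i bs cs) d (PComp P bs cs d i g f) =
            PComp Q (map (onCol H) bs) (map (onCol H) cs) (onCol H d) i
              (onOps H bs (cs ! i) g) (onOps H cs d f)"
    and onOps_Perm:
      "\<lbrakk>set cs \<subseteq> Col P; d \<in> Col P; \<pi> permutes {..<length cs}; f \<in> Ops P cs d\<rbrakk>
        \<Longrightarrow> onOps H (permute_list \<pi> cs) d (Perm P \<pi> cs d f) =
            Perm Q \<pi> (map (onCol H) cs) (onCol H d) (onOps H cs d f)"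

text \<open>\<open>Set\<close> as an operad: operations \<open>X\<^sub>0, \<dots>, X\<^sub>n\<^sub>-\<^sub>1 \<rightarrow> Y\<close> are functions \<open>X\<^sub>0 \<times> \<dots> \<times> X\<^sub>n\<^sub>-\<^sub>1 \<rightarrow> Y\<close>,
  tuples being lists.\<close>

definition Set_operad :: "('a set, 'a list \<Rightarrow> 'a) operad" where
  "Set_operad = \<lparr>
    Col = UNIV,
    Ops = (\<lambda>Xs Y. listset Xs \<rightarrow>\<^sub>E Y),
    OpId = (\<lambda>X. \<lambda>xs\<in>listset [X]. hd xs),
    PComp = (\<lambda>Ws Xs Y i g f. \<lambda>xs\<in>listset (graft i Ws Xs).
      f (take i xs @ [g (take (length Ws) (drop i xs))] @ drop (i + length Ws) xs)),
    Perm = (\<lambda>\<pi> Xs Y f. \<lambda>ys\<in>listset (permute_list \<pi> Xs). f (permute_list (inv \<pi>) ys)) \<rparr>"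


section \<open>Acyclic wiring diagrams\<close>

text \<open>
  For the symmetric monoidal categories on typed finite sets to be strict, \<open>\<oplus>\<close> has to be strictly
  associative and unital.  A typed finite set is therefore taken to be a finite ordinal
  \<open>{..<n}\<close> with a map to the types, i.e. a list of types, and \<open>\<oplus>\<close> is concatenation, with the
  inclusions \<open>p \<mapsto> p\<close> and \<open>p \<mapsto> length A + p\<close> into \<open>A @ B\<close>.
\<close>

type_synonym 't box = "'t list \<times> 't list"

definition boxes :: "'t set \<Rightarrow> 't box set" where
  "boxes \<tau> = lists \<tau> \<times> lists \<tau>"

text \<open>Elements of \<open>v\<^sub>- \<oplus> t\<^sub>+\<close> and of \<open>t\<^sub>- \<oplus> v\<^sub>+\<close>: \<open>Outer p\<close> is port \<open>p\<close> of the outer box,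
  \<open>Inner i p\<close> is port \<open>p\<close> of the \<open>i\<close>-th inner box, counted from \<open>0\<close>.\<close>

datatype port = Outer nat | Inner nat nat

definition src_ports :: "'t box list \<Rightarrow> 't box \<Rightarrow> port set" where
  "src_ports ts v =
    {Outer p |p. p < length (fst v)} \<union> {Inner i p |i p. i < length ts \<and> p < length (snd (ts ! i))}"

definition tgt_ports :: "'t box list \<Rightarrow> 't box \<Rightarrow> port set" where
  "tgt_ports ts v =
    {Inner i p |i p. i < length ts \<and> p < length (fst (ts ! i))} \<union> {Outer p |p. p < length (snd v)}"

fun src_type :: "'t box list \<Rightarrow> 't box \<Rightarrow> port \<Rightarrow> 't" where
  "src_type ts v (Outer p) = fst v ! p"
| "src_type ts v (Inner i p) = snd (ts ! i) ! p"

fun tgt_type :: "'t box list \<Rightarrow> 't box \<Rightarrow> port \<Rightarrow> 't" where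
  "tgt_type ts v (Outer p) = snd v ! p"
| "tgt_type ts v (Inner i p) = fst (ts ! i) ! p"

text \<open>A span from \<open>v\<^sub>- \<oplus> t\<^sub>+\<close> to \<open>t\<^sub>- \<oplus> v\<^sub>+\<close> in typed finite sets and type-preserving
  bijections, with apex the set of wires \<open>W\<close> typed by \<open>ty\<close>.\<close>

definition bij_span ::
  "'t box list \<Rightarrow> 't box \<Rightarrow> 'w set \<Rightarrow> ('w \<Rightarrow> 't) \<Rightarrow> ('w \<Rightarrow> port) \<Rightarrow> ('w \<Rightarrow> port) \<Rightarrow> bool" where
  "bij_span ts v W ty src tgt \<longleftrightarrow>
    finite W \<and>
    bij_betw src W (src_ports ts v) \<and> (\<forall>w\<in>W. src_type ts v (src w) = ty w) \<and>
    bij_betw tgt W (tgt_ports ts v) \<and> (\<forall>w\<in>W. tgt_type ts v (tgt w) = ty w)"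

definition span_iso ::
  "'w set \<Rightarrow> ('w \<Rightarrow> 't) \<Rightarrow> ('w \<Rightarrow> port) \<Rightarrow> ('w \<Rightarrow> port) \<Rightarrow>
   'u set \<Rightarrow> ('u \<Rightarrow> 't) \<Rightarrow> ('u \<Rightarrow> port) \<Rightarrow> ('u \<Rightarrow> port) \<Rightarrow> bool" where
  "span_iso W ty src tgt W' ty' src' tgt' \<longleftrightarrow>
    (\<exists>h. bij_betw h W W' \<and>
      (\<forall>w\<in>W. ty' (h w) = ty w \<and> src' (h w) = src w \<and> tgt' (h w) = tgt w))"

text \<open>
  As the legs of a span are bijections, its isomorphism class contains exactly one span whose apex
  is a set of pairs and whose legs are the projections (see the three lemmas below).  A wiring
  diagram is represented by this apex: a wire is the pair of its source and its target.
\<close>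

type_synonym diagram = "(port \<times> port) set"

definition progress :: "diagram \<Rightarrow> bool" where
  "progress D \<longleftrightarrow> acyclic {(i, j). \<exists>p q. (Inner i p, Inner j q) \<in> D}"

definition diagrams :: "'t set \<Rightarrow> 't box list \<Rightarrow> 't box \<Rightarrow> diagram set" where
  "diagrams \<tau> ts v = {D. set ts \<subseteq> boxes \<tau> \<and> v \<in> boxes \<tau> \<and>
    bij_span ts v D (src_type ts v \<circ> fst) fst snd \<and> progress D}"

definition wires_of :: "'w set \<Rightarrow> ('w \<Rightarrow> port) \<Rightarrow> ('w \<Rightarrow> port) \<Rightarrow> diagram" where
  "wires_of W src tgt = (\<lambda>w. (src w, tgt w)) ` W"

lemma bij_span_wires_of:
  assumes "bij_span ts v W ty src tgt"
  shows "bij_span ts v (wires_of W src tgt) (src_type ts v \<circ> fst) fst snd"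
    and "span_iso W ty src tgt (wires_of W src tgt) (src_type ts v \<circ> fst) fst snd"
proof -
  have s: "inj_on src W" "src ` W = src_ports ts v"
    and t: "inj_on tgt W" "tgt ` W = tgt_ports ts v"
    using assms by (auto simp: bij_span_def bij_betw_def)
  have "inj_on fst (wires_of W src tgt)" "inj_on snd (wires_of W src tgt)"
    using s(1) t(1) by (auto simp: wires_of_def inj_on_def)
  then show "bij_span ts v (wires_of W src tgt) (src_type ts v \<circ> fst) fst snd"
    using assms s(2) t(2) by (auto simp: bij_span_def wires_of_def bij_betw_def image_image)
  have "bij_betw (\<lambda>w. (src w, tgt w)) W (wires_of W src tgt)"
    using s(1) by (auto simp: wires_of_def bij_betw_def inj_on_def)
  then show "span_iso W ty src tgt (wires_of W src tgt) (src_type ts v \<circ> fst) fst snd"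
    unfolding span_iso_def using assms by (intro exI[of _ "\<lambda>w. (src w, tgt w)"])
      (auto simp: bij_span_def)
qed

lemma span_iso_iff_wires_of_eq:
  assumes "bij_span ts v W ty src tgt" and "bij_span ts v W' ty' src' tgt'"
  shows "span_iso W ty src tgt W' ty' src' tgt' \<longleftrightarrow> wires_of W src tgt = wires_of W' src' tgt'"
proof
  assume "span_iso W ty src tgt W' ty' src' tgt'"
  then obtain h where h: "bij_betw h W W'"
      "\<And>w. w \<in> W \<Longrightarrow> src' (h w) = src w \<and> tgt' (h w) = tgt w"
    unfolding span_iso_def by blast
  have "wires_of W' src' tgt' = (\<lambda>w. (src' (h w), tgt' (h w))) ` W"
    using h(1) unfolding wires_of_def bij_betw_def by (auto simp: image_image)
  also have "\<dots> = wires_of W src tgt"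
    unfolding wires_of_def using h(2) by (intro image_cong) auto
  finally show "wires_of W src tgt = wires_of W' src' tgt'" by simp
next
  assume eq: "wires_of W src tgt = wires_of W' src' tgt'"
  have s: "bij_betw src W (src_ports ts v)" and s': "bij_betw src' W' (src_ports ts v)"
    using assms by (auto simp: bij_span_def)
  define h where "h = inv_into W' src' \<circ> src"
  have hb: "bij_betw h W W'"
    unfolding h_def by (rule bij_betw_trans[OF s bij_betw_inv_into[OF s']])
  have "ty' (h w) = ty w \<and> src' (h w) = src w \<and> tgt' (h w) = tgt w" if w: "w \<in> W" for w
  proof -
    have "(src w, tgt w) \<in> wires_of W' src' tgt'"
      using w eq[symmetric] by (auto simp: wires_of_def)
    then obtain u where u: "u \<in> W'" "src' u = src w" "tgt' u = tgt w"
      by (auto simp: wires_of_def)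
    have "h w = u"
      unfolding h_def o_def u(2)[symmetric]
      using s' u(1) by (auto simp: bij_betw_def inv_into_f_f)
    moreover have "ty' u = ty w"
      using assms u w unfolding bij_span_def by metis
    ultimately show ?thesis using u by simp
  qed
  then show "span_iso W ty src tgt W' ty' src' tgt'"
    using hb unfolding span_iso_def by blast
qed

lemma wires_of_fst_snd: "wires_of D fst snd = D"
  by (simp add: wires_of_def)

text \<open>
  In the composite of \<open>\<Psi> : s\<^sub>0, \<dots>, s\<^sub>m\<^sub>-\<^sub>1 \<rightarrow> t\<^sub>i\<close> and \<open>\<Phi> : t\<^sub>0, \<dots>, t\<^sub>n\<^sub>-\<^sub>1 \<rightarrow> v\<close> the box \<open>t\<^sub>j\<close> is at
  position \<open>j\<close> for \<open>j < i\<close> and at position \<open>j + m - 1\<close> for \<open>j > i\<close>, and \<open>s\<^sub>k\<close> is at position \<open>i + k\<close>.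
  Port \<open>p\<close> of \<open>t\<^sub>i\<close> is \<open>Inner i p\<close> in \<open>\<Phi>\<close> and \<open>Outer p\<close> in \<open>\<Psi>\<close>.
\<close>

fun reindex_outer :: "nat \<Rightarrow> nat \<Rightarrow> port \<Rightarrow> port" where
  "reindex_outer m i (Outer p) = Outer p"
| "reindex_outer m i (Inner j p) = Inner (if j < i then j else j + m - 1) p"

definition port_of_box :: "nat \<Rightarrow> port \<Rightarrow> bool" where
  "port_of_box i a \<longleftrightarrow> (\<exists>p. a = Inner i p)"

definition diagram_pcomp :: "nat \<Rightarrow> nat \<Rightarrow> diagram \<Rightarrow> diagram \<Rightarrow> diagram" where
  "diagram_pcomp m i \<Psi> \<Phi> = (let r = reindex_outer m i in
     \<comment> \<open>from \<open>u\<^sub>-\<close> to \<open>s\<^sub>-\<close>\<close>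
     {(r a, Inner (i + k) q) |a k q. \<exists>p. \<not> port_of_box i a \<and> (a, Inner i p) \<in> \<Phi> \<and> (Outer p, Inner k q) \<in> \<Psi>} \<union>
     \<comment> \<open>from \<open>u\<^sub>-\<close> to \<open>u\<^sub>+\<close>\<close>
     {(r a, r b) |a b. \<not> port_of_box i a \<and> \<not> port_of_box i b \<and> (a, b) \<in> \<Phi>} \<union>
     {(r a, r b) |a b. \<exists>p q. \<not> port_of_box i a \<and> \<not> port_of_box i b \<and>
        (a, Inner i p) \<in> \<Phi> \<and> (Outer p, Outer q) \<in> \<Psi> \<and> (Inner i q, b) \<in> \<Phi>} \<union>
     \<comment> \<open>from \<open>s\<^sub>+\<close> to \<open>s\<^sub>-\<close>\<close>
     {(Inner (i + k) p, Inner (i + l) q) |k p l q. (Inner k p, Inner l q) \<in> \<Psi>} \<union>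
     \<comment> \<open>from \<open>s\<^sub>+\<close> to \<open>u\<^sub>+\<close>\<close>
     {(Inner (i + k) p, r b) |k p b. \<exists>q. \<not> port_of_box i b \<and> (Inner k p, Outer q) \<in> \<Psi> \<and> (Inner i q, b) \<in> \<Phi>})"

definition diagram_id :: "'t box \<Rightarrow> diagram" where
  "diagram_id t = {(Outer p, Inner 0 p) |p. p < length (fst t)} \<union>
                  {(Inner 0 p, Outer p) |p. p < length (snd t)}"

text \<open>Reordering by \<open>\<pi>\<close> puts the box at position \<open>\<pi> k\<close> into position \<open>k\<close>.\<close>

fun permute_port :: "(nat \<Rightarrow> nat) \<Rightarrow> port \<Rightarrow> port" where
  "permute_port \<pi> (Outer p) = Outer p"
| "permute_port \<pi> (Inner j p) = Inner (inv \<pi> j) p"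

definition diagram_perm :: "(nat \<Rightarrow> nat) \<Rightarrow> diagram \<Rightarrow> diagram" where
  "diagram_perm \<pi> \<Phi> = {(permute_port \<pi> a, permute_port \<pi> b) |a b. (a, b) \<in> \<Phi>}"

definition wiring_operad :: "'t set \<Rightarrow> ('t box, diagram) operad" where
  "wiring_operad \<tau> = \<lparr>
    Col = boxes \<tau>,
    Ops = diagrams \<tau>,
    OpId = diagram_id,
    PComp = (\<lambda>ss ts v i \<Psi> \<Phi>. diagram_pcomp (length ss) i \<Psi> \<Phi>),
    Perm = (\<lambda>\<pi> ts v \<Phi>. diagram_perm \<pi> \<Phi>) \<rparr>"

definition unit_diagram :: "'t list \<Rightarrow> diagram" where
  "unit_diagram A = {(Outer p, Outer p) |p. p < length A}"

definition seq_diagram :: "'t list \<Rightarrow> 't list \<Rightarrow> 't list \<Rightarrow> diagram" where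
  "seq_diagram A B C =
    {(Outer p, Inner 0 p) |p. p < length A} \<union>
    {(Inner 0 p, Inner 1 p) |p. p < length B} \<union>
    {(Inner 1 p, Outer p) |p. p < length C}"

definition para_diagram :: "'t list \<Rightarrow> 't list \<Rightarrow> 't list \<Rightarrow> 't list \<Rightarrow> diagram" where
  "para_diagram A B A' B' =
    {(Outer p, Inner 0 p) |p. p < length A} \<union>
    {(Outer (length A + p), Inner 1 p) |p. p < length A'} \<union>
    {(Inner 0 p, Outer p) |p. p < length B} \<union>
    {(Inner 1 p, Outer (length B + p)) |p. p < length B'}"


section \<open>The category of algebras\<close>

type_synonym ('t, 'a) algebra = "('t box, diagram, 'a set, 'a list \<Rightarrow> 'a) opmap"

definition algebra_nat_trans ::
  "'t set \<Rightarrow> ('t, 'a) algebra \<Rightarrow> ('t, 'a) algebra \<Rightarrow> ('t box \<Rightarrow> 'a \<Rightarrow> 'a) set" where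
  "algebra_nat_trans \<tau> H K = {\<alpha> \<in> (\<Pi>\<^sub>E t\<in>boxes \<tau>. onCol H t \<rightarrow>\<^sub>E onCol K t).
    \<forall>ts v. \<forall>\<Phi>\<in>diagrams \<tau> ts v. \<forall>xs\<in>listset (map (onCol H) ts).
      \<alpha> v (onOps H ts v \<Phi> xs) = onOps K ts v \<Phi> (map2 \<alpha> ts xs)}"

definition algebra_category ::
  "'t set \<Rightarrow> (('t, 'a) algebra, 't box \<Rightarrow> 'a \<Rightarrow> 'a) category" where
  "algebra_category \<tau> = \<lparr>
    Obj = {H. operad_functor (wiring_operad \<tau>) Set_operad H},
    Hom = algebra_nat_trans \<tau>,
    Idt = (\<lambda>H. \<lambda>t\<in>boxes \<tau>. \<lambda>x\<in>onCol H t. x),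
    Comp = (\<lambda>H K L \<alpha> \<beta>. \<lambda>t\<in>boxes \<tau>. \<lambda>x\<in>onCol H t. \<beta> t (\<alpha> t x)) \<rparr>"


section \<open>The category of symmetric monoidal categories on typed finite sets\<close>

type_synonym ('t, 'a) typed_smc = "('t list, 'a) smc"

definition typed_smcs :: "'t set \<Rightarrow> ('t, 'a) typed_smc set" where
  "typed_smcs \<tau> = {C. strict_symmetric_monoidal_category C \<and> Obj C = lists \<tau> \<and>
    UnitOb C = [] \<and> (\<forall>A\<in>lists \<tau>. \<forall>B\<in>lists \<tau>. TensorOb C A B = A @ B)}"

definition id_on_objects_smc_functors ::
  "'t set \<Rightarrow> ('t, 'a) typed_smc \<Rightarrow> ('t, 'a) typed_smc
    \<Rightarrow> ('t list \<Rightarrow> 't list \<Rightarrow> 'a \<Rightarrow> 'a) set" where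
  "id_on_objects_smc_functors \<tau> C D =
    {F \<in> (\<Pi>\<^sub>E A\<in>lists \<tau>. \<Pi>\<^sub>E B\<in>lists \<tau>. Hom C A B \<rightarrow>\<^sub>E Hom D A B).
      cat_functor C D (\<lambda>A. A) F \<and>
      (\<forall>A\<in>lists \<tau>. \<forall>B\<in>lists \<tau>. \<forall>A'\<in>lists \<tau>. \<forall>B'\<in>lists \<tau>. \<forall>f\<in>Hom C A B. \<forall>g\<in>Hom C A' B'.
        F (A @ A') (B @ B') (Tensor C A B A' B' f g) =
        Tensor D A B A' B' (F A B f) (F A' B' g)) \<and>
      (\<forall>A\<in>lists \<tau>. \<forall>B\<in>lists \<tau>. F (A @ B) (B @ A) (Braid C A B) = Braid D A B)}"

definition smc_category ::
  "'t set \<Rightarrow> (('t, 'a) typed_smc, 't list \<Rightarrow> 't list \<Rightarrow> 'a \<Rightarrow> 'a) category" where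
  "smc_category \<tau> = \<lparr>
    Obj = typed_smcs \<tau>,
    Hom = id_on_objects_smc_functors \<tau>,
    Idt = (\<lambda>C. \<lambda>A\<in>lists \<tau>. \<lambda>B\<in>lists \<tau>. \<lambda>f\<in>Hom C A B. f),
    Comp = (\<lambda>C D E F G. \<lambda>A\<in>lists \<tau>. \<lambda>B\<in>lists \<tau>. \<lambda>f\<in>Hom C A B. G A B (F A B f)) \<rparr>"

end

theory Submission
  imports Defs
begin

text \<open>
  The axioms of a symmetric monoidal category hold in the category obtained from an algebra
  \<open>H\<close> because the two sides of each are the images under \<open>H\<close> of the same
  wiring diagram. Conversely, sequential and parallel composition, identities, braidings and
  reordering of boxes generate every wiring diagram: by the progress condition some box is fed by
  outer inputs only, and it can be split off after permuting the wires; a diagram without boxes is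
  a permutation, a composite of braidings. Hence a family of maps that respects the monoidal
  structure is natural with respect to all diagrams, which gives fullness; faithfulness is clear
  because both kinds of morphisms are families of maps on the same sets.
\<close>


section \<open>Wiring diagrams as graphs of functions on ports\<close>

text \<open>A wire is its source together with its target, so a diagram is treated as the graph of a
  function \<open>\<phi>\<close> on source ports; equality of two diagrams then becomes a pointwise
  case distinction over ports. An element \<open>f\<close> of \<open>onCol H (A, B)\<close> is the
  value of the identity diagram at \<open>[f]\<close>, so both sides of an axiom can be written as a
  wire function applied to a list of morphisms. The obstacle is the order of that list: naturality
  of the braiding and the interchange law list the same boxes in different orders, and there the
  equivariance of \<open>H\<close> under reordering has to be used.

  The progress condition is exploited in two ways. It excludes wires from a box back to itself, so
  that fusing wires in a partial composite ends after finitely many links and the result is again a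
  function; and it makes the relation between boxes well-founded, which supplies the box to be split
  off. Partial composites also have to be proved to be diagrams again, since evaluation is
  controlled only on diagrams.\<close>

lemma src_ports_iff [simp]:
  "Outer p \<in> src_ports ts v \<longleftrightarrow> p < length (fst v)"
  "Inner i p \<in> src_ports ts v \<longleftrightarrow> i < length ts \<and> p < length (snd (ts ! i))"
  by (auto simp: src_ports_def)

lemma tgt_ports_iff [simp]:
  "Outer p \<in> tgt_ports ts v \<longleftrightarrow> p < length (snd v)"
  "Inner i p \<in> tgt_ports ts v \<longleftrightarrow> i < length ts \<and> p < length (fst (ts ! i))"
  by (auto simp: tgt_ports_def)

lemma finite_src_ports: "finite (src_ports ts v)"
proof -
  have "src_ports ts v = Outer ` {..<length (fst v)} \<union>
      (\<Union>i<length ts. Inner i ` {..<length (snd (ts ! i))})"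
    by (auto simp: src_ports_def)
  then show ?thesis by simp
qed

definition box_edges :: "diagram \<Rightarrow> (nat \<times> nat) set" where
  "box_edges D = {(i, j). \<exists>p q. (Inner i p, Inner j q) \<in> D}"

lemma progress_iff: "progress D \<longleftrightarrow> acyclic (box_edges D)"
  by (simp add: progress_def box_edges_def)

lemma diagrams_iff:
  "D \<in> diagrams \<tau> ts v \<longleftrightarrow> set ts \<subseteq> boxes \<tau> \<and> v \<in> boxes \<tau> \<and>
    bij_betw fst D (src_ports ts v) \<and> bij_betw snd D (tgt_ports ts v) \<and>
    (\<forall>(a, b)\<in>D. src_type ts v a = tgt_type ts v b) \<and> acyclic (box_edges D)"
  using bij_betw_finite[of fst D "src_ports ts v"] finite_src_ports[of ts v]
  by (auto simp: diagrams_def bij_span_def progress_iff split_beta)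

lemma diagram_wireD:
  assumes "D \<in> diagrams \<tau> ts v" and "(a, b) \<in> D"
  shows "a \<in> src_ports ts v" and "b \<in> tgt_ports ts v"
    and "src_type ts v a = tgt_type ts v b"
  using assms imageI[OF assms(2), of fst] imageI[OF assms(2), of snd]
  by (auto simp: diagrams_iff bij_betw_def)

text \<open>There are only finitely many boxes, so acyclicity amounts to well-foundedness. That form
  passes to lexicographic products, inverse images and subrelations, and it provides minimal
  boxes.\<close>

lemma wf_box_edges:
  assumes "D \<in> diagrams \<tau> ts v"
  shows "wf (box_edges D)"
proof (rule finite_acyclic_wf)
  have "box_edges D \<subseteq> {..<length ts} \<times> {..<length ts}"
    using diagram_wireD[OF assms] by (fastforce simp: box_edges_def)
  then show "finite (box_edges D)" by (rule finite_subset) simp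
qed (use assms in \<open>simp add: diagrams_iff\<close>)

text \<open>The values of \<open>\<phi>\<close> outside \<open>src_ports ts v\<close> are
  irrelevant, so one function may serve for many boxes, and diagrams are compared through
  \<open>wires_cong\<close> rather than by equality of functions.\<close>

definition wires :: "'t box list \<Rightarrow> 't box \<Rightarrow> (port \<Rightarrow> port) \<Rightarrow> diagram" where
  "wires ts v \<phi> = (\<lambda>a. (a, \<phi> a)) ` src_ports ts v"

lemma wires_iff [simp]: "(a, b) \<in> wires ts v \<phi> \<longleftrightarrow> a \<in> src_ports ts v \<and> b = \<phi> a"
  by (auto simp: wires_def)

lemma wires_cong:
  assumes "\<And>p. p < length (fst v) \<Longrightarrow> \<phi> (Outer p) = \<psi> (Outer p)"
    and "\<And>i p. i < length ts \<Longrightarrow> p < length (snd (ts ! i)) \<Longrightarrow> \<phi> (Inner i p) = \<psi> (Inner i p)"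
  shows "wires ts v \<phi> = wires ts v \<psi>"
  unfolding wires_def
proof (rule image_cong)
  fix a assume "a \<in> src_ports ts v"
  then show "(a, \<phi> a) = (a, \<psi> a)" using assms by (cases a) auto
qed simp

lemma diagram_eq_wires:
  assumes "D \<in> diagrams \<tau> ts v"
  obtains \<phi> where "D = wires ts v \<phi>"
proof
  let ?\<phi> = "\<lambda>a. snd (inv_into D fst a)"
  have b: "bij_betw fst D (src_ports ts v)" using assms by (simp add: diagrams_iff)
  show "D = wires ts v ?\<phi>"
  proof (intro set_eqI iffI)
    fix w assume w: "w \<in> D"
    then have "inv_into D fst (fst w) = w" using b by (simp add: bij_betw_inv_into_left)
    then show "w \<in> wires ts v ?\<phi>"
      using w diagram_wireD(1)[OF assms, of "fst w" "snd w"] by (cases w) auto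
  next
    fix w assume w: "w \<in> wires ts v ?\<phi>"
    then have *: "fst w \<in> src_ports ts v" "snd w = ?\<phi> (fst w)" by (auto simp: wires_def)
    have "w = inv_into D fst (fst w)"
      using bij_betw_inv_into_right[OF b *(1)] *(2) by (simp add: prod_eq_iff)
    also have "\<dots> \<in> D" using *(1) b by (auto simp: bij_betw_def intro: inv_into_into)
    finally show "w \<in> D" .
  qed
qed

lemma bij_betw_fst_wires: "bij_betw fst (wires ts v \<phi>) (src_ports ts v)"
  by (auto simp: wires_def bij_betw_def inj_on_def image_image)

lemma bij_betw_snd_wires:
  "bij_betw snd (wires ts v \<phi>) T \<longleftrightarrow> bij_betw \<phi> (src_ports ts v) T"
  by (auto simp: wires_def bij_betw_def inj_on_def image_image)

lemma wires_in_diagrams_iff: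
  "wires ts v \<phi> \<in> diagrams \<tau> ts v \<longleftrightarrow> set ts \<subseteq> boxes \<tau> \<and> v \<in> boxes \<tau> \<and>
    bij_betw \<phi> (src_ports ts v) (tgt_ports ts v) \<and>
    (\<forall>a\<in>src_ports ts v. src_type ts v a = tgt_type ts v (\<phi> a)) \<and>
    acyclic (box_edges (wires ts v \<phi>))"
  unfolding diagrams_iff bij_betw_snd_wires by (auto simp: bij_betw_fst_wires)

lemma wires_tgt:
  assumes "wires ts v \<phi> \<in> diagrams \<tau> ts v" and "a \<in> src_ports ts v"
  shows "\<phi> a \<in> tgt_ports ts v"
  using assms by (auto simp: wires_in_diagrams_iff bij_betw_def)

text \<open>Such a wire would be a cycle of length one. In a partial composite this prevents a wire
  that has left the substituted box from entering it again.\<close>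

lemma wires_no_loop:
  assumes "wires ts v \<phi> \<in> diagrams \<tau> ts v" and "i < length ts" and "p < length (snd (ts ! i))"
  shows "\<phi> (Inner i p) \<noteq> Inner i q"
proof
  assume "\<phi> (Inner i p) = Inner i q"
  then have "(i, i) \<in> box_edges (wires ts v \<phi>)" using assms by (auto simp: box_edges_def)
  then show False using assms(1) by (auto simp: wires_in_diagrams_iff acyclic_def)
qed

text \<open>Wires out of \<open>\<Psi>\<close> that reach its outer box go on in \<open>\<Phi>\<close>, and conversely; by the progress
  condition this switch happens at most twice.\<close>

fun exit_port :: "nat \<Rightarrow> nat \<Rightarrow> (port \<Rightarrow> port) \<Rightarrow> port \<Rightarrow> port" where
  "exit_port m i \<phi> (Outer q) = reindex_outer m i (\<phi> (Inner i q))"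
| "exit_port m i \<phi> (Inner k q) = Inner (i + k) q"

fun enter_port :: "nat \<Rightarrow> nat \<Rightarrow> (port \<Rightarrow> port) \<Rightarrow> (port \<Rightarrow> port) \<Rightarrow> port \<Rightarrow> port" where
  "enter_port m i \<psi> \<phi> (Outer q) = Outer q"
| "enter_port m i \<psi> \<phi> (Inner j q) =
    (if j = i then exit_port m i \<phi> (\<psi> (Outer q)) else reindex_outer m i (Inner j q))"

text \<open>The three ranges of \<open>j\<close> are the boxes of \<open>\<Phi>\<close> before
  position \<open>i\<close>, the boxes of \<open>\<Psi>\<close>, and the later boxes of
  \<open>\<Phi>\<close>. The term \<open>Suc j - m\<close> inverts the shift
  \<open>j + m - 1\<close> of \<open>reindex_outer\<close>; adding one before subtracting keeps it
  correct for \<open>m = 0\<close>.\<close>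

fun pcomp_fun :: "nat \<Rightarrow> nat \<Rightarrow> (port \<Rightarrow> port) \<Rightarrow> (port \<Rightarrow> port) \<Rightarrow> port \<Rightarrow> port" where
  "pcomp_fun m i \<psi> \<phi> (Outer p) = enter_port m i \<psi> \<phi> (\<phi> (Outer p))"
| "pcomp_fun m i \<psi> \<phi> (Inner j p) =
    (if j < i then enter_port m i \<psi> \<phi> (\<phi> (Inner j p))
     else if j < i + m then exit_port m i \<phi> (\<psi> (Inner (j - i) p))
     else enter_port m i \<psi> \<phi> (\<phi> (Inner (Suc j - m) p)))"

lemma length_graft: "i < length ts \<Longrightarrow> length (graft i ss ts) = length ts + length ss - 1"
  by (simp add: graft_def)

lemma nth_graft:
  assumes "i < length ts" and "j < length ts + length ss - 1"
  shows "graft i ss ts ! j = (if j < i then ts ! j else if j < i + length ss then ss ! (j - i)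
    else ts ! (Suc j - length ss))"
proof -
  have "Suc i + (j - i - length ss) = Suc j - length ss" if "\<not> j < i + length ss"
    using that by simp
  then show ?thesis using assms by (auto simp: graft_def nth_append min_def)
qed

lemma mem_pcomp_iff:
  "w \<in> diagram_pcomp m i \<Psi> \<Phi> \<longleftrightarrow>
    (\<exists>a k p q. w = (reindex_outer m i a, Inner (i + k) q) \<and> \<not> port_of_box i a \<and>
       (a, Inner i p) \<in> \<Phi> \<and> (Outer p, Inner k q) \<in> \<Psi>) \<or>
    (\<exists>a b. w = (reindex_outer m i a, reindex_outer m i b) \<and> \<not> port_of_box i a \<and>
       \<not> port_of_box i b \<and> (a, b) \<in> \<Phi>) \<or>
    (\<exists>a b p q. w = (reindex_outer m i a, reindex_outer m i b) \<and> \<not> port_of_box i a \<and>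
       \<not> port_of_box i b \<and> (a, Inner i p) \<in> \<Phi> \<and> (Outer p, Outer q) \<in> \<Psi> \<and> (Inner i q, b) \<in> \<Phi>) \<or>
    (\<exists>k p l q. w = (Inner (i + k) p, Inner (i + l) q) \<and> (Inner k p, Inner l q) \<in> \<Psi>) \<or>
    (\<exists>k p b q. w = (Inner (i + k) p, reindex_outer m i b) \<and> \<not> port_of_box i b \<and>
       (Inner k p, Outer q) \<in> \<Psi> \<and> (Inner i q, b) \<in> \<Phi>)"
  unfolding diagram_pcomp_def Let_def Un_iff mem_Collect_eq by blast

lemma port_of_box_simps [simp]:
  "\<not> port_of_box i (Outer p)" "port_of_box i (Inner j p) \<longleftrightarrow> j = i"
  by (auto simp: port_of_box_def)

lemma enter_port_reindex: "\<not> port_of_box i b \<Longrightarrow> enter_port m i \<psi> \<phi> b = reindex_outer m i b"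
  by (cases b) auto

lemma pcomp_fun_reindex:
  "\<not> port_of_box i a \<Longrightarrow> pcomp_fun m i \<psi> \<phi> (reindex_outer m i a) = enter_port m i \<psi> \<phi> (\<phi> a)"
  by (cases a) auto

lemma reindex_src_port:
  assumes "\<not> port_of_box i a" and "a \<in> src_ports ts v" and "i < length ts"
  shows "reindex_outer (length ss) i a \<in> src_ports (graft i ss ts) v"
  using assms by (cases a) (auto simp: length_graft nth_graft)

text \<open>Each of the five kinds of fused wires is one branch of \<open>pcomp_fun\<close>.
  Conversely the branches exhaust all sources of the composite, because progress in
  \<open>\<Phi>\<close> rules out a chain that returns to box \<open>i\<close> after leaving
  it.\<close>

lemma pcomp_wires:
  assumes \<Psi>: "wires ss (ts ! i) \<psi> \<in> diagrams \<tau> ss (ts ! i)"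
    and \<Phi>: "wires ts v \<phi> \<in> diagrams \<tau> ts v" and i: "i < length ts"
  shows "diagram_pcomp (length ss) i (wires ss (ts ! i) \<psi>) (wires ts v \<phi>) =
    wires (graft i ss ts) v (pcomp_fun (length ss) i \<psi> \<phi>)" (is "?L = ?R")
proof (intro set_eqI iffI)
  fix w assume "w \<in> ?L"
  then show "w \<in> ?R"
    unfolding mem_pcomp_iff
    using i
    by (elim disjE exE conjE)
      (auto simp: pcomp_fun_reindex reindex_src_port enter_port_reindex length_graft nth_graft
        dest!: sym[of "Inner _ _" "\<phi> _"] sym[of "Inner _ _" "\<psi> _"] sym[of "Outer _" "\<psi> _"])
next
  let ?m = "length ss"
  \<comment> \<open>A wire leaving the substituted box cannot come back to it, so its end
    \<open>b\<close> is a port that survives in the composite.\<close>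
  have exit: "\<exists>b. \<not> port_of_box i b \<and> exit_port ?m i \<phi> (Outer q) = reindex_outer ?m i b \<and>
      (Inner i q, b) \<in> wires ts v \<phi>" if "q < length (snd (ts ! i))" for q
    using wires_no_loop[OF \<Phi> i that] i that by (auto simp: port_of_box_def)
  \<comment> \<open>A wire of \<open>\<Phi>\<close> from a surviving port either avoids box
    \<open>i\<close>, or crosses into \<open>\<Psi>\<close> and ends there, or runs through
    \<open>\<Psi>\<close> and leaves it: the three kinds of wires that start in
    \<open>u_-\<close>.\<close>
  have enter: "(reindex_outer ?m i a, enter_port ?m i \<psi> \<phi> (\<phi> a)) \<in> ?L"
    if a: "a \<in> src_ports ts v" "\<not> port_of_box i a" for a
  proof (cases "port_of_box i (\<phi> a)")
    case True
    then obtain p where p: "\<phi> a = Inner i p" by (auto simp: port_of_box_def)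
    have pl: "Outer p \<in> src_ports ss (ts ! i)" using wires_tgt[OF \<Phi> a(1)] p by simp
    show ?thesis
    proof (cases "\<psi> (Outer p)")
      case (Outer q)
      have "q < length (snd (ts ! i))" using wires_tgt[OF \<Psi> pl] Outer by simp
      from exit[OF this] obtain b where "\<not> port_of_box i b"
        "exit_port ?m i \<phi> (Outer q) = reindex_outer ?m i b" "(Inner i q, b) \<in> wires ts v \<phi>" by blast
      moreover have "(a, Inner i p) \<in> wires ts v \<phi>" "(Outer p, Outer q) \<in> wires ss (ts ! i) \<psi>"
        using a p pl Outer by auto
      ultimately show ?thesis
        unfolding mem_pcomp_iff using a(2) p Outer
        by (intro disjI2 disjI1) (metis enter_port.simps(2))
    next
      case (Inner k q)
      have "(a, Inner i p) \<in> wires ts v \<phi>" "(Outer p, Inner k q) \<in> wires ss (ts ! i) \<psi>"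
        using a p pl Inner by auto
      then show ?thesis
        unfolding mem_pcomp_iff using a(2) p Inner
        by (intro disjI1) (metis enter_port.simps(2) exit_port.simps(2))
    qed
  next
    case False
    then show ?thesis
      unfolding mem_pcomp_iff using a by (intro disjI2 disjI1) (auto simp: enter_port_reindex)
  qed
  fix w assume "w \<in> ?R"
  then obtain a where w: "w = (a, pcomp_fun ?m i \<psi> \<phi> a)" and a: "a \<in> src_ports (graft i ss ts) v"
    by (auto simp: wires_def)
  show "w \<in> ?L"
  proof (cases a)
    case (Outer p)
    then show ?thesis using enter[of "Outer p"] a w by simp
  next
    case (Inner j p)
    consider "j < i" | "i \<le> j" "j < i + ?m" | "i + ?m \<le> j" by linarith
    then show ?thesis
    proof cases
      case 1
      then show ?thesis using enter[of "Inner j p"] a w Inner i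
        by (auto simp: length_graft nth_graft)
    next
      case 2
      then obtain k where k: "j = i + k" "k < ?m" by (metis le_Suc_ex nat_add_left_cancel_less)
      have s: "Inner k p \<in> src_ports ss (ts ! i)"
        using a k Inner i by (auto simp: length_graft nth_graft)
      show ?thesis
      proof (cases "\<psi> (Inner k p)")
        case (Outer q)
        have "q < length (snd (ts ! i))" using wires_tgt[OF \<Psi> s] Outer by simp
        from exit[OF this] obtain b where b: "\<not> port_of_box i b"
          "exit_port ?m i \<phi> (Outer q) = reindex_outer ?m i b" "(Inner i q, b) \<in> wires ts v \<phi>"
          by blast
        moreover have "(Inner k p, Outer q) \<in> wires ss (ts ! i) \<psi>" using s Outer by auto
        moreover have "w = (Inner (i + k) p, reindex_outer ?m i b)"
          using w Inner k Outer b(2) by simp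
        ultimately show ?thesis
          unfolding mem_pcomp_iff by (intro disjI2) blast
      next
        fix l q assume kq: "\<psi> (Inner k p) = Inner l q"
        have "(Inner k p, Inner l q) \<in> wires ss (ts ! i) \<psi>" using s kq by auto
        moreover have "w = (Inner (i + k) p, Inner (i + l) q)"
          using w Inner k kq by simp
        ultimately show ?thesis
          unfolding mem_pcomp_iff by - (rule disjI2, rule disjI2, rule disjI2, rule disjI1, blast)
      qed
    next
      case 3
      then have "Suc j - ?m \<noteq> i" "reindex_outer ?m i (Inner (Suc j - ?m) p) = Inner j p" by auto
      then show ?thesis using enter[of "Inner (Suc j - ?m) p"] a w Inner i 3
        by (auto simp: length_graft nth_graft)
    qed
  qed
qed

section \<open>Composites and reorderings of wiring diagrams\<close>

text \<open>Reversing all wires exchanges inputs and outputs; it halves the proof that composites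
  of wiring diagrams are bijective.\<close>

lemma src_ports_swap: "src_ports (map prod.swap ts) (prod.swap v) = tgt_ports ts v"
  and tgt_ports_swap: "tgt_ports (map prod.swap ts) (prod.swap v) = src_ports ts v"
  by (auto simp: src_ports_def tgt_ports_def)

lemma bij_betw_converse:
  "bij_betw fst (D\<inverse>) S \<longleftrightarrow> bij_betw snd D S" "bij_betw snd (D\<inverse>) S \<longleftrightarrow> bij_betw fst D S"
proof -
  have "bij_betw prod.swap D (D\<inverse>)"
    by (rule bij_betw_byWitness[of _ prod.swap]) auto
  note bij_betw_comp_iff[OF this]
  from this[of fst S] this[of snd S] show
    "bij_betw fst (D\<inverse>) S \<longleftrightarrow> bij_betw snd D S" "bij_betw snd (D\<inverse>) S \<longleftrightarrow> bij_betw fst D S"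
    by (simp_all add: o_def)
qed

lemma converse_in_diagrams:
  assumes "D \<in> diagrams \<tau> ts v"
  shows "D\<inverse> \<in> diagrams \<tau> (map prod.swap ts) (prod.swap v)"
proof -
  have "src_type (map prod.swap ts) (prod.swap v) b = tgt_type ts v b"
    if "b \<in> tgt_ports ts v" for b using that by (cases b) auto
  moreover have "tgt_type (map prod.swap ts) (prod.swap v) a = src_type ts v a"
    if "a \<in> src_ports ts v" for a using that by (cases a) auto
  ultimately have "\<forall>(a, b)\<in>D\<inverse>. src_type (map prod.swap ts) (prod.swap v) a =
      tgt_type (map prod.swap ts) (prod.swap v) b"
    using diagram_wireD[OF assms] by auto
  moreover have "box_edges (D\<inverse>) = (box_edges D)\<inverse>" by (auto simp: box_edges_def)
  ultimately show ?thesis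
    using assms
    by (auto simp: diagrams_iff src_ports_swap tgt_ports_swap bij_betw_converse acyclic_converse
        boxes_def)
qed

text \<open>Reversal exchanges the chains that end inside \<open>\<Psi>\<close> with those that
  start inside \<open>\<Psi>\<close>, and maps each of the other three kinds of wires to
  itself.\<close>

lemma diagram_pcomp_converse: "(diagram_pcomp m i \<Psi> \<Phi>)\<inverse> = diagram_pcomp m i (\<Psi>\<inverse>) (\<Phi>\<inverse>)"
proof (intro set_eqI)
  fix w :: "port \<times> port"
  obtain a b where w: "w = (a, b)" by (cases w)
  have "w \<in> (diagram_pcomp m i \<Psi> \<Phi>)\<inverse> \<longleftrightarrow> (b, a) \<in> diagram_pcomp m i \<Psi> \<Phi>" by (simp add: w)
  then show "w \<in> (diagram_pcomp m i \<Psi> \<Phi>)\<inverse> \<longleftrightarrow> w \<in> diagram_pcomp m i (\<Psi>\<inverse>) (\<Phi>\<inverse>)"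
    unfolding w mem_pcomp_iff converse_iff prod.inject by blast
qed

text \<open>The composite is the graph of a function on its source ports, so projecting to sources
  is bijective at no further cost. Applied to reversed diagrams, this also yields the bijection onto
  targets.\<close>

lemma pcomp_bij_src:
  assumes "\<Psi> \<in> diagrams \<tau> ss (ts ! i)" and "\<Phi> \<in> diagrams \<tau> ts v" and "i < length ts"
  shows "bij_betw fst (diagram_pcomp (length ss) i \<Psi> \<Phi>) (src_ports (graft i ss ts) v)"
proof -
  from diagram_eq_wires[OF assms(1)] obtain \<psi> where "\<Psi> = wires ss (ts ! i) \<psi>" .
  moreover from diagram_eq_wires[OF assms(2)] obtain \<phi> where "\<Phi> = wires ts v \<phi>" .
  ultimately show ?thesis using assms by (simp add: pcomp_wires bij_betw_fst_wires)
qed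

lemma set_graft: "set (graft i ss ts) \<subseteq> set ss \<union> set ts"
  using set_take_subset[of i ts] set_drop_subset[of "Suc i" ts] by (auto simp: graft_def)

lemma src_type_graft:
  assumes "i < length ts" and "a \<in> src_ports ts v" and "\<not> port_of_box i a"
  shows "src_type (graft i ss ts) v (reindex_outer (length ss) i a) = src_type ts v a"
  using assms by (cases a) (auto simp: nth_graft)

lemma tgt_type_graft:
  assumes "i < length ts" and "b \<in> tgt_ports ts v" and "\<not> port_of_box i b"
  shows "tgt_type (graft i ss ts) v (reindex_outer (length ss) i b) = tgt_type ts v b"
  using assms by (cases b) (auto simp: nth_graft)

lemma nth_graft_add: "\<lbrakk>i < length ts; k < length ss\<rbrakk> \<Longrightarrow> graft i ss ts ! (i + k) = ss ! k"
  by (simp add: nth_graft)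

text \<open>Boxes of the composite are ordered by the box of \<open>\<Phi>\<close> they come from, then by \<open>\<Psi>\<close>.\<close>

lemma pcomp_acyclic:
  assumes \<Psi>: "\<Psi> \<in> diagrams \<tau> ss (ts ! i)" and \<Phi>: "\<Phi> \<in> diagrams \<tau> ts v" and i: "i < length ts"
  shows "acyclic (box_edges (diagram_pcomp (length ss) i \<Psi> \<Phi>))"
proof -
  define m where "m = length ss"
  \<comment> \<open>\<open>pos j\<close> is the box of \<open>\<Phi>\<close> from which position
    \<open>j\<close> of the composite originates; all inserted boxes are sent to
    \<open>i\<close>.\<close>
  define pos where "pos = (\<lambda>j. if j < i then j else if j < i + m then i else Suc j - m)"
  define r where "r = (\<lambda>j. if j < i then j else j + m - 1)"
  have r: "reindex_outer m i (Inner j p) = Inner (r j) p" for j p by (simp add: r_def)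
  have pos_r: "pos (r j) = j" if "j \<noteq> i" for j using that by (auto simp: pos_def r_def)
  have pos_s: "pos (i + k) = i" if "k < m" for k using that by (simp add: pos_def)
  \<comment> \<open>The transitive closure is needed because a chain that runs from one box into
    \<open>t_i\<close>, through \<open>\<Psi>\<close>, and on to another box yields a single edge of
    the composite out of two edges of \<open>\<Phi>\<close>.\<close>
  let ?R = "inv_image ((box_edges \<Phi>)\<^sup>+ <*lex*> box_edges \<Psi>) (\<lambda>j. (pos j, j - i))"
  have "wf ?R"
    by (intro wf_inv_image wf_lex_prod wf_trancl wf_box_edges[OF \<Phi>] wf_box_edges[OF \<Psi>])
  moreover have "box_edges (diagram_pcomp m i \<Psi> \<Phi>) \<subseteq> ?R"
  proof
    fix e assume "e \<in> box_edges (diagram_pcomp m i \<Psi> \<Phi>)"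
    then obtain j p l q where e: "e = (j, l)"
      and w: "(Inner j p, Inner l q) \<in> diagram_pcomp m i \<Psi> \<Phi>"
      by (auto simp: box_edges_def)
    have re: "\<exists>j'. a = Inner j' p \<and> j = r j' \<and> j' \<noteq> i"
      if "Inner j p = reindex_outer m i a" "\<not> port_of_box i a" for a j p
      using that by (cases a) (auto simp: r_def)
    have s: "k < m" if "(Inner k p, b) \<in> \<Psi>" for k p b
      using diagram_wireD(1)[OF \<Psi> that] by (simp add: m_def)
    have t: "k < m" if "(a, Inner k p) \<in> \<Psi>" for k p a
      using diagram_wireD(2)[OF \<Psi> that] by (simp add: m_def)
    have E: "(j, k) \<in> box_edges D" if "(Inner j p, Inner k q) \<in> D" for j p k q and D :: diagram
      using that by (auto simp: box_edges_def)
    show "e \<in> ?R"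
      using w unfolding mem_pcomp_iff prod.inject e
    proof (elim disjE exE conjE)
      fix a k p' q'
      assume *: "Inner j p = reindex_outer m i a" "\<not> port_of_box i a" "Inner l q = Inner (i + k) q'"
        "(a, Inner i p') \<in> \<Phi>" "(Outer p', Inner k q') \<in> \<Psi>"
      from re[OF *(1,2)] t[OF *(5)] *(3,4) show "(j, l) \<in> ?R"
        by (auto simp: pos_r pos_s dest!: E)
    next
      fix a b
      assume *: "Inner j p = reindex_outer m i a" "Inner l q = reindex_outer m i b"
        "\<not> port_of_box i a" "\<not> port_of_box i b" "(a, b) \<in> \<Phi>"
      from re[OF *(1,3)] re[OF *(2,4)] *(5) show "(j, l) \<in> ?R"
        by (auto simp: pos_r pos_s dest!: E)
    next
      fix a b p' q'
      assume *: "Inner j p = reindex_outer m i a" "Inner l q = reindex_outer m i b"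
        "\<not> port_of_box i a" "\<not> port_of_box i b"
        "(a, Inner i p') \<in> \<Phi>" "(Outer p', Outer q') \<in> \<Psi>" "(Inner i q', b) \<in> \<Phi>"
      from re[OF *(1,3)] re[OF *(2,4)] *(5,7) show "(j, l) \<in> ?R"
        by (auto simp: pos_r pos_s dest!: E intro: trancl.trancl_into_trancl[OF r_into_trancl])
    next
      fix k p' l' q'
      assume *: "Inner j p = Inner (i + k) p'" "Inner l q = Inner (i + l') q'"
        "(Inner k p', Inner l' q') \<in> \<Psi>"
      from s[OF *(3)] t[OF *(3)] * show "(j, l) \<in> ?R" by (auto simp: pos_s dest!: E)
    next
      fix k p' b q'
      assume *: "Inner j p = Inner (i + k) p'" "Inner l q = reindex_outer m i b"
        "\<not> port_of_box i b" "(Inner k p', Outer q') \<in> \<Psi>" "(Inner i q', b) \<in> \<Phi>"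
      from re[OF *(2,3)] s[OF *(4)] *(1,5) show "(j, l) \<in> ?R"
        by (auto simp: pos_r pos_s dest!: E)
    qed
  qed
  ultimately show ?thesis unfolding m_def using wf_acyclic[OF wf_subset] by blast
qed

lemma pcomp_in_diagrams:
  assumes \<Psi>: "\<Psi> \<in> diagrams \<tau> ss (ts ! i)" and \<Phi>: "\<Phi> \<in> diagrams \<tau> ts v" and i: "i < length ts"
  shows "diagram_pcomp (length ss) i \<Psi> \<Phi> \<in> diagrams \<tau> (graft i ss ts) v"
proof -
  let ?C = "diagram_pcomp (length ss) i \<Psi> \<Phi>"
  have "bij_betw fst (?C\<inverse>) (src_ports (graft i (map prod.swap ss) (map prod.swap ts)) (prod.swap v))"
    using pcomp_bij_src[of "\<Psi>\<inverse>" \<tau> "map prod.swap ss" "map prod.swap ts" i "\<Phi>\<inverse>" "prod.swap v"]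
      converse_in_diagrams[OF \<Psi>] converse_in_diagrams[OF \<Phi>] i
    by (simp add: diagram_pcomp_converse)
  moreover have "graft i (map prod.swap ss) (map prod.swap ts) = map prod.swap (graft i ss ts)"
    by (simp add: graft_def take_map drop_map)
  ultimately have "bij_betw snd ?C (tgt_ports (graft i ss ts) v)"
    by (simp add: src_ports_swap bij_betw_converse)
  \<comment> \<open>Types agree along every link of a chain, since port \<open>p\<close> of the
    substituted box carries the same type whether it is seen from inside or from outside.\<close>
  moreover have "src_type (graft i ss ts) v (fst w) = tgt_type (graft i ss ts) v (snd w)"
    if "w \<in> ?C" for w
  proof -
    note P = diagram_wireD[OF \<Psi>] and F = diagram_wireD[OF \<Phi>]
    note T = src_type_graft[OF i] tgt_type_graft[OF i] nth_graft_add[OF i]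
    show ?thesis
      using that unfolding mem_pcomp_iff
    proof (elim disjE exE conjE)
      fix a k p q
      assume w: "w = (reindex_outer (length ss) i a, Inner (i + k) q)" and a: "\<not> port_of_box i a"
        and 1: "(a, Inner i p) \<in> \<Phi>" and 2: "(Outer p, Inner k q) \<in> \<Psi>"
      show ?thesis using F[OF 1] P[OF 2] a by (simp add: w T(1) T(3))
    next
      fix a b
      assume w: "w = (reindex_outer (length ss) i a, reindex_outer (length ss) i b)"
        and a: "\<not> port_of_box i a" "\<not> port_of_box i b" and 1: "(a, b) \<in> \<Phi>"
      show ?thesis using F[OF 1] a by (simp add: w T(1,2))
    next
      fix a b p q
      assume w: "w = (reindex_outer (length ss) i a, reindex_outer (length ss) i b)"
        and a: "\<not> port_of_box i a" "\<not> port_of_box i b" and 1: "(a, Inner i p) \<in> \<Phi>"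
        and 2: "(Outer p, Outer q) \<in> \<Psi>" and 3: "(Inner i q, b) \<in> \<Phi>"
      show ?thesis using F[OF 1] P[OF 2] F[OF 3] a by (simp add: w T(1,2))
    next
      fix k p l q
      assume w: "w = (Inner (i + k) p, Inner (i + l) q)" and 1: "(Inner k p, Inner l q) \<in> \<Psi>"
      show ?thesis using P[OF 1] by (simp add: w T(3))
    next
      fix k p b q
      assume w: "w = (Inner (i + k) p, reindex_outer (length ss) i b)" and b: "\<not> port_of_box i b"
        and 1: "(Inner k p, Outer q) \<in> \<Psi>" and 2: "(Inner i q, b) \<in> \<Phi>"
      show ?thesis using P[OF 1] F[OF 2] b by (simp add: w T(2) T(3))
    qed
  qed
  moreover have "set (graft i ss ts) \<subseteq> boxes \<tau>"
    using set_graft[of i ss ts] \<Psi> \<Phi> by (auto simp: diagrams_iff)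
  ultimately show ?thesis
    using pcomp_bij_src[OF assms] pcomp_acyclic[OF assms] \<Phi> by (auto simp: diagrams_iff)
qed

section \<open>Reordering the inner boxes\<close>

fun unpermute_port :: "(nat \<Rightarrow> nat) \<Rightarrow> port \<Rightarrow> port" where
  "unpermute_port \<pi> (Outer p) = Outer p"
| "unpermute_port \<pi> (Inner j p) = Inner (\<pi> j) p"

lemma unpermute_permute_port:
  assumes "\<pi> permutes S"
  shows "unpermute_port \<pi> (permute_port \<pi> a) = a" "permute_port \<pi> (unpermute_port \<pi> a) = a"
  using assms by (cases a; simp add: permutes_inverses)+

lemma ports_permute:
  assumes "\<pi> permutes {..<length ts}"
  shows "src_ports (permute_list \<pi> ts) v = permute_port \<pi> ` src_ports ts v"
    and "tgt_ports (permute_list \<pi> ts) v = permute_port \<pi> ` tgt_ports ts v"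
proof -
  note u = unpermute_permute_port[OF assms]
  have \<pi>: "\<pi> j < length ts \<longleftrightarrow> j < length ts" for j
    using permutes_in_image[OF assms, of j] by simp
  have "a \<in> src_ports (permute_list \<pi> ts) v \<longleftrightarrow> unpermute_port \<pi> a \<in> src_ports ts v" for a
    by (cases a) (auto simp: \<pi> permute_list_nth[OF assms])
  then show "src_ports (permute_list \<pi> ts) v = permute_port \<pi> ` src_ports ts v"
    using u by (metis (no_types, lifting) image_iff set_eqI)
  have "a \<in> tgt_ports (permute_list \<pi> ts) v \<longleftrightarrow> unpermute_port \<pi> a \<in> tgt_ports ts v" for a
    by (cases a) (auto simp: \<pi> permute_list_nth[OF assms])
  then show "tgt_ports (permute_list \<pi> ts) v = permute_port \<pi> ` tgt_ports ts v"
    using u by (metis (no_types, lifting) image_iff set_eqI)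
qed

lemma diagram_perm_image: "diagram_perm \<pi> D = map_prod (permute_port \<pi>) (permute_port \<pi>) ` D"
  by (force simp: diagram_perm_def)

lemma perm_wires:
  assumes "\<pi> permutes {..<length ts}"
  shows "diagram_perm \<pi> (wires ts v \<phi>) =
    wires (permute_list \<pi> ts) v (\<lambda>a. permute_port \<pi> (\<phi> (unpermute_port \<pi> a)))"
  unfolding diagram_perm_image wires_def ports_permute[OF assms] image_image
  by (simp add: unpermute_permute_port[OF assms])

lemma perm_in_diagrams:
  assumes \<pi>: "\<pi> permutes {..<length ts}" and D: "D \<in> diagrams \<tau> ts v"
  shows "diagram_perm \<pi> D \<in> diagrams \<tau> (permute_list \<pi> ts) v"
proof -
  note u = unpermute_permute_port[OF \<pi>]
  from diagram_eq_wires[OF D] obtain \<phi> where \<phi>: "D = wires ts v \<phi>" .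
  have inj: "inj (permute_port \<pi>)" by (rule inj_on_inverseI[of _ "unpermute_port \<pi>"]) (rule u)
  have bphi: "bij_betw \<phi> (src_ports ts v) (tgt_ports ts v)"
    using D by (simp add: \<phi> wires_in_diagrams_iff)
  have "bij_betw (unpermute_port \<pi>) (permute_port \<pi> ` src_ports ts v) (src_ports ts v)"
    by (rule bij_betw_byWitness[of _ "permute_port \<pi>"]) (auto simp: u)
  moreover have "bij_betw (permute_port \<pi>) (tgt_ports ts v) (permute_port \<pi> ` tgt_ports ts v)"
    by (rule bij_betw_byWitness[of _ "unpermute_port \<pi>"]) (auto simp: u)
  ultimately have "bij_betw (permute_port \<pi> \<circ> (\<phi> \<circ> unpermute_port \<pi>))
      (permute_port \<pi> ` src_ports ts v) (permute_port \<pi> ` tgt_ports ts v)"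
    using bphi by (blast intro: bij_betw_trans)
  moreover have "src_type (permute_list \<pi> ts) v (permute_port \<pi> a) = src_type ts v a"
    if "a \<in> src_ports ts v" for a
    using that permutes_in_image[OF permutes_inv[OF \<pi>]]
    by (cases a) (auto simp: permute_list_nth[OF \<pi>] permutes_inverses[OF \<pi>])
  moreover have "tgt_type (permute_list \<pi> ts) v (permute_port \<pi> a) = tgt_type ts v a"
    if "a \<in> tgt_ports ts v" for a
    using that permutes_in_image[OF permutes_inv[OF \<pi>]]
    by (cases a) (auto simp: permute_list_nth[OF \<pi>] permutes_inverses[OF \<pi>])
  moreover have "acyclic (box_edges (diagram_perm \<pi> D))"
  proof -
    have 1: "Inner j p = permute_port \<pi> a \<longleftrightarrow> a = Inner (\<pi> j) p" for j p a
      using u by (metis unpermute_port.simps(2))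
    \<comment> \<open>Reordering only renames boxes, so well-foundedness is pulled back along
      \<open>\<pi>\<close>.\<close>
    have "box_edges (diagram_perm \<pi> D) \<subseteq> inv_image (box_edges D) \<pi>"
      unfolding box_edges_def diagram_perm_def by (auto simp: 1) blast
    then show ?thesis using wf_acyclic[OF wf_subset[OF wf_inv_image[OF wf_box_edges[OF D]]]] by blast
  qed
  ultimately show ?thesis
    using D \<pi> wires_tgt[OF D[unfolded \<phi>]] unfolding \<phi> perm_wires[OF \<pi>] wires_in_diagrams_iff
    by (auto simp: ports_permute[OF \<pi>] u o_def)
qed

section \<open>Diagrams plugged into sequential and parallel composition\<close>

lemma Box_in_boxes [simp]: "(A, B) \<in> boxes \<tau> \<longleftrightarrow> A \<in> lists \<tau> \<and> B \<in> lists \<tau>"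
  by (simp add: boxes_def)

text \<open>\<open>\<chi>\<close> is the inverse of \<open>\<phi>\<close>. The special diagrams list
  their boxes in the direction of flow, so every wire between boxes increases the position, and
  \<open>less_than\<close> witnesses progress.\<close>

lemma wires_in_diagramsI:
  assumes "set ts \<subseteq> boxes \<tau>" and "v \<in> boxes \<tau>"
    and O: "\<And>p. p < length (fst v) \<Longrightarrow> \<phi> (Outer p) \<in> tgt_ports ts v \<and>
      tgt_type ts v (\<phi> (Outer p)) = fst v ! p \<and> \<chi> (\<phi> (Outer p)) = Outer p"
    and I: "\<And>i p. i < length ts \<Longrightarrow> p < length (snd (ts ! i)) \<Longrightarrow> \<phi> (Inner i p) \<in> tgt_ports ts v \<and>
      tgt_type ts v (\<phi> (Inner i p)) = snd (ts ! i) ! p \<and> \<chi> (\<phi> (Inner i p)) = Inner i p \<and>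
      (\<forall>j q. \<phi> (Inner i p) = Inner j q \<longrightarrow> i < j)"
    and O': "\<And>p. p < length (snd v) \<Longrightarrow>
      \<chi> (Outer p) \<in> src_ports ts v \<and> \<phi> (\<chi> (Outer p)) = Outer p"
    and I': "\<And>i p. i < length ts \<Longrightarrow> p < length (fst (ts ! i)) \<Longrightarrow>
      \<chi> (Inner i p) \<in> src_ports ts v \<and> \<phi> (\<chi> (Inner i p)) = Inner i p"
  shows "wires ts v \<phi> \<in> diagrams \<tau> ts v"
proof -
  have s: "\<phi> a \<in> tgt_ports ts v \<and> \<chi> (\<phi> a) = a \<and> src_type ts v a = tgt_type ts v (\<phi> a)"
    if "a \<in> src_ports ts v" for a
    using that O I by (cases a) auto
  have t: "\<chi> b \<in> src_ports ts v \<and> \<phi> (\<chi> b) = b" if "b \<in> tgt_ports ts v" for b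
    using that O' I' by (cases b) auto
  have "bij_betw \<phi> (src_ports ts v) (tgt_ports ts v)"
    by (rule bij_betw_byWitness[of _ \<chi>]) (use s t in auto)
  moreover have "box_edges (wires ts v \<phi>) \<subseteq> less_than"
  proof
    fix e assume "e \<in> box_edges (wires ts v \<phi>)"
    then obtain i j p q where "e = (i, j)" "i < length ts" "p < length (snd (ts ! i))"
      "Inner j q = \<phi> (Inner i p)" by (auto simp: box_edges_def)
    then show "e \<in> less_than" using I[of i p] by (metis less_than_iff)
  qed
  then have "acyclic (box_edges (wires ts v \<phi>))"
    by (rule wf_acyclic[OF wf_subset[OF wf_less_than]])
  ultimately show ?thesis using assms(1,2) s by (simp add: wires_in_diagrams_iff)
qed

text \<open>In the wire functions of the special diagrams only the box positions \<open>0\<close>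
  and \<open>1\<close> can occur; the clauses for other inner ports are default values.\<close>

fun id_wire :: "port \<Rightarrow> port" where
  "id_wire (Outer p) = Inner 0 p"
| "id_wire (Inner i p) = Outer p"

fun seq_wire :: "port \<Rightarrow> port" where
  "seq_wire (Outer p) = Inner 0 p"
| "seq_wire (Inner i p) = (if i = 0 then Inner 1 p else Outer p)"

fun para_wire :: "nat \<Rightarrow> nat \<Rightarrow> port \<Rightarrow> port" where
  "para_wire a b (Outer p) = (if p < a then Inner 0 p else Inner 1 (p - a))"
| "para_wire a b (Inner i p) = (if i = 0 then Outer p else Outer (b + p))"

fun braid_wire :: "nat \<Rightarrow> nat \<Rightarrow> port \<Rightarrow> port" where
  "braid_wire a b (Outer p) = (if p < a then Outer (b + p) else Outer (p - a))"
| "braid_wire a b (Inner i p) = Inner i p"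

definition braid_diagram :: "'t list \<Rightarrow> 't list \<Rightarrow> diagram" where
  "braid_diagram A B = wires [] (A @ B, B @ A) (braid_wire (length A) (length B))"

lemma diagram_id_eq_wires: "diagram_id t = wires [t] t id_wire"
  by (auto simp: diagram_id_def wires_def src_ports_def)

lemma unit_diagram_eq_wires: "unit_diagram A = wires [] (A, A) (\<lambda>a. a)"
  by (auto simp: unit_diagram_def wires_def src_ports_def)

lemma seq_diagram_eq_wires: "seq_diagram A B C = wires [(A, B), (B, C)] (A, C) seq_wire"
  by (force simp: seq_diagram_def wires_def src_ports_def less_Suc_eq)

lemma para_diagram_eq_wires:
  "para_diagram A B A' B' =
    wires [(A, B), (A', B')] (A @ A', B @ B') (para_wire (length A) (length B))" (is "?L = ?R")
proof (intro set_eqI iffI)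
  fix w assume "w \<in> ?L"
  then show "w \<in> ?R" by (auto simp: para_diagram_def)
next
  fix w assume "w \<in> ?R"
  then obtain a where a: "a \<in> src_ports [(A, B), (A', B')] (A @ A', B @ B')"
    "w = (a, para_wire (length A) (length B) a)" by (auto simp: wires_def)
  show "w \<in> ?L"
  proof (cases a)
    case (Outer p)
    moreover have "\<exists>q. p = length A + q \<and> q < length A'" if "\<not> p < length A"
      using that a Outer by (intro exI[of _ "p - length A"]) auto
    ultimately show ?thesis using a by (auto simp: para_diagram_def)
  qed (use a in \<open>auto simp: para_diagram_def less_Suc_eq\<close>)
qed

lemma diagram_id_in_diagrams: "t \<in> boxes \<tau> \<Longrightarrow> diagram_id t \<in> diagrams \<tau> [t] t"
  unfolding diagram_id_eq_wires by (rule wires_in_diagramsI[where \<chi> = id_wire]) auto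

lemma unit_in_diagrams: "A \<in> lists \<tau> \<Longrightarrow> unit_diagram A \<in> diagrams \<tau> [] (A, A)"
  unfolding unit_diagram_eq_wires by (rule wires_in_diagramsI[where \<chi> = "\<lambda>a. a"]) auto

lemma seq_in_diagrams:
  "\<lbrakk>A \<in> lists \<tau>; B \<in> lists \<tau>; C \<in> lists \<tau>\<rbrakk>
    \<Longrightarrow> seq_diagram A B C \<in> diagrams \<tau> [(A, B), (B, C)] (A, C)"
  unfolding seq_diagram_eq_wires
  by (rule wires_in_diagramsI[where
        \<chi> = "case_port (Inner 1) (\<lambda>i p. if i = 0 then Outer p else Inner 0 p)"])
    (auto simp: less_Suc_eq)

lemma para_in_diagrams:
  "\<lbrakk>A \<in> lists \<tau>; B \<in> lists \<tau>; A' \<in> lists \<tau>; B' \<in> lists \<tau>\<rbrakk>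
    \<Longrightarrow> para_diagram A B A' B' \<in> diagrams \<tau> [(A, B), (A', B')] (A @ A', B @ B')"
  unfolding para_diagram_eq_wires
  by (rule wires_in_diagramsI[where
        \<chi> = "case_port (\<lambda>p. if p < length B then Inner 0 p else Inner 1 (p - length B))
          (\<lambda>i p. if i = 0 then Outer p else Outer (length A + p))"])
    (auto simp: less_Suc_eq nth_append)

lemma braid_in_diagrams:
  "\<lbrakk>A \<in> lists \<tau>; B \<in> lists \<tau>\<rbrakk> \<Longrightarrow> braid_diagram A B \<in> diagrams \<tau> [] (A @ B, B @ A)"
  unfolding braid_diagram_def
  \<comment> \<open>The exchange of two blocks is undone by the exchange with the block lengths
    swapped.\<close>
  by (rule wires_in_diagramsI[where \<chi> = "braid_wire (length B) (length A)"])
    (auto simp: nth_append)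

section \<open>Wire functions of sequential and parallel composites\<close>

fun shift_port :: "nat \<Rightarrow> nat \<Rightarrow> port \<Rightarrow> port" where
  "shift_port m b (Outer q) = Outer (b + q)"
| "shift_port m b (Inner k q) = Inner (m + k) q"

fun then_wire :: "nat \<Rightarrow> (port \<Rightarrow> port) \<Rightarrow> port \<Rightarrow> port" where
  "then_wire m \<psi> (Outer q) = shift_port m 0 (\<psi> (Outer q))"
| "then_wire m \<psi> (Inner k q) = Inner k q"

fun seq_fun :: "nat \<Rightarrow> (port \<Rightarrow> port) \<Rightarrow> (port \<Rightarrow> port) \<Rightarrow> port \<Rightarrow> port" where
  "seq_fun m \<phi> \<psi> (Outer p) = then_wire m \<psi> (\<phi> (Outer p))"
| "seq_fun m \<phi> \<psi> (Inner j p) = (if j < m then then_wire m \<psi> (\<phi> (Inner j p))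
     else shift_port m 0 (\<psi> (Inner (j - m) p)))"

text \<open>\<open>m\<close> counts the boxes of the first diagram, \<open>a\<close> and
  \<open>b\<close> its outer inputs and outputs. Only here is the output offset \<open>b\<close> of
  \<open>shift_port\<close> nonzero: in a sequential composite the outputs of the second diagram are
  already the outer ones.\<close>

fun par_fun :: "nat \<Rightarrow> nat \<Rightarrow> nat \<Rightarrow> (port \<Rightarrow> port) \<Rightarrow> (port \<Rightarrow> port) \<Rightarrow> port \<Rightarrow> port" where
  "par_fun m a b \<phi> \<psi> (Outer p) = (if p < a then \<phi> (Outer p) else shift_port m b (\<psi> (Outer (p - a))))"
| "par_fun m a b \<phi> \<psi> (Inner j p) = (if j < m then \<phi> (Inner j p)
     else shift_port m b (\<psi> (Inner (j - m) p)))"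

text \<open>The order of the two substitutions matters for the indices: once \<open>D\<close> with
  its \<open>m\<close> boxes replaces box \<open>0\<close>, the box awaiting \<open>E\<close> sits
  at position \<open>m\<close>.\<close>

definition plug2 :: "nat \<Rightarrow> nat \<Rightarrow> diagram \<Rightarrow> diagram \<Rightarrow> diagram \<Rightarrow> diagram" where
  "plug2 m n \<Phi> D E = diagram_pcomp n m E (diagram_pcomp m 0 D \<Phi>)"

lemma graft_first: "graft 0 ts [s, t] = ts @ [t]"
  and graft_last: "graft (length ts) ss (ts @ [t]) = ts @ ss"
  by (simp_all add: graft_def)

lemma plug2_steps:
  assumes D: "D \<in> diagrams \<tau> ts s" and E: "E \<in> diagrams \<tau> ss t" and \<Phi>: "\<Phi> \<in> diagrams \<tau> [s, t] v"
  shows "diagram_pcomp (length ts) 0 D \<Phi> \<in> diagrams \<tau> (ts @ [t]) v"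
    and "plug2 (length ts) (length ss) \<Phi> D E \<in> diagrams \<tau> (ts @ ss) v"
proof -
  show *: "diagram_pcomp (length ts) 0 D \<Phi> \<in> diagrams \<tau> (ts @ [t]) v"
    using pcomp_in_diagrams[of D \<tau> ts "[s, t]" 0 \<Phi> v] D \<Phi> by (simp add: graft_first)
  show "plug2 (length ts) (length ss) \<Phi> D E \<in> diagrams \<tau> (ts @ ss) v"
    unfolding plug2_def
    using pcomp_in_diagrams[of E \<tau> ss "ts @ [t]" "length ts", OF _ *] E by (simp add: graft_last)
qed

lemma plug2_wires:
  assumes D: "wires ts s \<psi> \<in> diagrams \<tau> ts s" and E: "wires ss t \<chi> \<in> diagrams \<tau> ss t"
    and \<Phi>: "wires [s, t] v \<phi> \<in> diagrams \<tau> [s, t] v"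
  shows "plug2 (length ts) (length ss) (wires [s, t] v \<phi>) (wires ts s \<psi>) (wires ss t \<chi>) =
    wires (ts @ ss) v (pcomp_fun (length ss) (length ts) \<chi> (pcomp_fun (length ts) 0 \<psi> \<phi>))"
proof -
  have *: "diagram_pcomp (length ts) 0 (wires ts s \<psi>) (wires [s, t] v \<phi>) =
      wires (ts @ [t]) v (pcomp_fun (length ts) 0 \<psi> \<phi>)"
    using pcomp_wires[of ts "[s, t]" 0 \<psi> \<tau> v \<phi>] D \<Phi> by (simp add: graft_first)
  show ?thesis
    using pcomp_wires[of ss "ts @ [t]" "length ts" \<chi> \<tau> v "pcomp_fun (length ts) 0 \<psi> \<phi>"]
      E plug2_steps(1)[OF D E \<Phi>] by (simp add: plug2_def * graft_last)
qed

definition seq_comp where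
  "seq_comp ts ss A B C D E = plug2 (length ts) (length ss) (seq_diagram A B C) D E"

definition par_comp where
  "par_comp ts ss A B A' B' D E = plug2 (length ts) (length ss) (para_diagram A B A' B') D E"

text \<open>This bound decides the index tests in \<open>pcomp_fun\<close>: a wire that ends at a
  box of the first diagram is never mistaken for one that reaches the box still to be
  substituted.\<close>

lemma wires_Inner_bound:
  assumes "wires ts v \<phi> \<in> diagrams \<tau> ts v" and "a \<in> src_ports ts v" and "\<phi> a = Inner k q"
  shows "k < length ts"
  using wires_tgt[OF assms(1,2)] assms(3) by simp

text \<open>After both substitutions a wire follows \<open>\<phi>\<close>, and if it comes out at
  the interface \<open>B\<close> it continues along \<open>\<psi>\<close>. Nothing flows from the
  second diagram back to the first, so there is at most one crossing.\<close>

lemma seq_comp_wires: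
  assumes D: "wires ts (A, B) \<phi> \<in> diagrams \<tau> ts (A, B)"
    and E: "wires ss (B, C) \<psi> \<in> diagrams \<tau> ss (B, C)"
  shows "seq_comp ts ss A B C (wires ts (A, B) \<phi>) (wires ss (B, C) \<psi>) =
      wires (ts @ ss) (A, C) (seq_fun (length ts) \<phi> \<psi>)"
    and "wires (ts @ ss) (A, C) (seq_fun (length ts) \<phi> \<psi>) \<in> diagrams \<tau> (ts @ ss) (A, C)"
proof -
  have \<Phi>: "wires [(A, B), (B, C)] (A, C) seq_wire \<in> diagrams \<tau> [(A, B), (B, C)] (A, C)"
    using seq_in_diagrams[of A \<tau> B C] D E by (simp add: seq_diagram_eq_wires diagrams_iff)
  have 1: "k < length ts" if "\<phi> (Outer p) = Inner k q" "p < length A" for p k q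
    using wires_Inner_bound[OF D _ that(1)] that by simp
  have 2: "k < length ts" if "\<phi> (Inner j p) = Inner k q" "j < length ts" "p < length (snd (ts ! j))"
    for j p k q
    using wires_Inner_bound[OF D _ that(1)] that by simp
  show eq: "seq_comp ts ss A B C (wires ts (A, B) \<phi>) (wires ss (B, C) \<psi>) =
      wires (ts @ ss) (A, C) (seq_fun (length ts) \<phi> \<psi>)"
    unfolding seq_comp_def seq_diagram_eq_wires plug2_wires[OF D E \<Phi>]
  proof (rule wires_cong)
    fix p assume "p < length (fst (A, C))"
    \<comment> \<open>The incomplete \<open>case\<close> in the split below picks the interface port
      at which a wire leaves the first diagram; if the wire ends at a box its value is arbitrary and
      not consulted.\<close>
    then show "pcomp_fun (length ss) (length ts) \<psi> (pcomp_fun (length ts) 0 \<phi> seq_wire) (Outer p) =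
        seq_fun (length ts) \<phi> \<psi> (Outer p)"
      using 1[of p] by (cases "\<phi> (Outer p)"; cases "\<psi> (Outer (case \<phi> (Outer p) of Outer q \<Rightarrow> q))") auto
  next
    fix j p assume "j < length (ts @ ss)" "p < length (snd ((ts @ ss) ! j))"
    then show "pcomp_fun (length ss) (length ts) \<psi> (pcomp_fun (length ts) 0 \<phi> seq_wire) (Inner j p) =
        seq_fun (length ts) \<phi> \<psi> (Inner j p)"
      using 2[of j p]
      by (cases "\<phi> (Inner j p)"; cases "\<psi> (Outer (case \<phi> (Inner j p) of Outer q \<Rightarrow> q))";
          cases "\<psi> (Inner (j - length ts) p)") (auto simp: nth_append)
  qed
  show "wires (ts @ ss) (A, C) (seq_fun (length ts) \<phi> \<psi>) \<in> diagrams \<tau> (ts @ ss) (A, C)"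
    using plug2_steps(2)[OF D E \<Phi>] eq by (simp add: seq_comp_def seq_diagram_eq_wires)
qed

lemma par_comp_wires:
  assumes D: "wires ts (A, B) \<phi> \<in> diagrams \<tau> ts (A, B)"
    and E: "wires ss (A', B') \<psi> \<in> diagrams \<tau> ss (A', B')"
  shows "par_comp ts ss A B A' B' (wires ts (A, B) \<phi>) (wires ss (A', B') \<psi>) =
      wires (ts @ ss) (A @ A', B @ B') (par_fun (length ts) (length A) (length B) \<phi> \<psi>)"
    and "wires (ts @ ss) (A @ A', B @ B') (par_fun (length ts) (length A) (length B) \<phi> \<psi>)
      \<in> diagrams \<tau> (ts @ ss) (A @ A', B @ B')"
proof -
  have \<Phi>: "wires [(A, B), (A', B')] (A @ A', B @ B') (para_wire (length A) (length B))
      \<in> diagrams \<tau> [(A, B), (A', B')] (A @ A', B @ B')"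
    using para_in_diagrams[of A \<tau> B A' B'] D E by (simp add: para_diagram_eq_wires diagrams_iff)
  have 1: "k < length ts" if "\<phi> (Outer p) = Inner k q" "p < length A" for p k q
    using wires_Inner_bound[OF D _ that(1)] that by simp
  have 2: "k < length ts" if "\<phi> (Inner j p) = Inner k q" "j < length ts" "p < length (snd (ts ! j))"
    for j p k q
    using wires_Inner_bound[OF D _ that(1)] that by simp
  show eq: "par_comp ts ss A B A' B' (wires ts (A, B) \<phi>) (wires ss (A', B') \<psi>) =
      wires (ts @ ss) (A @ A', B @ B') (par_fun (length ts) (length A) (length B) \<phi> \<psi>)"
    unfolding par_comp_def para_diagram_eq_wires plug2_wires[OF D E \<Phi>]
  proof (rule wires_cong)
    fix p assume "p < length (fst (A @ A', B @ B'))"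
    then show "pcomp_fun (length ss) (length ts) \<psi>
        (pcomp_fun (length ts) 0 \<phi> (para_wire (length A) (length B))) (Outer p) =
        par_fun (length ts) (length A) (length B) \<phi> \<psi> (Outer p)"
      using 1[of p] by (cases "\<phi> (Outer p)"; cases "\<psi> (Outer (p - length A))") auto
  next
    fix j p assume "j < length (ts @ ss)" "p < length (snd ((ts @ ss) ! j))"
    then show "pcomp_fun (length ss) (length ts) \<psi>
        (pcomp_fun (length ts) 0 \<phi> (para_wire (length A) (length B))) (Inner j p) =
        par_fun (length ts) (length A) (length B) \<phi> \<psi> (Inner j p)"
      using 2[of j p]
      by (cases "\<phi> (Inner j p)"; cases "\<psi> (Inner (j - length ts) p)") (auto simp: nth_append)
  qed
  show "wires (ts @ ss) (A @ A', B @ B') (par_fun (length ts) (length A) (length B) \<phi> \<psi>)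
      \<in> diagrams \<tau> (ts @ ss) (A @ A', B @ B')"
    using plug2_steps(2)[OF D E \<Phi>] eq by (simp add: par_comp_def para_diagram_eq_wires)
qed

section \<open>The symmetric monoidal category of an algebra\<close>

lemma in_listset_iff: "xs \<in> listset Xs \<longleftrightarrow> list_all2 (\<in>) xs Xs"
  by (induction Xs arbitrary: xs) (auto simp: set_Cons_def list_all2_Cons2)

lemma permute_list_inv:
  assumes "\<pi> permutes {..<length xs}"
  shows "permute_list (inv \<pi>) (permute_list \<pi> xs) = xs"
proof -
  have "permute_list (inv \<pi>) (permute_list \<pi> xs) = permute_list (\<pi> \<circ> inv \<pi>) xs"
    using permutes_inv[OF assms] by (simp add: permute_list_compose)
  then show ?thesis using permutes_inv_o[OF assms] by simp
qed

text \<open>The theorem prescribes hom-sets, identities, composition and product but leaves the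
  braiding open. It is taken to be the image of the box-free diagram that exchanges two blocks of
  wires.\<close>

definition smc_of_algebra :: "'t set \<Rightarrow> ('t, 'a) algebra \<Rightarrow> ('t, 'a) typed_smc" where
  "smc_of_algebra \<tau> H = \<lparr>
    Obj = lists \<tau>,
    Hom = (\<lambda>A B. onCol H (A, B)),
    Idt = (\<lambda>A. onOps H [] (A, A) (unit_diagram A) []),
    Comp = (\<lambda>A B C f g. onOps H [(A, B), (B, C)] (A, C) (seq_diagram A B C) [f, g]),
    UnitOb = [],
    TensorOb = (@),
    Tensor = (\<lambda>A B A' B' f g.
      onOps H [(A, B), (A', B')] (A @ A', B @ B') (para_diagram A B A' B') [f, g]),
    Braid = (\<lambda>A B. onOps H [] (A @ B, B @ A) (braid_diagram A B) []) \<rparr>"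

lemma smc_of_algebra_simps [simp]:
  "Obj (smc_of_algebra \<tau> H) = lists \<tau>"
  "Hom (smc_of_algebra \<tau> H) A B = onCol H (A, B)"
  "UnitOb (smc_of_algebra \<tau> H) = []"
  "TensorOb (smc_of_algebra \<tau> H) A B = A @ B"
  by (simp_all add: smc_of_algebra_def)

section \<open>Evaluation of diagrams in an algebra\<close>

locale wiring_algebra = operad_functor "wiring_operad \<tau>" Set_operad H
  for \<tau> :: "'t set" and H :: "('t, 'a) algebra"
begin

lemma ev_fun:
  assumes "D \<in> diagrams \<tau> ts v"
  shows "onOps H ts v D \<in> listset (map (onCol H) ts) \<rightarrow>\<^sub>E onCol H v"
  using onOps_in_Ops[of ts v D] assms by (simp add: wiring_operad_def Set_operad_def diagrams_iff)

lemma ev_in: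
  assumes "D \<in> diagrams \<tau> ts v" and "xs \<in> listset (map (onCol H) ts)"
  shows "onOps H ts v D xs \<in> onCol H v"
  using ev_fun[OF assms(1)] assms(2) by auto

lemma ev_id:
  assumes "t \<in> boxes \<tau>" and "x \<in> onCol H t"
  shows "onOps H [t] t (diagram_id t) [x] = x"
  using onOps_OpId[of t] assms
  by (simp add: wiring_operad_def Set_operad_def set_Cons_def del: listset.simps(2))
    (simp add: set_Cons_def)

lemma ev_pcomp:
  assumes "\<Psi> \<in> diagrams \<tau> ss (ts ! i)" and "\<Phi> \<in> diagrams \<tau> ts v" and "i < length ts"
    and "xs \<in> listset (map (onCol H) (graft i ss ts))"
  shows "onOps H (graft i ss ts) v (diagram_pcomp (length ss) i \<Psi> \<Phi>) xs = onOps H ts v \<Phi>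
    (take i xs @ [onOps H ss (ts ! i) \<Psi> (take (length ss) (drop i xs))] @ drop (i + length ss) xs)"
proof -
  have "map (onCol H) (graft i ss ts) = graft i (map (onCol H) ss) (map (onCol H) ts)"
    by (simp add: graft_def take_map drop_map)
  then show ?thesis
    using onOps_PComp[of ss ts v i \<Psi> \<Phi>] assms
    by (simp add: wiring_operad_def Set_operad_def diagrams_iff)
qed

text \<open>Two uses of functoriality for partial composites turn a nested evaluation into the
  evaluation of a single diagram on the concatenated arguments. Composition and product of morphisms
  are instances, with the sequential or the parallel diagram as \<open>\<Phi>\<close>.\<close>

lemma ev_plug2:
  assumes D: "D \<in> diagrams \<tau> ts s" and E: "E \<in> diagrams \<tau> ss t" and \<Phi>: "\<Phi> \<in> diagrams \<tau> [s, t] v"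
    and xs: "xs \<in> listset (map (onCol H) ts)" and ys: "ys \<in> listset (map (onCol H) ss)"
  shows "onOps H (ts @ ss) v (plug2 (length ts) (length ss) \<Phi> D E) (xs @ ys) =
    onOps H [s, t] v \<Phi> [onOps H ts s D xs, onOps H ss t E ys]"
proof -
  have l: "length xs = length ts" "length ys = length ss"
    using xs ys by (auto simp: in_listset_iff dest: list_all2_lengthD)
  have xy: "xs @ ys \<in> listset (map (onCol H) (ts @ ss))"
    using xs ys by (simp add: in_listset_iff list_all2_appendI)
  \<comment> \<open>The intermediate argument list: the boxes of \<open>D\<close> keep their values,
    and the one box \<open>t\<close> receives the value of \<open>E\<close>.\<close>
  have y: "xs @ [onOps H ss t E ys] \<in> listset (map (onCol H) (ts @ [t]))"
    using xs ev_in[OF E ys] by (simp add: in_listset_iff list_all2_appendI)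
  show ?thesis
    using ev_pcomp[of E ss "ts @ [t]" "length ts" "diagram_pcomp (length ts) 0 D \<Phi>" v "xs @ ys"]
      ev_pcomp[of D ts "[s, t]" 0 \<Phi> v "xs @ [onOps H ss t E ys]"]
      plug2_steps(1)[OF D E \<Phi>] D E \<Phi> xy y
    by (simp add: plug2_def graft_first graft_last l)
qed

text \<open>A reordered operation of \<open>Set_operad\<close> first undoes the reordering of its
  arguments, which cancels the reordering applied to \<open>xs\<close>.\<close>

lemma ev_perm:
  assumes \<pi>: "\<pi> permutes {..<length ts}" and D: "D \<in> diagrams \<tau> ts v"
    and xs: "xs \<in> listset (map (onCol H) ts)"
  shows "onOps H (permute_list \<pi> ts) v (diagram_perm \<pi> D) (permute_list \<pi> xs) = onOps H ts v D xs"
proof -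
  have l: "length xs = length ts"
    using xs by (auto simp: in_listset_iff dest: list_all2_lengthD)
  have "permute_list \<pi> xs \<in> listset (permute_list \<pi> (map (onCol H) ts))"
    using xs \<pi> l permutes_in_image[OF \<pi>]
    by (auto simp: in_listset_iff list_all2_conv_all_nth permute_list_nth)
  then show ?thesis
    using onOps_Perm[of ts v \<pi> D] \<pi> D l permute_list_inv[of \<pi> xs]
    by (simp add: wiring_operad_def Set_operad_def diagrams_iff)
qed

text \<open>The normal form for morphisms: a wire function applied to a list of morphisms. Two
  morphisms in this form with equal boxes and arguments coincide as soon as their wire functions
  agree on source ports.\<close>

definition interp where
  "interp ts A B \<phi> xs = onOps H ts (A, B) (wires ts (A, B) \<phi>) xs"

definition well_typed where
  "well_typed ts A B \<phi> xs \<longleftrightarrow>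
    wires ts (A, B) \<phi> \<in> diagrams \<tau> ts (A, B) \<and> xs \<in> listset (map (onCol H) ts)"

abbreviation "\<C> \<equiv> smc_of_algebra \<tau> H"

lemma interp_cong:
  assumes "ts = ts'" and "xs = xs'"
    and "\<And>p. p < length A \<Longrightarrow> \<phi> (Outer p) = \<psi> (Outer p)"
    and "\<And>i p. i < length ts \<Longrightarrow> p < length (snd (ts ! i)) \<Longrightarrow> \<phi> (Inner i p) = \<psi> (Inner i p)"
  shows "interp ts A B \<phi> xs = interp ts' A B \<psi> xs'"
  unfolding interp_def assms(1,2)[symmetric] using wires_cong[of "(A, B)" \<phi> \<psi> ts] assms(3,4) by simp

lemma interp_in: "well_typed ts A B \<phi> xs \<Longrightarrow> interp ts A B \<phi> xs \<in> onCol H (A, B)"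
  by (simp add: well_typed_def interp_def ev_in)

text \<open>Preservation of operadic identities brings an arbitrary morphism \<open>f\<close> into
  the normal form, so that variables can take part in the calculations below.\<close>

lemma interp_box:
  "\<lbrakk>A \<in> lists \<tau>; B \<in> lists \<tau>; f \<in> onCol H (A, B)\<rbrakk> \<Longrightarrow> interp [(A, B)] A B id_wire [f] = f"
  unfolding interp_def diagram_id_eq_wires[symmetric] by (rule ev_id) auto

lemma well_typed_box:
  "\<lbrakk>A \<in> lists \<tau>; B \<in> lists \<tau>; f \<in> onCol H (A, B)\<rbrakk> \<Longrightarrow> well_typed [(A, B)] A B id_wire [f]"
  unfolding well_typed_def diagram_id_eq_wires[symmetric]
  by (simp add: diagram_id_in_diagrams in_listset_iff del: listset.simps)

lemma Idt_interp: "Idt \<C> A = interp [] A A (\<lambda>a. a) []"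
  by (simp add: smc_of_algebra_def interp_def unit_diagram_eq_wires)

lemma well_typed_Idt: "A \<in> lists \<tau> \<Longrightarrow> well_typed [] A A (\<lambda>a. a) []"
  using unit_in_diagrams[of A \<tau>] by (simp add: well_typed_def unit_diagram_eq_wires)

lemma Braid_interp: "Braid \<C> A B = interp [] (A @ B) (B @ A) (braid_wire (length A) (length B)) []"
  by (simp add: smc_of_algebra_def interp_def braid_diagram_def)

lemma well_typed_Braid:
  "\<lbrakk>A \<in> lists \<tau>; B \<in> lists \<tau>\<rbrakk> \<Longrightarrow> well_typed [] (A @ B) (B @ A) (braid_wire (length A) (length B)) []"
  using braid_in_diagrams[of A \<tau> B] by (simp add: well_typed_def braid_diagram_def)

text \<open>Kept for arbitrary diagrams, not only for those given by wire functions, because the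
  induction over generated diagrams applies it in this form to two algebras at once.\<close>

lemma Comp_ev:
  assumes "D \<in> diagrams \<tau> ts (A, B)" and "E \<in> diagrams \<tau> ss (B, C)"
    and "xs \<in> listset (map (onCol H) ts)" and "ys \<in> listset (map (onCol H) ss)"
  shows "Comp \<C> A B C (onOps H ts (A, B) D xs) (onOps H ss (B, C) E ys) =
    onOps H (ts @ ss) (A, C) (seq_comp ts ss A B C D E) (xs @ ys)"
proof -
  have "seq_diagram A B C \<in> diagrams \<tau> [(A, B), (B, C)] (A, C)"
    using assms by (intro seq_in_diagrams) (auto simp: diagrams_iff)
  from ev_plug2[OF assms(1,2) this assms(3,4)] show ?thesis
    by (simp add: smc_of_algebra_def seq_comp_def)
qed

lemma Tensor_ev:
  assumes "D \<in> diagrams \<tau> ts (A, B)" and "E \<in> diagrams \<tau> ss (A', B')"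
    and "xs \<in> listset (map (onCol H) ts)" and "ys \<in> listset (map (onCol H) ss)"
  shows "Tensor \<C> A B A' B' (onOps H ts (A, B) D xs) (onOps H ss (A', B') E ys) =
    onOps H (ts @ ss) (A @ A', B @ B') (par_comp ts ss A B A' B' D E) (xs @ ys)"
proof -
  have "para_diagram A B A' B' \<in> diagrams \<tau> [(A, B), (A', B')] (A @ A', B @ B')"
    using assms by (intro para_in_diagrams) (auto simp: diagrams_iff)
  from ev_plug2[OF assms(1,2) this assms(3,4)] show ?thesis
    by (simp add: smc_of_algebra_def par_comp_def)
qed

lemma well_typed_seq:
  "\<lbrakk>well_typed ts A B \<phi> xs; well_typed ss B C \<psi> ys\<rbrakk> \<Longrightarrow> well_typed (ts @ ss) A C (seq_fun (length ts) \<phi> \<psi>) (xs @ ys)"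
  using seq_comp_wires(2)[of ts A B \<phi> \<tau> ss C \<psi>]
  by (auto simp: well_typed_def in_listset_iff list_all2_appendI)

lemma Comp_interp:
  "\<lbrakk>well_typed ts A B \<phi> xs; well_typed ss B C \<psi> ys\<rbrakk> \<Longrightarrow> Comp \<C> A B C (interp ts A B \<phi> xs) (interp ss B C \<psi> ys) =
    interp (ts @ ss) A C (seq_fun (length ts) \<phi> \<psi>) (xs @ ys)"
  using seq_comp_wires(1)[of ts A B \<phi> \<tau> ss C \<psi>]
    Comp_ev[of "wires ts (A, B) \<phi>" ts A B "wires ss (B, C) \<psi>" ss C xs ys]
  by (simp add: well_typed_def interp_def)

lemma well_typed_par:
  "\<lbrakk>well_typed ts A B \<phi> xs; well_typed ss A' B' \<psi> ys\<rbrakk>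
    \<Longrightarrow> well_typed (ts @ ss) (A @ A') (B @ B') (par_fun (length ts) (length A) (length B) \<phi> \<psi>) (xs @ ys)"
  using par_comp_wires(2)[of ts A B \<phi> \<tau> ss A' B' \<psi>]
  by (auto simp: well_typed_def in_listset_iff list_all2_appendI)

lemma Tensor_interp:
  "\<lbrakk>well_typed ts A B \<phi> xs; well_typed ss A' B' \<psi> ys\<rbrakk>
    \<Longrightarrow> Tensor \<C> A B A' B' (interp ts A B \<phi> xs) (interp ss A' B' \<psi> ys) =
      interp (ts @ ss) (A @ A') (B @ B') (par_fun (length ts) (length A) (length B) \<phi> \<psi>) (xs @ ys)"
  using par_comp_wires(1)[of ts A B \<phi> \<tau> ss A' B' \<psi>]
    Tensor_ev[of "wires ts (A, B) \<phi>" ts A B "wires ss (A', B') \<psi>" ss A' B' xs ys]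
  by (simp add: well_typed_def interp_def)

text \<open>Serves the axioms whose two sides mention the same morphisms in different orders; it
  changes the order of the boxes together with that of the arguments.\<close>

lemma interp_perm:
  assumes "well_typed ts A B \<phi> xs" and "\<pi> permutes {..<length ts}"
  shows "interp ts A B \<phi> xs = interp (permute_list \<pi> ts) A B
    (\<lambda>a. permute_port \<pi> (\<phi> (unpermute_port \<pi> a))) (permute_list \<pi> xs)"
  using ev_perm[OF assms(2), of "wires ts (A, B) \<phi>" "(A, B)" xs] assms
  by (simp add: well_typed_def interp_def perm_wires)

lemmas interp_simps = Comp_interp Tensor_interp Idt_interp Braid_interp well_typed_seq well_typed_par well_typed_box well_typed_Idt well_typed_Braid

section \<open>The axioms of a strict symmetric monoidal category\<close>

lemma smc_of_algebra_category: "category \<C>"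
proof
  fix a assume "a \<in> Obj \<C>"
  then show "Idt \<C> a \<in> Hom \<C> a a" by (simp add: Idt_interp well_typed_Idt interp_in)
next
  fix a b c f g
  assume "a \<in> Obj \<C>" "b \<in> Obj \<C>" "c \<in> Obj \<C>" "f \<in> Hom \<C> a b" "g \<in> Hom \<C> b c"
  then have *: "a \<in> lists \<tau>" "b \<in> lists \<tau>" "c \<in> lists \<tau>" "f \<in> onCol H (a, b)" "g \<in> onCol H (b, c)"
    by auto
  \<comment> \<open>The pattern for every axiom: variables are replaced by values of identity
    diagrams, each side is rewritten to one \<open>interp\<close>, and \<open>interp_box\<close>
    translates the result back.\<close>
  have "Comp \<C> a b c (interp [(a, b)] a b id_wire [f]) (interp [(b, c)] b c id_wire [g]) \<in> onCol H (a, c)"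
    by (simp only: interp_simps *) (intro interp_in well_typed_seq[OF well_typed_box well_typed_box] *)
  then show "Comp \<C> a b c f g \<in> Hom \<C> a c" using * by (simp add: interp_box)
next
  fix a b f
  assume "a \<in> Obj \<C>" "b \<in> Obj \<C>" "f \<in> Hom \<C> a b"
  then have *: "a \<in> lists \<tau>" "b \<in> lists \<tau>" "f \<in> onCol H (a, b)" by auto
  let ?f = "interp [(a, b)] a b id_wire [f]"
  have "Comp \<C> a a b (Idt \<C> a) ?f = ?f"
    by (simp only: interp_simps *, rule interp_cong) auto
  then show "Comp \<C> a a b (Idt \<C> a) f = f" using * by (simp add: interp_box)
  have "Comp \<C> a b b ?f (Idt \<C> b) = ?f"
    by (simp only: interp_simps *, rule interp_cong) auto
  then show "Comp \<C> a b b f (Idt \<C> b) = f" using * by (simp add: interp_box)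
next
  fix a b c d f g h
  assume "a \<in> Obj \<C>" "b \<in> Obj \<C>" "c \<in> Obj \<C>" "d \<in> Obj \<C>"
    "f \<in> Hom \<C> a b" "g \<in> Hom \<C> b c" "h \<in> Hom \<C> c d"
  then have *: "a \<in> lists \<tau>" "b \<in> lists \<tau>" "c \<in> lists \<tau>" "d \<in> lists \<tau>"
    "f \<in> onCol H (a, b)" "g \<in> onCol H (b, c)" "h \<in> onCol H (c, d)" by auto
  let ?f = "interp [(a, b)] a b id_wire [f]"
    and ?g = "interp [(b, c)] b c id_wire [g]" and ?h = "interp [(c, d)] c d id_wire [h]"
  note ok = well_typed_seq[OF well_typed_box well_typed_box, OF *(1,2,5) *(2,3,6)] well_typed_seq[OF well_typed_box well_typed_box, OF *(2,3,6) *(3,4,7)]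
  have "Comp \<C> a c d (Comp \<C> a b c ?f ?g) ?h = Comp \<C> a b d ?f (Comp \<C> b c d ?g ?h)"
    by (simp only: interp_simps ok *, rule interp_cong) (auto simp: less_Suc_eq)
  then show "Comp \<C> a c d (Comp \<C> a b c f g) h = Comp \<C> a b d f (Comp \<C> b c d g h)"
    using * by (simp add: interp_box)
qed

lemma smc_of_algebra_smc: "strict_symmetric_monoidal_category \<C>"
proof (intro strict_symmetric_monoidal_category.intro smc_of_algebra_category
    strict_symmetric_monoidal_category_axioms.intro)
  fix a b a' b' f g
  assume "a \<in> Obj \<C>" "b \<in> Obj \<C>" "a' \<in> Obj \<C>" "b' \<in> Obj \<C>" "f \<in> Hom \<C> a b" "g \<in> Hom \<C> a' b'"
  then have *: "a \<in> lists \<tau>" "b \<in> lists \<tau>" "a' \<in> lists \<tau>" "b' \<in> lists \<tau>"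
    "f \<in> onCol H (a, b)" "g \<in> onCol H (a', b')" by auto
  let ?f = "interp [(a, b)] a b id_wire [f]" and ?g = "interp [(a', b')] a' b' id_wire [g]"
  have "Tensor \<C> a b a' b' ?f ?g \<in> onCol H (a @ a', b @ b')"
    by (simp only: interp_simps *) (intro interp_in well_typed_par well_typed_box *)
  then show "Tensor \<C> a b a' b' f g \<in> Hom \<C> (TensorOb \<C> a a') (TensorOb \<C> b b')"
    using * by (simp add: interp_box)
  \<comment> \<open>Tensoring before the braiding lists the boxes as \<open>f, g\<close>, tensoring
    after it as \<open>g, f\<close>.\<close>
  define \<pi> :: "nat \<Rightarrow> nat" where "\<pi> = transpose 0 1"
  have ok: "well_typed ([(a, b)] @ [(a', b')] @ []) (a @ a') (b' @ b)
      (seq_fun (length ([(a, b)] @ [(a', b')])) (par_fun (length [(a, b)]) (length a) (length b) id_wire id_wire)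
        (braid_wire (length b) (length b'))) ([f] @ [g] @ [])"
    using well_typed_seq[OF well_typed_par[OF well_typed_box well_typed_box] well_typed_Braid] * by auto
  have \<pi>: "\<pi> permutes {..<length ([(a, b)] @ [(a', b')] @ [])}"
    unfolding \<pi>_def by (rule permutes_swap_id) auto
  have "Comp \<C> (a @ a') (b @ b') (b' @ b) (Tensor \<C> a b a' b' ?f ?g) (Braid \<C> b b') =
      Comp \<C> (a @ a') (a' @ a) (b' @ b) (Braid \<C> a a') (Tensor \<C> a' b' a b ?g ?f)"
    by (simp only: interp_simps * append_assoc, subst interp_perm[OF ok \<pi>], rule interp_cong)
      (auto simp: \<pi>_def permute_list_def less_Suc_eq transpose_def upt_rec)
  then show "Comp \<C> (TensorOb \<C> a a') (TensorOb \<C> b b') (TensorOb \<C> b' b)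
      (Tensor \<C> a b a' b' f g) (Braid \<C> b b') =
    Comp \<C> (TensorOb \<C> a a') (TensorOb \<C> a' a) (TensorOb \<C> b' b)
      (Braid \<C> a a') (Tensor \<C> a' b' a b g f)"
    using * by (simp add: interp_box)
next
  fix a b assume "a \<in> Obj \<C>" "b \<in> Obj \<C>"
  then have *: "a \<in> lists \<tau>" "b \<in> lists \<tau>" by auto
  show "TensorOb \<C> a b \<in> Obj \<C>" using * by simp
  have "Tensor \<C> a a b b (Idt \<C> a) (Idt \<C> b) = Idt \<C> (a @ b)"
    by (simp only: interp_simps *, rule interp_cong) auto
  then show "Tensor \<C> a a b b (Idt \<C> a) (Idt \<C> b) = Idt \<C> (TensorOb \<C> a b)" by simp
  have "Braid \<C> a b \<in> onCol H (a @ b, b @ a)"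
    by (simp only: interp_simps *) (intro interp_in well_typed_Braid *)
  then show "Braid \<C> a b \<in> Hom \<C> (TensorOb \<C> a b) (TensorOb \<C> b a)" by simp
  have "Comp \<C> (a @ b) (b @ a) (a @ b) (Braid \<C> a b) (Braid \<C> b a) = Idt \<C> (a @ b)"
    by (simp only: interp_simps *, rule interp_cong) auto
  then show "Comp \<C> (TensorOb \<C> a b) (TensorOb \<C> b a) (TensorOb \<C> a b) (Braid \<C> a b) (Braid \<C> b a)
      = Idt \<C> (TensorOb \<C> a b)" by simp
next
  fix a b c a' b' c' f g f' g'
  assume "a \<in> Obj \<C>" "b \<in> Obj \<C>" "c \<in> Obj \<C>" "a' \<in> Obj \<C>" "b' \<in> Obj \<C>" "c' \<in> Obj \<C>"
    "f \<in> Hom \<C> a b" "g \<in> Hom \<C> b c" "f' \<in> Hom \<C> a' b'" "g' \<in> Hom \<C> b' c'"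
  then have *: "a \<in> lists \<tau>" "b \<in> lists \<tau>" "c \<in> lists \<tau>" "a' \<in> lists \<tau>" "b' \<in> lists \<tau>" "c' \<in> lists \<tau>"
    "f \<in> onCol H (a, b)" "g \<in> onCol H (b, c)" "f' \<in> onCol H (a', b')" "g' \<in> onCol H (b', c')"
    by auto
  let ?f = "interp [(a, b)] a b id_wire [f]" and ?g = "interp [(b, c)] b c id_wire [g]"
    and ?f' = "interp [(a', b')] a' b' id_wire [f']" and ?g' = "interp [(b', c')] b' c' id_wire [g']"
  \<comment> \<open>The left side of the interchange law lists the boxes as
    \<open>f, g, f', g'\<close>, the right side as \<open>f, f', g, g'\<close>; exchanging positions
    \<open>1\<close> and \<open>2\<close> reconciles them.\<close>
  define \<pi> :: "nat \<Rightarrow> nat" where "\<pi> = transpose 1 2"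
  note ok_fg = well_typed_seq[OF well_typed_box well_typed_box, OF *(1,2,7) *(2,3,8)] well_typed_seq[OF well_typed_box well_typed_box, OF *(4,5,9) *(5,6,10)]
  note ok = well_typed_par[OF ok_fg]
  have \<pi>: "\<pi> permutes {..<length (([(a, b)] @ [(b, c)]) @ ([(a', b')] @ [(b', c')]))}"
    unfolding \<pi>_def by (rule permutes_swap_id) auto
  have "Tensor \<C> a c a' c' (Comp \<C> a b c ?f ?g) (Comp \<C> a' b' c' ?f' ?g') =
      Comp \<C> (a @ a') (b @ b') (c @ c') (Tensor \<C> a b a' b' ?f ?f') (Tensor \<C> b c b' c' ?g ?g')"
    by (simp only: interp_simps ok_fg *, subst interp_perm[OF ok \<pi>], rule interp_cong)
      (auto simp: \<pi>_def permute_list_def less_Suc_eq transpose_def upt_rec)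
  then show "Tensor \<C> a c a' c' (Comp \<C> a b c f g) (Comp \<C> a' b' c' f' g') =
      Comp \<C> (TensorOb \<C> a a') (TensorOb \<C> b b') (TensorOb \<C> c c')
        (Tensor \<C> a b a' b' f f') (Tensor \<C> b c b' c' g g')"
    using * by (simp add: interp_box)
next
  fix a b f assume "a \<in> Obj \<C>" "b \<in> Obj \<C>" "f \<in> Hom \<C> a b"
  then have *: "a \<in> lists \<tau>" "b \<in> lists \<tau>" "f \<in> onCol H (a, b)" "[] \<in> lists \<tau>" by auto
  let ?f = "interp [(a, b)] a b id_wire [f]"
  have "Tensor \<C> [] [] a b (Idt \<C> []) ?f = ?f"
    by (simp only: interp_simps * append_Nil, rule interp_cong) auto
  then show "Tensor \<C> (UnitOb \<C>) (UnitOb \<C>) a b (Idt \<C> (UnitOb \<C>)) f = f"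
    using * by (simp add: interp_box)
  have "Tensor \<C> a b [] [] ?f (Idt \<C> []) = ?f"
    by (simp only: interp_simps * append_Nil2, rule interp_cong) auto
  then show "Tensor \<C> a b (UnitOb \<C>) (UnitOb \<C>) f (Idt \<C> (UnitOb \<C>)) = f"
    using * by (simp add: interp_box)
next
  fix a b a' b' a'' b'' f g h
  assume "a \<in> Obj \<C>" "b \<in> Obj \<C>" "a' \<in> Obj \<C>" "b' \<in> Obj \<C>" "a'' \<in> Obj \<C>" "b'' \<in> Obj \<C>"
    "f \<in> Hom \<C> a b" "g \<in> Hom \<C> a' b'" "h \<in> Hom \<C> a'' b''"
  then have *: "a \<in> lists \<tau>" "b \<in> lists \<tau>" "a' \<in> lists \<tau>" "b' \<in> lists \<tau>" "a'' \<in> lists \<tau>" "b'' \<in> lists \<tau>"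
    "f \<in> onCol H (a, b)" "g \<in> onCol H (a', b')" "h \<in> onCol H (a'', b'')" by auto
  let ?f = "interp [(a, b)] a b id_wire [f]" and ?g = "interp [(a', b')] a' b' id_wire [g]"
    and ?h = "interp [(a'', b'')] a'' b'' id_wire [h]"
  have "Tensor \<C> (a @ a') (b @ b') a'' b'' (Tensor \<C> a b a' b' ?f ?g) ?h =
      Tensor \<C> a b (a' @ a'') (b' @ b'') ?f (Tensor \<C> a' b' a'' b'' ?g ?h)"
    by (simp only: interp_simps *, simp only: append_assoc, rule interp_cong) (auto simp: less_Suc_eq)
  then show "Tensor \<C> (TensorOb \<C> a a') (TensorOb \<C> b b') a'' b'' (Tensor \<C> a b a' b' f g) h =
      Tensor \<C> a b (TensorOb \<C> a' a'') (TensorOb \<C> b' b'') f (Tensor \<C> a' b' a'' b'' g h)"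
    using * by (simp add: interp_box)
next
  fix a b c assume "a \<in> Obj \<C>" "b \<in> Obj \<C>" "c \<in> Obj \<C>"
  then have *: "a \<in> lists \<tau>" "b \<in> lists \<tau>" "c \<in> lists \<tau>" "b @ c \<in> lists \<tau>" by auto
  show "TensorOb \<C> (TensorOb \<C> a b) c = TensorOb \<C> a (TensorOb \<C> b c)" by simp
  \<comment> \<open>The two factors are evaluated separately so that their outer boxes can be
    reassociated to a common middle object \<open>b @ a @ c\<close> before they are
    composed.\<close>
  have 1: "Tensor \<C> (a @ b) (b @ a) c c (Braid \<C> a b) (Idt \<C> c) =
      interp [] (a @ b @ c) (b @ a @ c) (par_fun 0 (length (a @ b)) (length (b @ a))
        (braid_wire (length a) (length b)) (\<lambda>a. a)) []"
    and ok1: "well_typed [] (a @ b @ c) (b @ a @ c) (par_fun 0 (length (a @ b)) (length (b @ a))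
        (braid_wire (length a) (length b)) (\<lambda>a. a)) []"
    using Tensor_interp[OF well_typed_Braid[OF *(1,2)] well_typed_Idt[OF *(3)]]
      well_typed_par[OF well_typed_Braid[OF *(1,2)] well_typed_Idt[OF *(3)]] by (simp_all add: Idt_interp Braid_interp)
  have 2: "Tensor \<C> b b (a @ c) (c @ a) (Idt \<C> b) (Braid \<C> a c) =
      interp [] (b @ a @ c) (b @ c @ a) (par_fun 0 (length b) (length b)
        (\<lambda>a. a) (braid_wire (length a) (length c))) []"
    and ok2: "well_typed [] (b @ a @ c) (b @ c @ a) (par_fun 0 (length b) (length b)
        (\<lambda>a. a) (braid_wire (length a) (length c))) []"
    using Tensor_interp[OF well_typed_Idt[OF *(2)] well_typed_Braid[OF *(1,3)]]
      well_typed_par[OF well_typed_Idt[OF *(2)] well_typed_Braid[OF *(1,3)]] by (simp_all add: Idt_interp Braid_interp)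
  \<comment> \<open>Moving the block \<open>a\<close> past \<open>b @ c\<close> at once is moving it
    past \<open>b\<close> and then past \<open>c\<close>. No boxes are involved, so this is
    arithmetic on positions.\<close>
  have "Braid \<C> a (b @ c) =
      interp ([] @ []) (a @ b @ c) (b @ c @ a) (seq_fun (length ([] :: 't box list))
        (par_fun 0 (length (a @ b)) (length (b @ a)) (braid_wire (length a) (length b)) (\<lambda>a. a))
        (par_fun 0 (length b) (length b) (\<lambda>a. a) (braid_wire (length a) (length c)))) ([] @ [])"
    by (simp only: Braid_interp append_assoc, rule interp_cong) auto
  then show "Braid \<C> a (TensorOb \<C> b c) =
      Comp \<C> (TensorOb \<C> (TensorOb \<C> a b) c) (TensorOb \<C> (TensorOb \<C> b a) c)
        (TensorOb \<C> b (TensorOb \<C> c a))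
        (Tensor \<C> (TensorOb \<C> a b) (TensorOb \<C> b a) c c (Braid \<C> a b) (Idt \<C> c))
        (Tensor \<C> b b (TensorOb \<C> a c) (TensorOb \<C> c a) (Idt \<C> b) (Braid \<C> a c))"
    by (simp only: smc_of_algebra_simps append_assoc 1 2 Comp_interp[OF ok1 ok2])
qed (simp_all)

end

section \<open>Generation of all wiring diagrams\<close>

text \<open>Every rule is an operation along which naturality can be propagated, either because a
  symmetric monoidal functor preserves it or because both algebras respect it. Only
  \<open>gen_id\<close> introduces a box, and only \<open>gen_perm\<close> changes the order in
  which boxes are listed.\<close>

inductive generated :: "'t set \<Rightarrow> 't box list \<Rightarrow> 't box \<Rightarrow> diagram \<Rightarrow> bool" for \<tau> where
  gen_id: "t \<in> boxes \<tau> \<Longrightarrow> generated \<tau> [t] t (diagram_id t)"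
| gen_unit: "A \<in> lists \<tau> \<Longrightarrow> generated \<tau> [] (A, A) (unit_diagram A)"
| gen_braid: "\<lbrakk>A \<in> lists \<tau>; B \<in> lists \<tau>\<rbrakk> \<Longrightarrow> generated \<tau> [] (A @ B, B @ A) (braid_diagram A B)"
| gen_seq: "\<lbrakk>generated \<tau> ts (A, B) D; generated \<tau> ss (B, C) E\<rbrakk>
    \<Longrightarrow> generated \<tau> (ts @ ss) (A, C) (seq_comp ts ss A B C D E)"
| gen_par: "\<lbrakk>generated \<tau> ts (A, B) D; generated \<tau> ss (A', B') E\<rbrakk>
    \<Longrightarrow> generated \<tau> (ts @ ss) (A @ A', B @ B') (par_comp ts ss A B A' B' D E)"
| gen_perm: "\<lbrakk>generated \<tau> ts v D; \<pi> permutes {..<length ts}\<rbrakk>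
    \<Longrightarrow> generated \<tau> (permute_list \<pi> ts) v (diagram_perm \<pi> D)"

lemma generated_in_diagrams: "generated \<tau> ts v D \<Longrightarrow> D \<in> diagrams \<tau> ts v"
proof (induction rule: generated.induct)
  case (gen_seq ts A B D ss C E)
  then have "seq_diagram A B C \<in> diagrams \<tau> [(A, B), (B, C)] (A, C)"
    by (intro seq_in_diagrams) (auto simp: diagrams_iff)
  then show ?case unfolding seq_comp_def using plug2_steps(2) gen_seq.IH by blast
next
  case (gen_par ts A B D ss A' B' E)
  then have "para_diagram A B A' B' \<in> diagrams \<tau> [(A, B), (A', B')] (A @ A', B @ B')"
    by (intro para_in_diagrams) (auto simp: diagrams_iff)
  then show ?case unfolding par_comp_def using plug2_steps(2) gen_par.IH by blast
qed (simp_all add: diagram_id_in_diagrams unit_in_diagrams braid_in_diagrams perm_in_diagrams)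

lemma gen_seq_wires:
  assumes "generated \<tau> ts (A, B) (wires ts (A, B) \<phi>)" and "generated \<tau> ss (B, C) (wires ss (B, C) \<psi>)"
  shows "generated \<tau> (ts @ ss) (A, C) (wires (ts @ ss) (A, C) (seq_fun (length ts) \<phi> \<psi>))"
  using gen_seq[OF assms] seq_comp_wires(1)[OF assms[THEN generated_in_diagrams]] by simp

lemma gen_par_wires:
  assumes "generated \<tau> ts (A, B) (wires ts (A, B) \<phi>)"
    and "generated \<tau> ss (A', B') (wires ss (A', B') \<psi>)"
  shows "generated \<tau> (ts @ ss) (A @ A', B @ B')
    (wires (ts @ ss) (A @ A', B @ B') (par_fun (length ts) (length A) (length B) \<phi> \<psi>))"
  using gen_par[OF assms] par_comp_wires(1)[OF assms[THEN generated_in_diagrams]] by simp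

section \<open>Diagrams without inner boxes\<close>

fun perm_wire :: "(nat \<Rightarrow> nat) \<Rightarrow> port \<Rightarrow> port" where
  "perm_wire \<sigma> (Outer p) = Outer (\<sigma> p)"
| "perm_wire \<sigma> (Inner i p) = Inner i p"

text \<open>Selection sort by braidings: the wire destined for output \<open>0\<close> is moved in
  front of the wires before it, and the remaining ones are permuted by induction, in parallel with
  an identity on that wire.\<close>

lemma generated_perm_wire:
  fixes A B :: "'t list"
  assumes "bij_betw \<sigma> {..<length A} {..<length B}" and "\<And>p. p < length A \<Longrightarrow> B ! \<sigma> p = A ! p"
    and "A \<in> lists \<tau>" and "B \<in> lists \<tau>"
  shows "generated \<tau> [] (A, B) (wires [] (A, B) (perm_wire \<sigma>))"
  using assms
proof (induction B arbitrary: A \<sigma>)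
  case Nil
  then have "A = []" by (simp add: bij_betw_def lessThan_empty_iff)
  moreover have "wires [] ([] :: 't list, [] :: 't list) (perm_wire \<sigma>) = unit_diagram ([] :: 't list)"
    unfolding unit_diagram_eq_wires by (rule wires_cong) auto
  ultimately show ?case using gen_unit[of "[]" \<tau>] by simp
next
  case (Cons b B)
  have "0 \<in> \<sigma> ` {..<length A}" using Cons.prems(1) by (simp add: bij_betw_def)
  then obtain p where p: "p < length A" "\<sigma> p = 0" by auto
  define A1 A2 where "A1 = take p A" and "A2 = drop (Suc p) A"
  have Ap: "A ! p = b" using Cons.prems(2)[OF p(1)] p(2) by simp
  have A: "A = A1 @ b # A2" and lA: "length A1 = p" "length A = Suc (length (A1 @ A2))"
    using id_take_nth_drop[OF p(1)] p(1) Ap by (simp_all add: A1_def A2_def)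
  have \<sigma>0: "\<sigma> q \<noteq> 0" if "q < length A" "q \<noteq> p" for q
    using Cons.prems(1) p that by (auto simp: bij_betw_def inj_on_def)
  \<comment> \<open>\<open>\<sigma>\<close> with input \<open>p\<close> and output \<open>0\<close>
    deleted: inputs after \<open>p\<close> close the gap, and the other outputs, all positive, drop
    by one.\<close>
  define \<sigma>' where "\<sigma>' = (\<lambda>j. \<sigma> (if j < p then j else Suc j) - 1)"
  have "bij_betw (\<lambda>j. if j < p then j else Suc j) {..<length (A1 @ A2)} ({..<length A} - {p})"
    by (rule bij_betw_byWitness[of _ "\<lambda>j. if j < p then j else j - 1"]) (use p lA in auto)
  moreover have "bij_betw \<sigma> ({..<length A} - {p}) ({..<length (b # B)} - {0})"
    using bij_betw_DiffI[OF Cons.prems(1), of "{p}" "{0}"] p by (auto simp: bij_betw_def)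
  moreover have "bij_betw (\<lambda>j. j - 1) ({..<length (b # B)} - {0}) {..<length B}"
    by (rule bij_betw_byWitness[of _ Suc]) auto
  ultimately have "bij_betw ((\<lambda>j. j - 1) \<circ> (\<sigma> \<circ> (\<lambda>j. if j < p then j else Suc j)))
      {..<length (A1 @ A2)} {..<length B}" by (blast intro: bij_betw_trans)
  then have bij': "bij_betw \<sigma>' {..<length (A1 @ A2)} {..<length B}"
    by (simp add: \<sigma>'_def o_def)
  have types': "B ! \<sigma>' j = (A1 @ A2) ! j" if "j < length (A1 @ A2)" for j
  proof -
    let ?q = "if j < p then j else Suc j"
    have q: "?q < length A" "?q \<noteq> p" using that lA by auto
    have "B ! \<sigma>' j = (b # B) ! \<sigma> ?q" using \<sigma>0[OF q] by (simp add: \<sigma>'_def nth_Cons')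
    also have "\<dots> = A ! ?q" by (rule Cons.prems(2)[OF q(1)])
    also have "\<dots> = (A1 @ A2) ! j" unfolding A using lA(1) by (auto simp: nth_append nth_Cons')
    finally show ?thesis .
  qed
  have lists: "A1 \<in> lists \<tau>" "A2 \<in> lists \<tau>" "[b] \<in> lists \<tau>" "B \<in> lists \<tau>"
    using Cons.prems(3,4) by (auto simp: A)
  have gu: "generated \<tau> [] (X, X) (wires [] (X, X) (\<lambda>a. a))" if "X \<in> lists \<tau>" for X
    using gen_unit[OF that] by (simp add: unit_diagram_eq_wires)
  note gb = gen_braid[OF lists(1,3), unfolded braid_diagram_def]
  have "generated \<tau> [] (A1 @ A2, B) (wires [] (A1 @ A2, B) (perm_wire \<sigma>'))"
    using Cons.IH[OF bij' types'] lists by auto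
  note 2 = gen_par_wires[OF gu[OF lists(3)] this]
  \<comment> \<open>The braiding exchanges the block \<open>A1\<close> of length \<open>p\<close>
    with the single wire \<open>b\<close>, while \<open>A2\<close> stays in place.\<close>
  have "generated \<tau> [] (A, [b] @ A1 @ A2) (wires [] (A, [b] @ A1 @ A2)
      (par_fun 0 (Suc p) (Suc p) (braid_wire p 1) (\<lambda>a. a)))"
    using gen_par_wires[OF gb gu[OF lists(2)]] by (simp add: A lA)
  from gen_seq_wires[OF this 2]
  have "generated \<tau> [] (A, b # B) (wires [] (A, b # B) (seq_fun 0
      (par_fun 0 (Suc p) (Suc p) (braid_wire p 1) (\<lambda>a. a)) (par_fun 0 1 1 (\<lambda>a. a) (perm_wire \<sigma>'))))"
    by simp
  moreover have "wires [] (A, b # B) (perm_wire \<sigma>) = wires [] (A, b # B) (seq_fun 0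
      (par_fun 0 (Suc p) (Suc p) (braid_wire p 1) (\<lambda>a. a)) (par_fun 0 1 1 (\<lambda>a. a) (perm_wire \<sigma>')))"
  proof (rule wires_cong)
    fix q assume "q < length (fst (A, b # B))"
    then have q: "q < length A" by simp
    consider "q < p" | "q = p" | "p < q" by linarith
    then show "perm_wire \<sigma> (Outer q) = seq_fun 0 (par_fun 0 (Suc p) (Suc p) (braid_wire p 1) (\<lambda>a. a))
        (par_fun 0 1 1 (\<lambda>a. a) (perm_wire \<sigma>')) (Outer q)"
      using \<sigma>0[OF q] p by cases (auto simp: \<sigma>'_def)
  qed simp
  ultimately show ?case by simp
qed

fun port_index :: "port \<Rightarrow> nat" where
  "port_index (Outer p) = p"
| "port_index (Inner i p) = p"

lemma generated_no_boxes:
  assumes "D \<in> diagrams \<tau> [] v"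
  shows "generated \<tau> [] v D"
proof -
  obtain A B where v: "v = (A, B)" by (cases v)
  from diagram_eq_wires[OF assms] obtain \<phi> where \<phi>: "D = wires [] (A, B) \<phi>" by (auto simp: v)
  note D = assms[unfolded \<phi> v wires_in_diagrams_iff]
  have s: "src_ports [] (A, B) = Outer ` {..<length A}" "tgt_ports [] (A, B) = Outer ` {..<length B}"
    by (auto simp: src_ports_def tgt_ports_def)
  let ?\<sigma> = "\<lambda>p. port_index (\<phi> (Outer p))"
  have out: "\<phi> (Outer p) = Outer (?\<sigma> p)" if "p < length A" for p
    using wires_tgt[OF assms[unfolded \<phi> v], of "Outer p"] that by (cases "\<phi> (Outer p)") auto
  have "bij_betw Outer {..<length A} (src_ports [] (A, B))"
    "bij_betw port_index (tgt_ports [] (A, B)) {..<length B}"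
    unfolding s by (auto simp: bij_betw_def inj_on_def image_image)
  then have "bij_betw (port_index \<circ> (\<phi> \<circ> Outer)) {..<length A} {..<length B}"
    using D by (blast intro: bij_betw_trans)
  then have "bij_betw ?\<sigma> {..<length A} {..<length B}" by (simp add: o_def)
  moreover have "B ! ?\<sigma> p = A ! p" if "p < length A" for p
  proof -
    have "Outer p \<in> src_ports [] (A, B)" using that by simp
    then have "src_type [] (A, B) (Outer p) = tgt_type [] (A, B) (\<phi> (Outer p))" using D by blast
    also have "\<dots> = B ! ?\<sigma> p" by (subst out[OF that]) simp
    finally show ?thesis by simp
  qed
  ultimately have "generated \<tau> [] (A, B) (wires [] (A, B) (perm_wire ?\<sigma>))"
    using D by (intro generated_perm_wire) auto
  moreover have "wires [] (A, B) (perm_wire ?\<sigma>) = wires [] (A, B) \<phi>"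
    by (rule wires_cong) (use out in auto)
  ultimately show ?thesis by (simp add: \<phi> v)
qed

section \<open>Splitting off a box that is fed by outer inputs only\<close>

fun lower_port :: "port \<Rightarrow> port" where
  "lower_port (Outer q) = Outer q"
| "lower_port (Inner j q) = Inner (j - 1) q"

text \<open>When no inner box feeds the first box \<open>t\<close>, the diagram factors as: permute the outer inputs
  so that those of \<open>t\<close> come first, apply \<open>t\<close> in parallel with an identity, continue with the
  other boxes.\<close>

lemma generated_strip_first_box:
  assumes D: "wires (t # ts) v \<phi> \<in> diagrams \<tau> (t # ts) v"
    and first: "\<And>i p q. Inner i p \<in> src_ports (t # ts) v \<Longrightarrow> \<phi> (Inner i p) \<noteq> Inner 0 q"
    and IH: "\<And>v' E. E \<in> diagrams \<tau> ts v' \<Longrightarrow> generated \<tau> ts v' E"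
  shows "generated \<tau> (t # ts) v (wires (t # ts) v \<phi>)"
proof -
  let ?S = "src_ports (t # ts) v" and ?T = "tgt_ports (t # ts) v"
  obtain A B where v: "v = (A, B)" by (cases v)
  obtain A0 B0 where t: "t = (A0, B0)" by (cases t)
  have bij: "bij_betw \<phi> ?S ?T" using D by (simp add: wires_in_diagrams_iff)
  have types: "src_type (t # ts) v a = tgt_type (t # ts) v (\<phi> a)" if "a \<in> ?S" for a
    using D that by (simp add: wires_in_diagrams_iff)
  have boxes: "A0 \<in> lists \<tau>" "B0 \<in> lists \<tau>" "A \<in> lists \<tau>" "B \<in> lists \<tau>" "set ts \<subseteq> boxes \<tau>"
    using D by (auto simp: diagrams_iff v t)
  \<comment> \<open>The outer inputs wired to the first box. Since no inner box feeds it, these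
    inputs account for all of its ports, so there are exactly \<open>length A0\<close> of
    them.\<close>
  define S0 where "S0 = {p \<in> {..<length A}. \<exists>q. \<phi> (Outer p) = Inner 0 q}"
  have bij0: "bij_betw (\<lambda>p. port_index (\<phi> (Outer p))) S0 {..<length A0}"
    unfolding bij_betw_def
  proof
    show "inj_on (\<lambda>p. port_index (\<phi> (Outer p))) S0"
    proof (rule inj_onI)
      fix p p' assume *: "p \<in> S0" "p' \<in> S0"
        "port_index (\<phi> (Outer p)) = port_index (\<phi> (Outer p'))"
      then have "\<phi> (Outer p) = \<phi> (Outer p')" by (auto simp: S0_def)
      moreover have "Outer p \<in> ?S" "Outer p' \<in> ?S" using * by (auto simp: S0_def v)
      ultimately show "p = p'" using bij by (auto simp: bij_betw_def dest: inj_onD)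
    qed
    show "(\<lambda>p. port_index (\<phi> (Outer p))) ` S0 = {..<length A0}"
    proof (intro equalityI subsetI)
      fix q assume "q \<in> (\<lambda>p. port_index (\<phi> (Outer p))) ` S0"
      then obtain p where p: "p < length A" "\<phi> (Outer p) = Inner 0 q" by (auto simp: S0_def)
      then show "q \<in> {..<length A0}" using wires_tgt[OF D, of "Outer p"] by (simp add: v t)
    next
      fix q assume "q \<in> {..<length A0}"
      then have "Inner 0 q \<in> \<phi> ` ?S"
        unfolding bij_betw_imp_surj_on[OF bij] by (simp add: t)
      then obtain a where a: "a \<in> ?S" "\<phi> a = Inner 0 q" by (metis imageE)
      then obtain p where "a = Outer p" using first by (cases a) auto
      then have "p \<in> S0" "q = port_index (\<phi> (Outer p))" using a by (auto simp: S0_def v)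
      then show "q \<in> (\<lambda>p. port_index (\<phi> (Outer p))) ` S0" by blast
    qed
  qed
  have S0: "S0 \<subseteq> {..<length A}" by (auto simp: S0_def)
  have card0: "card S0 = length A0" using bij_betw_same_card[OF bij0] by simp
  then have le: "length A0 \<le> length A" using card_mono[OF _ S0] by simp
  have "card ({..<length A} - S0) = card {length A0..<length A}"
    using S0 card0 by (simp add: card_Diff_subset finite_subset[OF S0])
  then obtain h where h: "bij_betw h ({..<length A} - S0) {length A0..<length A}"
    using finite_same_card_bij[of "{..<length A} - S0" "{length A0..<length A}"] by auto
  \<comment> \<open>An input of the first box is sent to the very port it feeds, so that after the
    permutation the box is attached by identity wires. The order \<open>h\<close> of the other
    inputs is arbitrary.\<close>
  define \<sigma> where "\<sigma> = (\<lambda>p. if p \<in> S0 then port_index (\<phi> (Outer p)) else h p)"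
  have "bij_betw \<sigma> (S0 \<union> ({..<length A} - S0)) ({..<length A0} \<union> {length A0..<length A})"
    unfolding \<sigma>_def by (rule bij_betw_disjoint_Un[OF bij0 h]) auto
  moreover have "S0 \<union> ({..<length A} - S0) = {..<length A}" using S0 by auto
  moreover have "{..<length A0} \<union> {length A0..<length A} = {..<length A}" using le by auto
  ultimately have bs: "bij_betw \<sigma> {..<length A} {..<length A}" by simp
  define \<rho> where "\<rho> = inv_into {..<length A} \<sigma>"
  have \<rho>\<sigma>: "\<rho> (\<sigma> p) = p" if "p < length A" for p
    unfolding \<rho>_def by (rule bij_betw_inv_into_left[OF bs]) (use that in simp)
  have \<sigma>\<rho>: "\<sigma> (\<rho> q) = q" if "q < length A" for q
    unfolding \<rho>_def by (rule bij_betw_inv_into_right[OF bs]) (use that in simp)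
  have \<rho>l: "\<rho> q < length A" if "q < length A" for q
    using bij_betwE[OF bij_betw_inv_into[OF bs]] that by (auto simp: \<rho>_def)
  have \<sigma>l: "\<sigma> p < length A" if "p < length A" for p
    using bij_betwE[OF bs] that by auto
  have h_ge: "length A0 \<le> h p" if "p < length A" "p \<notin> S0" for p
    using bij_betwE[OF h] that by auto
  have \<sigma>_iff: "\<sigma> p < length A0 \<longleftrightarrow> p \<in> S0" if "p < length A" for p
    using bij_betwE[OF bij0] h_ge[OF that] by (auto simp: \<sigma>_def not_less)
  have to0: "\<phi> (Outer p) = Inner 0 (\<sigma> p)" if "p < length A" "\<sigma> p < length A0" for p
    using that \<sigma>_iff[OF that(1)] by (auto simp: \<sigma>_def S0_def)
  have not0: "\<phi> (Outer p) \<noteq> Inner 0 q" if "p < length A" "\<not> \<sigma> p < length A0" for p q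
    using that \<sigma>_iff[OF that(1)] by (auto simp: S0_def)

  \<comment> \<open>The types of the inputs that bypass the first box, listed in the order chosen by
    \<open>h\<close>.\<close>
  define R where "R = map (\<lambda>q. A ! \<rho> q) [length A0..<length A]"
  have lR: "length R = length A - length A0" by (simp add: R_def)
  have R: "R \<in> lists \<tau>" using boxes(3) \<rho>l by (auto simp: R_def in_lists_conv_set)
  have R_nth: "R ! (q - length A0) = A ! \<rho> q" if "length A0 \<le> q" "q < length A" for q
    using that nth_upt[of "length A0" "q - length A0" "length A"] by (simp add: R_def)
  have 1: "generated \<tau> [] (A, A0 @ R) (wires [] (A, A0 @ R) (perm_wire \<sigma>))"
  proof (rule generated_perm_wire)
    show "bij_betw \<sigma> {..<length A} {..<length (A0 @ R)}" using bs lR le by simp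
    fix p assume p: "p < length A"
    show "(A0 @ R) ! \<sigma> p = A ! p"
    proof (cases "\<sigma> p < length A0")
      case True
      then show ?thesis using types[of "Outer p"] to0[OF p True] p by (simp add: v t nth_append)
    next
      case False
      then show ?thesis using R_nth[of "\<sigma> p"] \<sigma>l[OF p] \<rho>\<sigma>[OF p] by (simp add: nth_append)
    qed
  qed (use boxes R in auto)
  have 2: "generated \<tau> [t] (A0 @ R, B0 @ R)
      (wires [t] (A0 @ R, B0 @ R) (par_fun 1 (length A0) (length B0) id_wire (\<lambda>a. a)))"
    using gen_par_wires[of \<tau> "[t]" A0 B0 id_wire "[]" R R "\<lambda>a. a"] gen_id[of t \<tau>] gen_unit[OF R] boxes
    by (simp add: t diagram_id_eq_wires unit_diagram_eq_wires)

  \<comment> \<open>The outer box of the remaining diagram: its inputs are the outputs of the first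
    box followed by the bypassing wires. The map \<open>lift\<close> finds the source in the
    original diagram that each source of the remainder stands for.\<close>
  let ?v = "(B0 @ R, B)"
  let ?S' = "src_ports ts ?v" and ?T' = "tgt_ports ts ?v"
  define lift where "lift = case_port
    (\<lambda>p. if p < length B0 then Inner 0 p else Outer (\<rho> (p - length B0 + length A0)))
    (\<lambda>j p. Inner (Suc j) p)"
  define \<psi> where "\<psi> = (\<lambda>a. lower_port (\<phi> (lift a)))"
  \<comment> \<open>The wires of the remainder are the original wires that do not end at the first
    box; \<open>S1\<close> and \<open>T1\<close> are their sources and targets. The truncated
    \<open>j - 1\<close> in \<open>lower_port\<close> is harmless on \<open>T1\<close>.\<close>
  define S1 where "S1 = {a \<in> ?S. \<forall>q. \<phi> a \<noteq> Inner 0 q}"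
  define T1 where "T1 = {b \<in> ?T. \<forall>q. b \<noteq> Inner 0 q}"
  have bij1: "bij_betw lift ?S' S1"
  \<comment> \<open>The inverse of \<open>lift\<close>. An outer port in \<open>S1\<close> does not
    feed the first box, so \<open>\<sigma> p\<close> is at least \<open>length A0\<close> and the
    subtraction is exact.\<close>
  proof (rule bij_betw_byWitness[of _ "case_port (\<lambda>p. Outer (\<sigma> p - length A0 + length B0))
      (\<lambda>j p. if j = 0 then Outer p else Inner (j - 1) p)"])
    have *: "p - length B0 + length A0 < length A" if "p < length B0 + length R" "\<not> p < length B0" for p
      using that lR le by simp
    show "\<forall>a\<in>?S'. case_port (\<lambda>p. Outer (\<sigma> p - length A0 + length B0))
        (\<lambda>j p. if j = 0 then Outer p else Inner (j - 1) p) (lift a) = a"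
      using * by (auto simp: src_ports_def lift_def \<sigma>\<rho>)
    show "lift ` ?S' \<subseteq> S1"
    proof
      fix b assume "b \<in> lift ` ?S'"
      then obtain a where a: "a \<in> ?S'" "b = lift a" by blast
      show "b \<in> S1"
      proof (cases a)
        case (Outer p)
        show ?thesis
        proof (cases "p < length B0")
          case True
          then show ?thesis using first[of 0 p] by (auto simp: S1_def a(2) Outer lift_def t)
        next
          case False
          with a(1) Outer have "p - length B0 + length A0 < length A" using * by simp
          then show ?thesis using False not0[of "\<rho> (p - length B0 + length A0)"] \<rho>l \<sigma>\<rho>
            by (auto simp: S1_def a(2) Outer lift_def v)
        qed
      next
        case (Inner j p)
        then show ?thesis using a first[of "Suc j" p] by (auto simp: S1_def lift_def)
      qed
    qed
    have unlift: "lift (Outer (\<sigma> p - length A0 + length B0)) = Outer p \<and>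
        \<sigma> p - length A0 + length B0 < length B0 + length R" if "Outer p \<in> S1" for p
    proof -
      have "p < length A" using that by (simp add: S1_def v)
      moreover from this have "\<not> \<sigma> p < length A0" using to0[of p] that by (auto simp: S1_def)
      ultimately show ?thesis using \<rho>\<sigma>[of p] \<sigma>l[of p] lR by (auto simp: lift_def)
    qed
    show "\<forall>a\<in>S1. lift (case_port (\<lambda>p. Outer (\<sigma> p - length A0 + length B0))
        (\<lambda>j p. if j = 0 then Outer p else Inner (j - 1) p) a) = a"
    proof
      fix a assume "a \<in> S1"
      then show "lift (case_port (\<lambda>p. Outer (\<sigma> p - length A0 + length B0))
          (\<lambda>j p. if j = 0 then Outer p else Inner (j - 1) p) a) = a"
        using unlift by (cases a) (auto simp: lift_def S1_def t nth_Cons' split: if_splits)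
    qed
    show "case_port (\<lambda>p. Outer (\<sigma> p - length A0 + length B0))
        (\<lambda>j p. if j = 0 then Outer p else Inner (j - 1) p) ` S1 \<subseteq> ?S'"
    proof
      fix b assume "b \<in> case_port (\<lambda>p. Outer (\<sigma> p - length A0 + length B0))
        (\<lambda>j p. if j = 0 then Outer p else Inner (j - 1) p) ` S1"
      then obtain a where a: "a \<in> S1" "b = case_port (\<lambda>p. Outer (\<sigma> p - length A0 + length B0))
        (\<lambda>j p. if j = 0 then Outer p else Inner (j - 1) p) a" by blast
      then show "b \<in> ?S'" using unlift by (cases a) (auto simp: S1_def t nth_Cons' split: if_splits)
    qed
  qed
  have "\<phi> ` S1 = T1"
    using bij by (auto simp: S1_def T1_def bij_betw_def)
  then have bij2: "bij_betw \<phi> S1 T1"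
    by (intro bij_betw_subset[OF bij]) (auto simp: S1_def)
  have bij3: "bij_betw lower_port T1 ?T'"
    by (rule bij_betw_byWitness[of _ "case_port Outer (\<lambda>j q. Inner (Suc j) q)"])
      (auto simp: T1_def tgt_ports_def v nth_Cons' split: if_splits)
  have "bij_betw (lower_port \<circ> (\<phi> \<circ> lift)) ?S' ?T'"
    by (rule bij_betw_trans[OF bij_betw_trans[OF bij1 bij2] bij3])
  then have bijp: "bij_betw \<psi> ?S' ?T'" by (simp add: \<psi>_def o_def)
  have lift_S1: "lift a \<in> S1" if "a \<in> ?S'" for a using bij_betwE[OF bij1] that by blast
  have "wires ts ?v \<psi> \<in> diagrams \<tau> ts ?v"
    unfolding wires_in_diagrams_iff
  proof (intro conjI ballI)
    fix a assume a: "a \<in> ?S'"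
    have "src_type ts ?v a = src_type (t # ts) v (lift a)"
    proof (cases a)
      case (Outer p)
      then show ?thesis using a R_nth[of "p - length B0 + length A0"] lR le
        by (auto simp: lift_def v t nth_append)
    qed (simp add: lift_def)
    also have "\<dots> = tgt_type (t # ts) v (\<phi> (lift a))"
      using lift_S1[OF a] by (intro types) (simp add: S1_def)
    also have "\<dots> = tgt_type ts ?v (\<psi> a)"
      using lift_S1[OF a] by (cases "\<phi> (lift a)") (auto simp: \<psi>_def S1_def v nth_Cons')
    finally show "src_type ts ?v a = tgt_type ts ?v (\<psi> a)" .
  next
    \<comment> \<open>An edge from \<open>i\<close> to \<open>j\<close> in the remainder is an edge
      from \<open>Suc i\<close> to \<open>Suc j\<close> in the original, so progress is
      inherited.\<close>
    have "box_edges (wires ts ?v \<psi>) \<subseteq> inv_image (box_edges (wires (t # ts) v \<phi>)) Suc"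
    proof
      fix e assume "e \<in> box_edges (wires ts ?v \<psi>)"
      then obtain i j p q where e: "e = (i, j)" "Inner i p \<in> ?S'" "Inner j q = \<psi> (Inner i p)"
        by (auto simp: box_edges_def)
      have l: "lift (Inner i p) = Inner (Suc i) p" by (simp add: lift_def)
      have "\<phi> (Inner (Suc i) p) = Inner (Suc j) q"
        using lift_S1[OF e(2)] e(3) by (cases "\<phi> (Inner (Suc i) p)") (auto simp: \<psi>_def S1_def l)
      moreover have "Inner (Suc i) p \<in> ?S" using e(2) by simp
      ultimately show "e \<in> inv_image (box_edges (wires (t # ts) v \<phi>)) Suc"
        by (auto simp: box_edges_def e(1))
    qed
    then show "acyclic (box_edges (wires ts ?v \<psi>))"
      by (rule wf_acyclic[OF wf_subset[OF wf_inv_image[OF wf_box_edges[OF D]]]])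
  qed (use boxes R bijp in auto)
  then have 3: "generated \<tau> ts ?v (wires ts ?v \<psi>)" by (rule IH)
  have "generated \<tau> (t # ts) (A, B) (wires (t # ts) (A, B) (seq_fun 1 (seq_fun 0 (perm_wire \<sigma>)
      (par_fun 1 (length A0) (length B0) id_wire (\<lambda>a. a))) \<psi>))"
    using gen_seq_wires[OF gen_seq_wires[OF 1 2] 3] by simp
  \<comment> \<open>Putting the first box back shifts positions up by one, which undoes
    \<open>lower_port\<close>.\<close>
  moreover have shift: "shift_port (Suc 0) 0 (\<psi> a) = \<phi> (lift a)" if "a \<in> ?S'" for a
    using lift_S1[OF that] by (cases "\<phi> (lift a)") (auto simp: \<psi>_def S1_def)
  have "wires (t # ts) (A, B) \<phi> = wires (t # ts) (A, B) (seq_fun 1 (seq_fun 0 (perm_wire \<sigma>)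
      (par_fun 1 (length A0) (length B0) id_wire (\<lambda>a. a))) \<psi>)"
  proof (rule wires_cong)
    fix p assume "p < length (fst (A, B))"
    then have p: "p < length A" by simp
    show "\<phi> (Outer p) = seq_fun 1 (seq_fun 0 (perm_wire \<sigma>)
      (par_fun 1 (length A0) (length B0) id_wire (\<lambda>a. a))) \<psi> (Outer p)"
    proof (cases "\<sigma> p < length A0")
      case True
      then show ?thesis using to0[OF p] by simp
    next
      case False
      then obtain d where d: "\<sigma> p = length A0 + d" by (metis le_Suc_ex not_less)
      then have "lift (Outer (length B0 + d)) = Outer p"
        using \<rho>\<sigma>[OF p] by (simp add: lift_def add.commute)
      moreover have "Outer (length B0 + d) \<in> ?S'" using \<sigma>l[OF p] lR d by simp
      ultimately show ?thesis using shift[of "Outer (length B0 + d)"] d by simp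
    qed
  next
    fix i p assume ip: "i < length (t # ts)" "p < length (snd ((t # ts) ! i))"
    show "\<phi> (Inner i p) = seq_fun 1 (seq_fun 0 (perm_wire \<sigma>)
      (par_fun 1 (length A0) (length B0) id_wire (\<lambda>a. a))) \<psi> (Inner i p)"
    proof (cases i)
      case 0
      then show ?thesis using ip shift[of "Outer p"] by (simp add: t lift_def)
    next
      case (Suc j)
      then show ?thesis using ip shift[of "Inner j p"] by (simp add: lift_def)
    qed
  qed
  ultimately show ?thesis by (simp add: v)
qed

lemma diagram_generated: "D \<in> diagrams \<tau> ts v \<Longrightarrow> generated \<tau> ts v D"
\<comment> \<open>The induction is on the number of boxes, not on the list, because the boxes are
  reordered before one of them is removed.\<close>
proof (induction "length ts" arbitrary: ts v D)
  case 0
  then show ?case by (simp add: generated_no_boxes)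
next
  case (Suc n)
  note D = \<open>D \<in> diagrams \<tau> ts v\<close>
  have "0 \<in> {..<length ts}" using Suc.hyps(2)[symmetric] by simp
  then obtain k where k: "k \<in> {..<length ts}"
    and min: "\<And>j. (j, k) \<in> box_edges D \<Longrightarrow> j \<notin> {..<length ts}"
    by (rule wfE_min[OF wf_box_edges[OF D]]) blast
  \<comment> \<open>A transposition brings the minimal box \<open>k\<close> to the front; being an
    involution, it also restores the original order at the end.\<close>
  define \<pi> :: "nat \<Rightarrow> nat" where "\<pi> = transpose 0 k"
  have \<pi>: "\<pi> permutes {..<length ts}"
    unfolding \<pi>_def using k by (intro permutes_swap_id) auto
  obtain t ts' where ts': "permute_list \<pi> ts = t # ts'" "length ts' = n"
    using Suc.hyps(2) by (cases "permute_list \<pi> ts") (auto dest: arg_cong[of _ _ length])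
  have E: "diagram_perm \<pi> D \<in> diagrams \<tau> (t # ts') v" using perm_in_diagrams[OF \<pi> D] ts' by simp
  from diagram_eq_wires[OF E] obtain \<phi> where \<phi>: "diagram_perm \<pi> D = wires (t # ts') v \<phi>" .
  have inv: "inv \<pi> = \<pi>" by (simp add: \<pi>_def)
  have pp: "permute_port \<pi> (permute_port \<pi> a) = a" for a
    by (cases a) (simp_all add: inv, simp add: \<pi>_def)
  have "generated \<tau> (t # ts') v (diagram_perm \<pi> D)"
    unfolding \<phi>
  proof (rule generated_strip_first_box)
    fix i p q assume i: "Inner i p \<in> src_ports (t # ts') v"
    show "\<phi> (Inner i p) \<noteq> Inner 0 q"
    proof
      assume "\<phi> (Inner i p) = Inner 0 q"
      with i have "(Inner i p, Inner 0 q) \<in> diagram_perm \<pi> D" unfolding \<phi> by auto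
      then obtain a b where ab: "(a, b) \<in> D" "Inner i p = permute_port \<pi> a"
        "Inner 0 q = permute_port \<pi> b" by (auto simp: diagram_perm_def)
      then have "a = permute_port \<pi> (Inner i p)" "b = permute_port \<pi> (Inner 0 q)" by (simp_all add: pp)
      then have "a = Inner (\<pi> i) p" "b = Inner k q"
        by (simp_all only: permute_port.simps inv) (simp add: \<pi>_def)
      with ab(1) have e: "(\<pi> i, k) \<in> box_edges D" "\<pi> i < length ts"
        using diagram_wireD(1)[OF D ab(1)] by (auto simp: box_edges_def)
      then show False using min[of "\<pi> i"] by simp
    qed
  qed (use E \<phi> Suc.hyps(1) ts' in auto)
  then have "generated \<tau> (permute_list \<pi> (permute_list \<pi> ts)) v (diagram_perm \<pi> (diagram_perm \<pi> D))"
    using \<pi> gen_perm[of \<tau> "permute_list \<pi> ts" v "diagram_perm \<pi> D" \<pi>]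
    by (simp add: ts' Suc.hyps(2)[symmetric])
  moreover have "permute_list \<pi> (permute_list \<pi> ts) = ts" using permute_list_inv[OF \<pi>] by (simp add: inv)
  moreover have "diagram_perm \<pi> (diagram_perm \<pi> D) = D"
    by (simp add: diagram_perm_image image_image map_prod_def split_beta pp)
  ultimately show ?case by simp
qed

section \<open>The two categories\<close>

lemma listset_map_iff:
  "xs \<in> listset (map f ts) \<longleftrightarrow> length xs = length ts \<and> (\<forall>i<length ts. xs ! i \<in> f (ts ! i))"
  by (auto simp: in_listset_iff list_all2_conv_all_nth)

lemma algebra_nat_transI:
  assumes "\<alpha> \<in> (\<Pi>\<^sub>E t\<in>boxes \<tau>. onCol H t \<rightarrow>\<^sub>E onCol K t)"
    and "\<And>ts v D xs. \<lbrakk>D \<in> diagrams \<tau> ts v; xs \<in> listset (map (onCol H) ts)\<rbrakk>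
      \<Longrightarrow> \<alpha> v (onOps H ts v D xs) = onOps K ts v D (map2 \<alpha> ts xs)"
  shows "\<alpha> \<in> algebra_nat_trans \<tau> H K"
  using assms by (simp add: algebra_nat_trans_def)

lemma algebra_nat_transD:
  assumes "\<alpha> \<in> algebra_nat_trans \<tau> H K"
  shows "\<alpha> \<in> (\<Pi>\<^sub>E t\<in>boxes \<tau>. onCol H t \<rightarrow>\<^sub>E onCol K t)"
    and "\<lbrakk>t \<in> boxes \<tau>; x \<in> onCol H t\<rbrakk> \<Longrightarrow> \<alpha> t x \<in> onCol K t"
    and "\<lbrakk>D \<in> diagrams \<tau> ts v; xs \<in> listset (map (onCol H) ts)\<rbrakk>
      \<Longrightarrow> \<alpha> v (onOps H ts v D xs) = onOps K ts v D (map2 \<alpha> ts xs)"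
proof -
  show "\<alpha> \<in> (\<Pi>\<^sub>E t\<in>boxes \<tau>. onCol H t \<rightarrow>\<^sub>E onCol K t)"
    using assms by (simp add: algebra_nat_trans_def)
  then show "\<alpha> t x \<in> onCol K t" if "t \<in> boxes \<tau>" "x \<in> onCol H t"
    using that by (simp add: PiE_iff)
  show "\<alpha> v (onOps H ts v D xs) = onOps K ts v D (map2 \<alpha> ts xs)"
    if "D \<in> diagrams \<tau> ts v" "xs \<in> listset (map (onCol H) ts)"
    using assms that unfolding algebra_nat_trans_def mem_Collect_eq by blast
qed

lemma map2_in_listset:
  assumes "\<And>t x. \<lbrakk>t \<in> boxes \<tau>; x \<in> onCol H t\<rbrakk> \<Longrightarrow> \<alpha> t x \<in> onCol K t"
    and "set ts \<subseteq> boxes \<tau>" and "xs \<in> listset (map (onCol H) ts)"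
  shows "map2 \<alpha> ts xs \<in> listset (map (onCol K) ts)"
  unfolding listset_map_iff
proof (intro conjI allI impI)
  have l: "length xs = length ts" using assms(3) by (simp add: listset_map_iff)
  then show "length (map2 \<alpha> ts xs) = length ts" by simp
  fix i assume i: "i < length ts"
  then have "xs ! i \<in> onCol H (ts ! i)" using assms(3) by (simp add: listset_map_iff)
  with i l show "map2 \<alpha> ts xs ! i \<in> onCol K (ts ! i)"
    using assms(1)[OF subsetD[OF assms(2) nth_mem[OF i]]] by simp
qed

lemma map2_cong_listset:
  assumes "\<And>t x. \<lbrakk>t \<in> boxes \<tau>; x \<in> onCol H t\<rbrakk> \<Longrightarrow> \<alpha> t x = \<beta> t x"
    and "set ts \<subseteq> boxes \<tau>" and "xs \<in> listset (map (onCol H) ts)"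
  shows "map2 \<alpha> ts xs = map2 \<beta> ts xs"
proof (rule nth_equalityI)
  fix i assume "i < length (map2 \<alpha> ts xs)"
  then have i: "i < length ts" "i < length xs" by simp_all
  then have "xs ! i \<in> onCol H (ts ! i)" using assms(3) by (simp add: listset_map_iff)
  with i show "map2 \<alpha> ts xs ! i = map2 \<beta> ts xs ! i"
    using assms(1)[OF subsetD[OF assms(2) nth_mem[OF i(1)]]] by simp
qed simp

lemma map2_snd: "length xs = length ts \<Longrightarrow> map2 (\<lambda>t x. x) ts xs = xs"
  by (intro nth_equalityI) auto

lemma map2_compose:
  "length xs = length ts \<Longrightarrow> map2 \<beta> ts (map2 \<alpha> ts xs) = map2 (\<lambda>t x. \<beta> t (\<alpha> t x)) ts xs"
  by (intro nth_equalityI) auto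

lemma category_algebra_category: "category (algebra_category \<tau> :: (('t, 'a) algebra, _) category)"
  (is "category ?A")
proof
  fix H :: "('t, 'a) algebra" assume "H \<in> Obj ?A"
  then interpret wiring_algebra \<tau> H by (simp add: algebra_category_def wiring_algebra_def)
  show "Idt ?A H \<in> Hom ?A H H"
    unfolding algebra_category_def category.simps
  proof (rule algebra_nat_transI)
    fix ts v D xs assume D: "D \<in> diagrams \<tau> ts v" and xs: "xs \<in> listset (map (onCol H) ts)"
    have "map2 (\<lambda>t\<in>boxes \<tau>. \<lambda>x\<in>onCol H t. x) ts xs = map2 (\<lambda>t x. x) ts xs"
      using D by (intro map2_cong_listset[OF _ _ xs]) (auto simp: diagrams_iff)
    also have "\<dots> = xs" using xs by (intro map2_snd) (simp add: listset_map_iff)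
    finally show "(\<lambda>t\<in>boxes \<tau>. \<lambda>x\<in>onCol H t. x) v (onOps H ts v D xs) =
        onOps H ts v D (map2 (\<lambda>t\<in>boxes \<tau>. \<lambda>x\<in>onCol H t. x) ts xs)"
      using D ev_in[OF D xs] by (simp add: diagrams_iff)
  qed auto
next
  fix H K L :: "('t, 'a) algebra" and \<alpha> \<beta>
  assume "H \<in> Obj ?A" "K \<in> Obj ?A" and *: "\<alpha> \<in> Hom ?A H K" "\<beta> \<in> Hom ?A K L"
  then interpret H: wiring_algebra \<tau> H + K: wiring_algebra \<tau> K
    by (simp_all add: algebra_category_def wiring_algebra_def)
  have \<alpha>: "\<alpha> \<in> algebra_nat_trans \<tau> H K" and \<beta>: "\<beta> \<in> algebra_nat_trans \<tau> K L"
    using * by (simp_all add: algebra_category_def)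
  note A = algebra_nat_transD[OF \<alpha>] and B = algebra_nat_transD[OF \<beta>]
  let ?\<gamma> = "\<lambda>t\<in>boxes \<tau>. \<lambda>x\<in>onCol H t. \<beta> t (\<alpha> t x)"
  have "?\<gamma> \<in> algebra_nat_trans \<tau> H L"
  proof (rule algebra_nat_transI)
    show "?\<gamma> \<in> (\<Pi>\<^sub>E t\<in>boxes \<tau>. onCol H t \<rightarrow>\<^sub>E onCol L t)" using A(2) B(2) by auto
    fix ts v D xs assume D: "D \<in> diagrams \<tau> ts v" and xs: "xs \<in> listset (map (onCol H) ts)"
    have ts: "set ts \<subseteq> boxes \<tau>" and v: "v \<in> boxes \<tau>" using D by (auto simp: diagrams_iff)
    have "?\<gamma> v (onOps H ts v D xs) = \<beta> v (\<alpha> v (onOps H ts v D xs))"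
      using v H.ev_in[OF D xs] by simp
    also have "\<dots> = onOps L ts v D (map2 \<beta> ts (map2 \<alpha> ts xs))"
      using A(3)[OF D xs] B(3)[OF D map2_in_listset[OF A(2) ts xs]] by simp
    also have "map2 \<beta> ts (map2 \<alpha> ts xs) = map2 (\<lambda>t x. \<beta> t (\<alpha> t x)) ts xs"
      using xs by (intro map2_compose) (simp add: listset_map_iff)
    also have "\<dots> = map2 ?\<gamma> ts xs" by (rule map2_cong_listset[OF _ ts xs]) simp
    finally show "?\<gamma> v (onOps H ts v D xs) = onOps L ts v D (map2 ?\<gamma> ts xs)" .
  qed
  then show "Comp ?A H K L \<alpha> \<beta> \<in> Hom ?A H L" by (simp add: algebra_category_def)
next
  fix H K :: "('t, 'a) algebra" and \<alpha>
  assume "\<alpha> \<in> Hom ?A H K"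
  then have \<alpha>: "\<alpha> \<in> algebra_nat_trans \<tau> H K" by (simp add: algebra_category_def)
  note A = algebra_nat_transD[OF \<alpha>]
  \<comment> \<open>Transformations are extensional at both levels, over boxes and over elements, so
    the identity laws hold as equalities of functions.\<close>
  have eta: "\<alpha> = (\<lambda>t\<in>boxes \<tau>. \<lambda>x\<in>onCol H t. \<alpha> t x)"
    using A(1) by (fastforce simp: PiE_iff extensional_def fun_eq_iff)
  have "(\<lambda>t\<in>boxes \<tau>. \<lambda>x\<in>onCol H t. \<alpha> t ((\<lambda>t\<in>boxes \<tau>. \<lambda>x\<in>onCol H t. x) t x)) =
      (\<lambda>t\<in>boxes \<tau>. \<lambda>x\<in>onCol H t. \<alpha> t x)" by (intro restrict_ext) auto
  then show "Comp ?A H H K (Idt ?A H) \<alpha> = \<alpha>" using eta by (simp add: algebra_category_def)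
  have "(\<lambda>t\<in>boxes \<tau>. \<lambda>x\<in>onCol H t. (\<lambda>t\<in>boxes \<tau>. \<lambda>x\<in>onCol K t. x) t (\<alpha> t x)) =
      (\<lambda>t\<in>boxes \<tau>. \<lambda>x\<in>onCol H t. \<alpha> t x)" by (intro restrict_ext) (use A(2) in auto)
  then show "Comp ?A H K K \<alpha> (Idt ?A K) = \<alpha>" using eta by (simp add: algebra_category_def)
next
  fix H K L M :: "('t, 'a) algebra" and \<alpha> \<beta> \<gamma>
  assume "\<alpha> \<in> Hom ?A H K"
  then have \<alpha>: "\<alpha> \<in> algebra_nat_trans \<tau> H K" by (simp add: algebra_category_def)
  show "Comp ?A H L M (Comp ?A H K L \<alpha> \<beta>) \<gamma> = Comp ?A H K M \<alpha> (Comp ?A K L M \<beta> \<gamma>)"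
    unfolding algebra_category_def category.simps
    by (intro restrict_ext) (use algebra_nat_transD(2)[OF \<alpha>] in auto)
qed

section \<open>Symmetric monoidal categories on typed finite sets\<close>

lemma typed_smcsD:
  assumes "C \<in> typed_smcs \<tau>"
  shows "strict_symmetric_monoidal_category C" and "category C" and "Obj C = lists \<tau>"
    and "UnitOb C = []" and "\<lbrakk>A \<in> lists \<tau>; B \<in> lists \<tau>\<rbrakk> \<Longrightarrow> TensorOb C A B = A @ B"
  using assms
  by (auto simp: typed_smcs_def strict_symmetric_monoidal_category_def)

text \<open>The extensional function space already says that homs are mapped to homs, and both
  categories satisfy the category axioms, so being a functor reduces to two equations.\<close>

lemma id_on_objects_smc_functors_iff:
  assumes C: "C \<in> typed_smcs \<tau>" and D: "D \<in> typed_smcs \<tau>"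
  shows "G \<in> id_on_objects_smc_functors \<tau> C D \<longleftrightarrow>
    G \<in> (\<Pi>\<^sub>E A\<in>lists \<tau>. \<Pi>\<^sub>E B\<in>lists \<tau>. Hom C A B \<rightarrow>\<^sub>E Hom D A B) \<and>
    (\<forall>A\<in>lists \<tau>. G A A (Idt C A) = Idt D A) \<and>
    (\<forall>X\<in>lists \<tau>. \<forall>Y\<in>lists \<tau>. \<forall>Z\<in>lists \<tau>. \<forall>f\<in>Hom C X Y. \<forall>g\<in>Hom C Y Z.
      G X Z (Comp C X Y Z f g) = Comp D X Y Z (G X Y f) (G Y Z g)) \<and>
    (\<forall>A\<in>lists \<tau>. \<forall>B\<in>lists \<tau>. \<forall>A'\<in>lists \<tau>. \<forall>B'\<in>lists \<tau>. \<forall>f\<in>Hom C A B. \<forall>g\<in>Hom C A' B'.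
      G (A @ A') (B @ B') (Tensor C A B A' B' f g) = Tensor D A B A' B' (G A B f) (G A' B' g)) \<and>
    (\<forall>A\<in>lists \<tau>. \<forall>B\<in>lists \<tau>. G (A @ B) (B @ A) (Braid C A B) = Braid D A B)"
    (is "_ \<longleftrightarrow> ?P \<and> ?I \<and> ?C \<and> ?T \<and> ?B")
proof -
  have *: "cat_functor C D (\<lambda>A. A) G \<longleftrightarrow> ?I \<and> ?C" if P: ?P
  proof
    assume "cat_functor C D (\<lambda>A. A) G"
    then interpret cat_functor C D "\<lambda>A. A" G .
    show "?I \<and> ?C"
      using functor_Idt functor_Comp by (simp add: typed_smcsD(3)[OF C])
  next
    assume *: "?I \<and> ?C"
    have "G A B f \<in> Hom D A B" if "A \<in> lists \<tau>" "B \<in> lists \<tau>" "f \<in> Hom C A B" for A B f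
      using P that by (auto simp: PiE_iff)
    then show "cat_functor C D (\<lambda>A. A) G"
      using * typed_smcsD[OF C] typed_smcsD[OF D]
      by (intro cat_functor.intro cat_functor_axioms.intro) auto
  qed
  show ?thesis
  proof (cases ?P)
    case True
    from *[OF this] this show ?thesis
      unfolding id_on_objects_smc_functors_def mem_Collect_eq by (simp only: simp_thms conj_assoc)
  next
    case False
    then show ?thesis
      unfolding id_on_objects_smc_functors_def mem_Collect_eq by (simp only: simp_thms)
  qed
qed

lemma category_smc_category: "category (smc_category \<tau> :: (('t, 'a) typed_smc, _) category)"
  (is "category ?S")
proof
  fix C :: "('t, 'a) typed_smc" assume "C \<in> Obj ?S"
  then have C: "C \<in> typed_smcs \<tau>" by (simp add: smc_category_def)
  note o = typed_smcsD[OF C]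
  interpret strict_symmetric_monoidal_category C by (rule o(1))
  \<comment> \<open>\<open>TensorOb C\<close> is known to be concatenation only on
    \<open>lists \<tau>\<close>, so the typing of products is restated with \<open>@\<close> for
    such objects.\<close>
  have "Tensor C A B A' B' f g \<in> Hom C (A @ A') (B @ B')"
    if "A \<in> lists \<tau>" "B \<in> lists \<tau>" "A' \<in> lists \<tau>" "B' \<in> lists \<tau>" "f \<in> Hom C A B" "g \<in> Hom C A' B'"
    for A B A' B' f g using Tensor_in_Hom[of A B A' B' f g] that by (simp add: o)
  moreover have "Braid C A B \<in> Hom C (A @ B) (B @ A)" if "A \<in> lists \<tau>" "B \<in> lists \<tau>" for A B
    using Braid_in_Hom[of A B] that by (simp add: o)
  ultimately show "Idt ?S C \<in> Hom ?S C C"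
    unfolding smc_category_def category.simps id_on_objects_smc_functors_iff[OF C C]
    using Idt_in_Hom Comp_in_Hom by (auto simp: o)
next
  fix C D E :: "('t, 'a) typed_smc" and F G
  assume "C \<in> Obj ?S" "D \<in> Obj ?S" "E \<in> Obj ?S" and *: "F \<in> Hom ?S C D" "G \<in> Hom ?S D E"
  then have CDE: "C \<in> typed_smcs \<tau>" "D \<in> typed_smcs \<tau>" "E \<in> typed_smcs \<tau>"
    by (simp_all add: smc_category_def)
  note o = typed_smcsD[OF CDE(1)]
  interpret strict_symmetric_monoidal_category C by (rule o(1))
  have "Tensor C A B A' B' f g \<in> Hom C (A @ A') (B @ B')"
    if "A \<in> lists \<tau>" "B \<in> lists \<tau>" "A' \<in> lists \<tau>" "B' \<in> lists \<tau>" "f \<in> Hom C A B" "g \<in> Hom C A' B'"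
    for A B A' B' f g using Tensor_in_Hom[of A B A' B' f g] that by (simp add: o)
  moreover have "Braid C A B \<in> Hom C (A @ B) (B @ A)" if "A \<in> lists \<tau>" "B \<in> lists \<tau>" for A B
    using Braid_in_Hom[of A B] that by (simp add: o)
  moreover have F: "F A B f \<in> Hom D A B" if "A \<in> lists \<tau>" "B \<in> lists \<tau>" "f \<in> Hom C A B" for A B f
    using * that by (auto simp: smc_category_def id_on_objects_smc_functors_def PiE_iff)
  moreover have "G A B f \<in> Hom E A B" if "A \<in> lists \<tau>" "B \<in> lists \<tau>" "f \<in> Hom D A B" for A B f
    using * that by (auto simp: smc_category_def id_on_objects_smc_functors_def PiE_iff)
  moreover note * [unfolded smc_category_def category.simps
      id_on_objects_smc_functors_iff[OF CDE(1,2)] id_on_objects_smc_functors_iff[OF CDE(2,3)]]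
  ultimately show "Comp ?S C D E F G \<in> Hom ?S C E"
    unfolding smc_category_def category.simps id_on_objects_smc_functors_iff[OF CDE(1,3)]
    using Idt_in_Hom Comp_in_Hom by (auto simp: o)
next
  fix C D :: "('t, 'a) typed_smc" and F
  assume "F \<in> Hom ?S C D"
  then have F: "F \<in> (\<Pi>\<^sub>E A\<in>lists \<tau>. \<Pi>\<^sub>E B\<in>lists \<tau>. Hom C A B \<rightarrow>\<^sub>E Hom D A B)"
    by (simp add: smc_category_def id_on_objects_smc_functors_def)
  have eta: "F = (\<lambda>A\<in>lists \<tau>. \<lambda>B\<in>lists \<tau>. \<lambda>f\<in>Hom C A B. F A B f)"
    using F by (fastforce simp: PiE_iff extensional_def fun_eq_iff)
  have in_D: "F A B f \<in> Hom D A B" if "A \<in> lists \<tau>" "B \<in> lists \<tau>" "f \<in> Hom C A B" for A B f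
    using F that by (auto simp: PiE_iff)
  have "Comp ?S C C D (Idt ?S C) F = (\<lambda>A\<in>lists \<tau>. \<lambda>B\<in>lists \<tau>. \<lambda>f\<in>Hom C A B. F A B f)"
    unfolding smc_category_def category.simps by (intro restrict_ext) auto
  then show "Comp ?S C C D (Idt ?S C) F = F" using eta by simp
  have "Comp ?S C D D F (Idt ?S D) = (\<lambda>A\<in>lists \<tau>. \<lambda>B\<in>lists \<tau>. \<lambda>f\<in>Hom C A B. F A B f)"
    unfolding smc_category_def category.simps by (intro restrict_ext) (use in_D in auto)
  then show "Comp ?S C D D F (Idt ?S D) = F" using eta by simp
next
  fix C D E M :: "('t, 'a) typed_smc" and F G K
  assume F: "F \<in> Hom ?S C D"
  have in_D: "F A B f \<in> Hom D A B" if "A \<in> lists \<tau>" "B \<in> lists \<tau>" "f \<in> Hom C A B" for A B f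
    using F that by (auto simp: smc_category_def id_on_objects_smc_functors_def PiE_iff)
  show "Comp ?S C E M (Comp ?S C D E F G) K = Comp ?S C D M F (Comp ?S D E M G K)"
    unfolding smc_category_def category.simps by (intro restrict_ext) (use in_D in auto)
qed

section \<open>The fully faithful functor\<close>

lemma (in wiring_algebra) smc_of_algebra_typed: "\<C> \<in> typed_smcs \<tau>"
  by (simp add: typed_smcs_def smc_of_algebra_smc)

text \<open>Currying of the box argument. Each level is restricted separately, since functors are
  compared as extensional functions of \<open>A\<close>, of \<open>B\<close> and of the
  morphism.\<close>

definition smc_functor_of :: "'t set \<Rightarrow> ('t, 'a) algebra \<Rightarrow> ('t box \<Rightarrow> 'a \<Rightarrow> 'a) \<Rightarrow> 't list \<Rightarrow> 't list \<Rightarrow> 'a \<Rightarrow> 'a"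
  where "smc_functor_of \<tau> H \<alpha> = (\<lambda>A\<in>lists \<tau>. \<lambda>B\<in>lists \<tau>. \<lambda>f\<in>onCol H (A, B). \<alpha> (A, B) f)"

definition nat_trans_of :: "'t set \<Rightarrow> ('t, 'a) algebra \<Rightarrow> ('t list \<Rightarrow> 't list \<Rightarrow> 'a \<Rightarrow> 'a) \<Rightarrow> 't box \<Rightarrow> 'a \<Rightarrow> 'a"
  where "nat_trans_of \<tau> H G = (\<lambda>t\<in>boxes \<tau>. \<lambda>x\<in>onCol H t. G (fst t) (snd t) x)"

locale wiring_algebra_pair = H: wiring_algebra \<tau> H + K: wiring_algebra \<tau> K
  for \<tau> :: "'t set" and H K :: "('t, 'a) algebra"
begin

lemmas smc_functor_iff =
  id_on_objects_smc_functors_iff[OF H.smc_of_algebra_typed K.smc_of_algebra_typed]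

text \<open>Naturality with respect to the unit, sequential, parallel and braiding diagrams is
  precisely preservation of identities, composition, product and braiding.\<close>

lemma smc_functor_of_in_Hom:
  assumes "\<alpha> \<in> algebra_nat_trans \<tau> H K"
  shows "smc_functor_of \<tau> H \<alpha> \<in> id_on_objects_smc_functors \<tau> H.\<C> K.\<C>"
proof -
  note A = algebra_nat_transD[OF assms]
  let ?F = "smc_functor_of \<tau> H \<alpha>"
  have F: "?F A B f = \<alpha> (A, B) f" if "A \<in> lists \<tau>" "B \<in> lists \<tau>" "f \<in> onCol H (A, B)" for A B f
    using that by (simp add: smc_functor_of_def)
  note nullary = H.ev_in[where xs = "[]" and ts = "[]"] A(3)[where xs = "[]" and ts = "[]"]
  show ?thesis
    unfolding smc_functor_iff
  proof (intro conjI ballI)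
    show "?F \<in> (\<Pi>\<^sub>E A\<in>lists \<tau>. \<Pi>\<^sub>E B\<in>lists \<tau>. Hom H.\<C> A B \<rightarrow>\<^sub>E Hom K.\<C> A B)"
      using A(2) by (auto simp: smc_functor_of_def PiE_iff)
  next
    fix X assume X: "X \<in> lists \<tau>"
    show "?F X X (Idt H.\<C> X) = Idt K.\<C> X"
      using nullary[OF unit_in_diagrams[OF X]] X by (simp add: smc_of_algebra_def F)
  next
    fix X Y assume XY: "X \<in> lists \<tau>" "Y \<in> lists \<tau>"
    then have "X @ Y \<in> lists \<tau>" "Y @ X \<in> lists \<tau>" by auto
    from F[OF this] show "?F (X @ Y) (Y @ X) (Braid H.\<C> X Y) = Braid K.\<C> X Y"
      using nullary[OF braid_in_diagrams[OF XY]] by (simp add: smc_of_algebra_def)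
  next
    fix X Y Z f g
    assume *: "X \<in> lists \<tau>" "Y \<in> lists \<tau>" "Z \<in> lists \<tau>" "f \<in> Hom H.\<C> X Y" "g \<in> Hom H.\<C> Y Z"
    then have fg: "[f, g] \<in> listset (map (onCol H) [(X, Y), (Y, Z)])"
      by (simp add: in_listset_iff del: listset.simps)
    show "?F X Z (Comp H.\<C> X Y Z f g) = Comp K.\<C> X Y Z (?F X Y f) (?F Y Z g)"
      using H.ev_in[OF seq_in_diagrams[OF *(1-3)] fg] A(3)[OF seq_in_diagrams[OF *(1-3)] fg] *
      by (simp add: smc_of_algebra_def F)
  next
    fix X Y X' Y' f g
    assume *: "X \<in> lists \<tau>" "Y \<in> lists \<tau>" "X' \<in> lists \<tau>" "Y' \<in> lists \<tau>"
      "f \<in> Hom H.\<C> X Y" "g \<in> Hom H.\<C> X' Y'"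
    then have fg: "[f, g] \<in> listset (map (onCol H) [(X, Y), (X', Y')])"
      by (simp add: in_listset_iff del: listset.simps)
    have XX: "X @ X' \<in> lists \<tau>" "Y @ Y' \<in> lists \<tau>" using * by auto
    show "?F (X @ X') (Y @ Y') (Tensor H.\<C> X Y X' Y' f g) =
        Tensor K.\<C> X Y X' Y' (?F X Y f) (?F X' Y' g)"
      using H.ev_in[OF para_in_diagrams[OF *(1-4)] fg] A(3)[OF para_in_diagrams[OF *(1-4)] fg] * F[OF XX]
      by (simp add: smc_of_algebra_def F)
  qed
qed

text \<open>For the monoidal generators the functor laws of \<open>G\<close> do the work, because
  composites of diagrams evaluate to composites of morphisms in both categories. For a single box
  and for reorderings, the two algebras behave in the same way by preservation of identities and
  equivariance.\<close>

lemma nat_trans_of_natural: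
  assumes G: "G \<in> id_on_objects_smc_functors \<tau> H.\<C> K.\<C>" and gen: "generated \<tau> ts v D"
    and xs: "xs \<in> listset (map (onCol H) ts)"
  shows "nat_trans_of \<tau> H G v (onOps H ts v D xs) = onOps K ts v D (map2 (nat_trans_of \<tau> H G) ts xs)"
  using gen xs
proof (induction arbitrary: xs rule: generated.induct)
  note G' = G[unfolded smc_functor_iff]
  let ?\<alpha> = "nat_trans_of \<tau> H G"
  have \<alpha>: "?\<alpha> (A, B) x = G A B x" if "A \<in> lists \<tau>" "B \<in> lists \<tau>" "x \<in> onCol H (A, B)" for A B x
    using that by (simp add: nat_trans_of_def)
  have \<alpha>_in: "?\<alpha> t x \<in> onCol K t" if "t \<in> boxes \<tau>" "x \<in> onCol H t" for t x
    using G' that by (cases t) (auto simp: nat_trans_of_def PiE_iff)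
  have in_K: "map2 ?\<alpha> us ws \<in> listset (map (onCol K) us)"
    if "set us \<subseteq> boxes \<tau>" "ws \<in> listset (map (onCol H) us)" for us ws
    using map2_in_listset[of \<tau> H ?\<alpha> K us ws] \<alpha>_in that by blast
  {
    case (gen_id t)
    then obtain x where x: "xs = [x]" "x \<in> onCol H t" by (auto simp: set_Cons_def)
    then show ?case using gen_id.hyps H.ev_id K.ev_id \<alpha>_in by simp
  next
    case (gen_unit A)
    then have "onOps H [] (A, A) (unit_diagram A) [] \<in> onCol H (A, A)"
      using H.ev_in[OF unit_in_diagrams] by simp
    then show ?case using gen_unit G' by (simp add: \<alpha> smc_of_algebra_def)
  next
    case (gen_braid A B)
    then have "A @ B \<in> lists \<tau>" "B @ A \<in> lists \<tau>" by auto
    moreover have "onOps H [] (A @ B, B @ A) (braid_diagram A B) [] \<in> onCol H (A @ B, B @ A)"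
      using gen_braid H.ev_in[OF braid_in_diagrams] by simp
    moreover have "G (A @ B) (B @ A) (Braid H.\<C> A B) = Braid K.\<C> A B" using G' gen_braid by blast
    ultimately show ?case using gen_braid by (simp add: \<alpha> smc_of_algebra_def)
  next
    case (gen_seq ts A B D ss C E)
    note DE = gen_seq.hyps[THEN generated_in_diagrams]
    have l: "A \<in> lists \<tau>" "B \<in> lists \<tau>" "C \<in> lists \<tau>" "set ts \<subseteq> boxes \<tau>" "set ss \<subseteq> boxes \<tau>"
      using DE by (auto simp: diagrams_iff)
    from gen_seq.prems obtain ys zs where xs: "xs = ys @ zs"
      and yz: "ys \<in> listset (map (onCol H) ts)" "zs \<in> listset (map (onCol H) ss)"
      by (auto simp: in_listset_iff list_all2_append2)
    have len: "length ys = length ts" using yz by (simp add: listset_map_iff)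
    note in_H = H.ev_in[OF DE(1) yz(1)] H.ev_in[OF DE(2) yz(2)]
    \<comment> \<open>The diagram is traded for a composite in the first category, \<open>G\<close>
      is moved inside, and the composite is reassembled in the second category.\<close>
    note C_H = H.Comp_ev[OF DE yz] and C_K = K.Comp_ev[OF DE in_K[OF l(4) yz(1)] in_K[OF l(5) yz(2)]]
    have "G A C (Comp H.\<C> A B C (onOps H ts (A, B) D ys) (onOps H ss (B, C) E zs)) =
        Comp K.\<C> A B C (G A B (onOps H ts (A, B) D ys)) (G B C (onOps H ss (B, C) E zs))"
      using G' l in_H by (simp)
    also have "\<dots> = Comp K.\<C> A B C (onOps K ts (A, B) D (map2 ?\<alpha> ts ys)) (onOps K ss (B, C) E (map2 ?\<alpha> ss zs))"
      using gen_seq.IH(1)[OF yz(1)] gen_seq.IH(2)[OF yz(2)] by (simp only: \<alpha> l in_H)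
    finally have "G A C (onOps H (ts @ ss) (A, C) (seq_comp ts ss A B C D E) xs) =
        onOps K (ts @ ss) (A, C) (seq_comp ts ss A B C D E) (map2 ?\<alpha> (ts @ ss) xs)"
      unfolding C_H C_K by (simp add: xs len)
    moreover have "onOps H (ts @ ss) (A, C) (seq_comp ts ss A B C D E) xs \<in> onCol H (A, C)"
      by (rule H.ev_in[OF generated_in_diagrams[OF generated.gen_seq[OF gen_seq.hyps]] gen_seq.prems])
    ultimately show ?case by (simp only: \<alpha> l)
  next
    case (gen_par ts A B D ss A' B' E)
    note DE = gen_par.hyps[THEN generated_in_diagrams]
    have l: "A \<in> lists \<tau>" "B \<in> lists \<tau>" "A' \<in> lists \<tau>" "B' \<in> lists \<tau>" "set ts \<subseteq> boxes \<tau>" "set ss \<subseteq> boxes \<tau>"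
      "A @ A' \<in> lists \<tau>" "B @ B' \<in> lists \<tau>"
      using DE by (auto simp: diagrams_iff)
    from gen_par.prems obtain ys zs where xs: "xs = ys @ zs"
      and yz: "ys \<in> listset (map (onCol H) ts)" "zs \<in> listset (map (onCol H) ss)"
      by (auto simp: in_listset_iff list_all2_append2)
    have len: "length ys = length ts" using yz by (simp add: listset_map_iff)
    note in_H = H.ev_in[OF DE(1) yz(1)] H.ev_in[OF DE(2) yz(2)]
    note C_H = H.Tensor_ev[OF DE yz] and C_K = K.Tensor_ev[OF DE in_K[OF l(5) yz(1)] in_K[OF l(6) yz(2)]]
    have "G (A @ A') (B @ B') (Tensor H.\<C> A B A' B' (onOps H ts (A, B) D ys) (onOps H ss (A', B') E zs)) =
        Tensor K.\<C> A B A' B' (G A B (onOps H ts (A, B) D ys)) (G A' B' (onOps H ss (A', B') E zs))"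
      using G' l in_H by (simp)
    also have "\<dots> = Tensor K.\<C> A B A' B' (onOps K ts (A, B) D (map2 ?\<alpha> ts ys))
        (onOps K ss (A', B') E (map2 ?\<alpha> ss zs))"
      using gen_par.IH(1)[OF yz(1)] gen_par.IH(2)[OF yz(2)] by (simp only: \<alpha> l in_H)
    finally have "G (A @ A') (B @ B') (onOps H (ts @ ss) (A @ A', B @ B') (par_comp ts ss A B A' B' D E) xs) =
        onOps K (ts @ ss) (A @ A', B @ B') (par_comp ts ss A B A' B' D E) (map2 ?\<alpha> (ts @ ss) xs)"
      unfolding C_H C_K by (simp add: xs len)
    moreover have "onOps H (ts @ ss) (A @ A', B @ B') (par_comp ts ss A B A' B' D E) xs
        \<in> onCol H (A @ A', B @ B')"
      by (rule H.ev_in[OF generated_in_diagrams[OF generated.gen_par[OF gen_par.hyps]] gen_par.prems])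
    ultimately show ?case by (simp only: \<alpha> l)
  next
    case (gen_perm ts v D \<pi>)
    note D = generated_in_diagrams[OF gen_perm.hyps(1)] and \<pi> = gen_perm.hyps(2)
    \<comment> \<open>Every argument list of the reordered diagram is the reordering of an argument
      list of the original one, to which the induction hypothesis applies.\<close>
    define ys where "ys = permute_list (inv \<pi>) xs"
    have l: "length xs = length ts" using gen_perm.prems by (simp add: listset_map_iff)
    have inv: "inv \<pi> permutes {..<length ts}" by (rule permutes_inv[OF \<pi>])
    have xs: "xs = permute_list \<pi> ys"
      using permute_list_inv[of "inv \<pi>" xs] inv l by (simp add: ys_def inv_inv_eq[OF permutes_bij[OF \<pi>]])
    have "ys ! i \<in> onCol H (ts ! i)" if i: "i < length ts" for i
    proof -
      have "inv \<pi> i < length ts" using permutes_in_image[OF inv] i by simp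
      then have "xs ! inv \<pi> i \<in> onCol H (permute_list \<pi> ts ! inv \<pi> i)"
        using gen_perm.prems by (simp add: listset_map_iff)
      then show ?thesis
        using i l inv \<open>inv \<pi> i < length ts\<close>
        by (simp add: ys_def permute_list_nth permute_list_nth[OF \<pi>] permutes_inverses[OF \<pi>])
    qed
    then have ys: "ys \<in> listset (map (onCol H) ts)" by (simp add: listset_map_iff ys_def l)
    have ts: "set ts \<subseteq> boxes \<tau>" using D by (simp add: diagrams_iff)
    have "permute_list \<pi> (map2 ?\<alpha> ts ys) = map2 ?\<alpha> (permute_list \<pi> ts) xs"
      using \<pi> ys by (simp add: xs permute_list_map permute_list_zip listset_map_iff)
    then show ?case
      using gen_perm.IH[OF ys] H.ev_perm[OF \<pi> D ys] K.ev_perm[OF \<pi> D in_K[OF ts ys]]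
      by (simp add: xs)
  }
qed

text \<open>The source of fullness: since every diagram is generated, preserving the monoidal
  structure already implies naturality for all diagrams.\<close>

lemma nat_trans_of_in_Hom:
  assumes G: "G \<in> id_on_objects_smc_functors \<tau> H.\<C> K.\<C>"
  shows "nat_trans_of \<tau> H G \<in> algebra_nat_trans \<tau> H K"
proof (rule algebra_nat_transI)
  show "nat_trans_of \<tau> H G \<in> (\<Pi>\<^sub>E t\<in>boxes \<tau>. onCol H t \<rightarrow>\<^sub>E onCol K t)"
    using G by (auto simp: nat_trans_of_def smc_functor_iff PiE_iff)
qed (rule nat_trans_of_natural[OF G diagram_generated])

lemma nat_trans_of_smc_functor_of:
  assumes "\<alpha> \<in> algebra_nat_trans \<tau> H K"
  shows "nat_trans_of \<tau> H (smc_functor_of \<tau> H \<alpha>) = \<alpha>"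
proof (rule PiE_ext[OF _ algebra_nat_transD(1)[OF assms]])
  show "nat_trans_of \<tau> H (smc_functor_of \<tau> H \<alpha>) \<in> (\<Pi>\<^sub>E t\<in>boxes \<tau>. onCol H t \<rightarrow>\<^sub>E onCol K t)"
    using algebra_nat_transD(1)[OF nat_trans_of_in_Hom[OF smc_functor_of_in_Hom[OF assms]]] .
  fix t assume t: "t \<in> boxes \<tau>"
  have "\<alpha> t \<in> onCol H t \<rightarrow>\<^sub>E onCol K t" using algebra_nat_transD(1)[OF assms] t by auto
  then show "nat_trans_of \<tau> H (smc_functor_of \<tau> H \<alpha>) t = \<alpha> t"
    using t by (cases t) (auto simp: nat_trans_of_def smc_functor_of_def PiE_iff extensional_def fun_eq_iff)
qed

lemma smc_functor_of_nat_trans_of: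
  assumes "G \<in> id_on_objects_smc_functors \<tau> H.\<C> K.\<C>"
  shows "smc_functor_of \<tau> H (nat_trans_of \<tau> H G) = G"
proof (intro ext)
  fix A B f
  have "G \<in> (\<Pi>\<^sub>E A\<in>lists \<tau>. \<Pi>\<^sub>E B\<in>lists \<tau>. onCol H (A, B) \<rightarrow>\<^sub>E onCol K (A, B))"
    using assms by (simp add: smc_functor_iff)
  then show "smc_functor_of \<tau> H (nat_trans_of \<tau> H G) A B f = G A B f"
    by (auto simp: nat_trans_of_def smc_functor_of_def PiE_iff extensional_def)
qed

lemma bij_betw_smc_functor_of:
  "bij_betw (smc_functor_of \<tau> H) (algebra_nat_trans \<tau> H K) (id_on_objects_smc_functors \<tau> H.\<C> K.\<C>)"
  by (rule bij_betw_byWitness[of _ "nat_trans_of \<tau> H"])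
    (auto simp: nat_trans_of_smc_functor_of smc_functor_of_nat_trans_of smc_functor_of_in_Hom
      nat_trans_of_in_Hom)

end

lemma smc_of_algebra_functor:
  fixes \<tau> :: "'t set"
  shows "cat_functor (algebra_category \<tau>) (smc_category \<tau>) (smc_of_algebra \<tau>) (\<lambda>H K. smc_functor_of \<tau> H)"
proof (intro cat_functor.intro cat_functor_axioms.intro category_algebra_category category_smc_category)
  fix H :: "('t, 'a) algebra" assume "H \<in> Obj (algebra_category \<tau>)"
  then interpret wiring_algebra \<tau> H by (simp add: algebra_category_def wiring_algebra_def)
  show "\<C> \<in> Obj (smc_category \<tau>)" by (simp add: smc_category_def smc_of_algebra_typed)
  show "smc_functor_of \<tau> H (Idt (algebra_category \<tau>) H) = Idt (smc_category \<tau>) \<C>"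
    by (auto simp: smc_functor_of_def algebra_category_def smc_category_def
        intro!: restrict_ext)
next
  fix H K :: "('t, 'a) algebra" and \<alpha>
  assume "H \<in> Obj (algebra_category \<tau>)" "K \<in> Obj (algebra_category \<tau>)"
    and \<alpha>: "\<alpha> \<in> Hom (algebra_category \<tau>) H K"
  then interpret wiring_algebra_pair \<tau> H K
    by (simp add: algebra_category_def wiring_algebra_def wiring_algebra_pair_def)
  show "smc_functor_of \<tau> H \<alpha> \<in> Hom (smc_category \<tau>) H.\<C> K.\<C>"
    using \<alpha> by (simp add: algebra_category_def smc_category_def smc_functor_of_in_Hom)
next
  fix H K L :: "('t, 'a) algebra" and \<alpha> \<beta>
  assume "\<alpha> \<in> Hom (algebra_category \<tau>) H K"
  then have \<alpha>: "\<alpha> \<in> algebra_nat_trans \<tau> H K" by (simp add: algebra_category_def)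
  show "smc_functor_of \<tau> H (Comp (algebra_category \<tau>) H K L \<alpha> \<beta>) =
      Comp (smc_category \<tau>) (smc_of_algebra \<tau> H) (smc_of_algebra \<tau> K) (smc_of_algebra \<tau> L)
        (smc_functor_of \<tau> H \<alpha>) (smc_functor_of \<tau> K \<beta>)"
    using algebra_nat_transD(2)[OF \<alpha>]
    by (auto simp: smc_functor_of_def algebra_category_def smc_category_def
        intro!: restrict_ext)
qed

lemma smc_of_algebra_fully_faithful:
  fixes \<tau> :: "'t set"
  shows "fully_faithful (algebra_category \<tau>) (smc_category \<tau>) (smc_of_algebra \<tau>) (\<lambda>H K. smc_functor_of \<tau> H)"
  unfolding fully_faithful_def
proof (intro ballI)
  fix H K :: "('t, 'a) algebra"
  assume "H \<in> Obj (algebra_category \<tau>)" "K \<in> Obj (algebra_category \<tau>)"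
  then interpret wiring_algebra_pair \<tau> H K
    by (simp add: algebra_category_def wiring_algebra_def wiring_algebra_pair_def)
  show "bij_betw (smc_functor_of \<tau> H) (Hom (algebra_category \<tau>) H K) (Hom (smc_category \<tau>) H.\<C> K.\<C>)"
    using bij_betw_smc_functor_of by (simp add: algebra_category_def smc_category_def)
qed

theorem theorem5p2:
  fixes \<tau> :: "'t set"
  shows "\<exists>(F :: ('t, 'a) algebra \<Rightarrow> ('t, 'a) typed_smc) F'.
    cat_functor (algebra_category \<tau>) (smc_category \<tau>) F F' \<and>
    fully_faithful (algebra_category \<tau>) (smc_category \<tau>) F F' \<and>
    (\<forall>H. operad_functor (wiring_operad \<tau>) Set_operad H \<longrightarrow>
      (\<forall>A\<in>lists \<tau>. \<forall>B\<in>lists \<tau>. Hom (F H) A B = onCol H (A, B)) \<and>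
      (\<forall>A\<in>lists \<tau>. Idt (F H) A = onOps H [] (A, A) (unit_diagram A) []) \<and>
      (\<forall>A\<in>lists \<tau>. \<forall>B\<in>lists \<tau>. \<forall>C\<in>lists \<tau>. \<forall>f\<in>onCol H (A, B). \<forall>g\<in>onCol H (B, C).
        Comp (F H) A B C f g =
        onOps H [(A, B), (B, C)] (A, C) (seq_diagram A B C) [f, g]) \<and>
      (\<forall>A\<in>lists \<tau>. \<forall>B\<in>lists \<tau>. \<forall>A'\<in>lists \<tau>. \<forall>B'\<in>lists \<tau>.
        \<forall>f\<in>onCol H (A, B). \<forall>g\<in>onCol H (A', B').
        Tensor (F H) A B A' B' f g =
        onOps H [(A, B), (A', B')] (A @ A', B @ B') (para_diagram A B A' B') [f, g]))"
proof (intro exI conjI)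
  show "cat_functor (algebra_category \<tau>) (smc_category \<tau>) (smc_of_algebra \<tau>) (\<lambda>H K. smc_functor_of \<tau> H)"
    by (rule smc_of_algebra_functor)
  show "fully_faithful (algebra_category \<tau>) (smc_category \<tau>) (smc_of_algebra \<tau>) (\<lambda>H K. smc_functor_of \<tau> H)"
    by (rule smc_of_algebra_fully_faithful)
qed (simp add: smc_of_algebra_def)

end
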